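(* Let $c > 2$ be a non-integer. For any $A \geq 1$ there exists $B \geq 1$ such that if $M = \frac{N^{1/c}}{\log^B N}$, then \[ \sum_{\xi=0}^{N-1} \left|\frac{\hat{\Lambda}(\xi)}{N}\right|^2 \left(\frac{1}{M}\sum_{m=1}^{M} e\!\left(-\frac{\xi \lfloor m^c \rfloor}{N}\right)\right) = 1 + O\!\left(\frac{1}{\log^A N}\right). \]
   Context: $\Lambda$ is the von Mangoldt function ($\Lambda(n)=\log p$ if $n=p^k$ with $p$ prime and $k\ge 1$, and $0$ otherwise). $e(x) = e^{2\pi i x}$. $\hat{\Lambda}(\xi) = \sum_{n=1}^{N} \Lambda(n)\, e(-\xi n/N)$ for $\xi \in \mathbb{Z}/N\mathbb{Z}$ (Fourier transform of $\Lambda$ restricted to $\{1,\dots,N\}$, viewed on $\mathbb{Z}/N\mathbb{Z}$). Sums with non-integer upper limit $M$ run over integers $m \le M$. *)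

theory Defs
  imports
    Complex_Main
    "HOL-Library.Landau_Symbols"
    "HOL-Number_Theory.Prime_Powers"
begin

definition e :: "real \<Rightarrow> complex" where
  "e x = exp (2 * complex_of_real pi * \<i> * complex_of_real x)"

(* An element of Z/NZ is given by an integer representative; the value depends only on xi mod N. *)
definition mangoldt_hat :: "nat \<Rightarrow> int \<Rightarrow> complex" where
  "mangoldt_hat N \<xi> = (\<Sum>n=1..N. mangoldt n * e (- (of_int \<xi> * of_nat n / of_nat N)))"

end

theory Submission
  imports Defs "HOL-Complex_Analysis.Complex_Analysis" "HOL-Real_Asymp.Real_Asymp"
begin

text \<open>
  The frequency \<open>\<xi> = 0\<close> contributes \<open>(\<psi>(N)/N)\<^sup>2\<close>, which is 1 up to any power of \<open>1 / ln N\<close> by the prime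
  number theorem. Frequencies within a power of \<open>ln N\<close> of 0 modulo \<open>N\<close> are few, and there partial summation against the prime
  number theorem makes the transform of \<open>\<Lambda>\<close> tiny. At all other frequencies the average of
  \<open>e(-\<xi>\<lfloor>m\<^sup>c\<rfloor>/N)\<close> saves any power of \<open>ln N\<close> by van der Corput's method, and Parseval suffices.
  The choice \<open>B = 1\<close> always works.

  The error term of the prime number theorem is obtained without shifting contours past \<open>Re s = 1\<close>: the \<open>k\<close>-th
  derivative of \<open>- \<zeta>'/\<zeta> - \<zeta>\<close> grows only like a power of \<open>ln |t|\<close>, uniformly up to the line \<open>Re s = 1\<close>, by Cauchy's
  estimate and the 3-4-1 inequality. By Perron's formula this bounds the sum of
  \<open>(\<Lambda>(n) - 1) ln(n)\<^sup>k (1 - n/N)\<close> by \<open>O(N)\<close>, and the weight \<open>ln(n)\<^sup>k\<close> is a saving of \<open>k\<close> logarithms.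
\<close>

section \<open>Exponential sums with phase \<open>m\<^sup>c\<close>\<close>

text \<open>The only major arc lies at 0. Let r be the residue of \<xi> nearest to 0 and \<theta> =
  - r / N. Removing the floor leaves phases (\<theta> + k) m^c with integers k, and here it is
  decisive that c is not an integer: for integral c the phase k m^c would be an integer, whereas now
  the factors c (c - 1) ... (c - i) never vanish and every derivative of the phase has a known sign
  and size. For k \<noteq> 0 the frequency is at least 1/2 in size, so cancellation can fail only
  for k = 0, when |\<theta>| M^c is below a power of the logarithm.

  Since M^c = N / ln(N)^c for B = 1, this happens only when |r| is at most a power of ln N. The
  obstacle is that this power grows with the required saving: the remaining residues are bounded one
  by one, each losing a factor |r|, so the error term of the prime number theorem must beat every
  power of the logarithm. On the other side Parseval with \<Lambda> \<le> ln N loses two logarithms,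
  which the exponential sums must save on top of A.\<close>

lemma e_add: "e (x + y) = e x * e y"
  by (simp add: e_def exp_add[symmetric] algebra_simps)

lemma norm_e [simp]: "cmod (e x) = 1"
  by (simp add: e_def norm_exp_eq_Re)

lemma e_cis: "e x = cis (2 * pi * x)"
  by (simp add: e_def cis_conv_exp mult_ac)

lemma e_of_int [simp]: "e (of_int k) = 1"
  using cis_multiple_2pi[of "of_int k"] by (simp add: e_cis mult_ac)

lemma e_0 [simp]: "e 0 = 1"
  by (simp add: e_cis)

lemma e_uminus: "e (- x) = cnj (e x)"
  by (simp add: e_cis cis_cnj)

lemma e_diff: "e (x - y) = e x * cnj (e y)"
  using e_add[of x "-y"] by (simp add: e_uminus)

section \<open>The Kuzmin-Landau inequality\<close>

lemma sin_pi_ge: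
  assumes "0 \<le> x" "x \<le> 1 / 2"
  shows "2 * x \<le> sin (pi * x)"
proof -
  \<comment> \<open>Jordan's inequality: the sine is concave on [0, pi] and hence lies above its
    chord over [0, pi / 2]. Concavity is phrased as convexity of \<open>- sin\<close>.\<close>
  have "convex_on {0..pi} (\<lambda>x. - sin x)"
    by (rule convex_on_realI[where f' = "\<lambda>x. - cos x"])
       (auto intro!: derivative_eq_intros cos_monotone_0_pi_le)
  hence "convex_on {0..pi/2} (\<lambda>x. - sin x)"
    by (rule convex_on_subset) auto
  from convex_onD_Icc'[OF this, of "pi * x"] assms
  have "- sin (pi * x) \<le> (- sin (pi/2) - (- sin 0)) / (pi/2 - 0) * (pi * x - 0) + (- sin 0)"
    by auto
  thus ?thesis by (simp add: field_simps)
qed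

lemma sin_pi_ge':
  assumes "0 < \<delta>" "\<delta> \<le> x" "x \<le> 1 - \<delta>"
  shows "2 * \<delta> \<le> sin (pi * x)"
proof (cases "x \<le> 1 / 2")
  case True
  with sin_pi_ge[of x] assms show ?thesis by simp
next
  case False
  have "sin (pi * x) = sin (pi * (1 - x))"
    by (simp add: algebra_simps sin_diff)
  with sin_pi_ge[of "1 - x"] assms False show ?thesis by simp
qed

text \<open>This is \<open>1 / (1 - e x)\<close>; the cotangent form makes its variation along a monotone sequence telescope.\<close>

definition kl_weight :: "real \<Rightarrow> complex" where
  "kl_weight x = Complex (1 / 2) (cot (pi * x) / 2)"

lemma kl_weight_mult:
  assumes "sin (pi * x) \<noteq> 0"
  shows "(1 - e x) * kl_weight x = 1"
proof -
  define y where "y = pi * x"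
  have e: "e x = Complex (1 - 2 * sin y ^ 2) (2 * sin y * cos y)"
    using cos_double_sin[of y] sin_double[of y]
    by (simp add: complex_eq_iff e_cis y_def mult.assoc)
  have "cos y * (cos y * 2) + sin y * (sin y * 2) = 2"
    using sin_cos_squared_add[of y] by (simp add: power2_eq_square)
  moreover have "sin y \<noteq> 0" using assms by (simp add: y_def)
  ultimately show ?thesis
    unfolding e kl_weight_def y_def[symmetric]
    by (simp add: complex_eq_iff cot_def power2_eq_square field_simps)
qed

lemma abs_cot_le:
  assumes "0 < \<delta>" "\<delta> \<le> x" "x \<le> 1 - \<delta>"
  shows "\<bar>cot (pi * x)\<bar> \<le> 1 / (2 * \<delta>)"
proof -
  have s: "2 * \<delta> \<le> sin (pi * x)" by (rule sin_pi_ge'[OF assms])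
  have "\<bar>cot (pi * x)\<bar> = \<bar>cos (pi * x)\<bar> / sin (pi * x)"
    using s assms(1) by (simp add: cot_def abs_divide)
  also have "\<dots> \<le> 1 / (2 * \<delta>)"
    using s assms(1) by (intro frac_le) auto
  finally show ?thesis .
qed

lemma cot_antimono:
  assumes "0 < x" "x \<le> y" "y < 1"
  shows "cot (pi * y) \<le> cot (pi * x)"
proof -
  have 1: "sin (pi * x) > 0" "sin (pi * y) > 0" 
    using assms by (auto intro!: sin_gt_zero)
  have "0 \<le> sin (pi * y - pi * x)"
    using assms by (intro sin_ge_zero) (auto simp flip: right_diff_distrib intro: mult_left_mono intro!: mult_left_le)
  thus ?thesis using 1 by (simp add: cot_def sin_diff field_simps)
qed

text \<open>With \<open>w n\<close> equal to 1 / (1 - \<open>e (d n)\<close>), each summand is the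
  difference \<open>w n * e (f n) - w n * e (f (Suc n))\<close>, so summation by parts leaves
  boundary terms and the variation of \<open>w\<close>. The increments increase inside one unit
  interval, at distance \<delta> from its ends. There the real part of \<open>w\<close> is constant
  and the imaginary part, half a cotangent, is monotone: the variation telescopes instead of growing
  with the number of terms.\<close>

lemma kuzmin_landau:
  fixes f :: "nat \<Rightarrow> real" and k :: int
  assumes "a \<le> b" "0 < \<delta>" "\<delta> \<le> 1 / 2"
  assumes mono: "\<And>n. a \<le> n \<Longrightarrow> Suc n < b \<Longrightarrow> f (Suc n) - f n \<le> f (Suc (Suc n)) - f (Suc n)"
  assumes bd: "\<And>n. a \<le> n \<Longrightarrow> n < b \<Longrightarrow> of_int k + \<delta> \<le> f (Suc n) - f n"
    "\<And>n. a \<le> n \<Longrightarrow> n < b \<Longrightarrow> f (Suc n) - f n \<le> of_int k + 1 - \<delta>"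
  shows "cmod (\<Sum>n=a..b. e (f n)) \<le> 2 / \<delta>"
proof -
  define d where "d n = f (Suc n) - f n - of_int k" for n
  define w where "w n = kl_weight (d n)" for n
  have d: "\<delta> \<le> d n" "d n \<le> 1 - \<delta>" if "a \<le> n" "n < b" for n
    using bd[OF that] by (auto simp: d_def)
  have dm: "d n \<le> d (Suc n)" if "a \<le> n" "Suc n < b" for n
    using mono[OF that] by (auto simp: d_def)
  have e1: "(1 - e (d n)) * w n = 1" if "a \<le> n" "n < b" for n
    unfolding w_def using sin_pi_ge'[OF assms(2) d[OF that]] assms(2) by (intro kl_weight_mult) auto
  have eS: "e (f (Suc n)) = e (f n) * e (d n)" for n
  proof -
    have "f (Suc n) = f n + (d n + of_int k)" by (simp add: d_def)
    thus ?thesis by (simp add: e_add)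
  qed
  have e2: "w n * e (f (Suc n)) = w n * e (f n) - e (f n)" if "a \<le> n" "n < b" for n
  proof -
    have "w n * e (f n) - w n * e (f (Suc n)) = ((1 - e (d n)) * w n) * e (f n)"
      unfolding eS by (simp add: algebra_simps)
    thus ?thesis unfolding e1[OF that] by (simp add: algebra_simps)
  qed
  have wn: "cmod (w n) \<le> 1 / 2 + 1 / (4 * \<delta>)" if "a \<le> n" "n < b" for n
  proof -
    have "cmod (w n) \<le> \<bar>Re (w n)\<bar> + \<bar>Im (w n)\<bar>" by (rule cmod_le)
    also have "\<dots> \<le> 1 / 2 + 1 / (4 * \<delta>)"
      using abs_cot_le[OF assms(2) d[OF that]] by (simp add: w_def kl_weight_def)
    finally show ?thesis .
  qed
  \<comment> \<open>The partial sum completed by its boundary term: one step changes it only by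
    \<open>(w (Suc n) - w n) * e (f (Suc n))\<close>, of norm half the decrease of the
    cotangent.\<close>
  have key: "m < b \<longrightarrow> cmod ((\<Sum>n=a..<m. e (f n)) + w m * e (f m))
      \<le> 1 / 2 + 1 / (4 * \<delta>) + (cot (pi * d a) - cot (pi * d m)) / 2" if "a \<le> m" for m
    using that
  proof (induction m rule: dec_induct)
    case base
    show ?case using wn[of a] by (auto simp: norm_mult)
  next
    case (step n)
    show ?case
    proof
      assume n: "Suc n < b"
      have "(\<Sum>n=a..<Suc n. e (f n)) + w (Suc n) * e (f (Suc n)) = 
         ((\<Sum>n=a..<n. e (f n)) + w n * e (f n)) + (w (Suc n) - w n) * e (f (Suc n))"
        using step n e2[of n] by (simp add: algebra_simps)
      also have "cmod \<dots> \<le> cmod ((\<Sum>n=a..<n. e (f n)) + w n * e (f n)) + cmod (w (Suc n) - w n)"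
        by (rule order.trans[OF norm_triangle_ineq]) (simp add: norm_mult)
      also have "w (Suc n) - w n = \<i> * complex_of_real ((cot (pi * d (Suc n)) - cot (pi * d n)) / 2)"
        by (simp add: w_def kl_weight_def complex_eq_iff field_simps)
      also have "cmod \<dots> = (cot (pi * d n) - cot (pi * d (Suc n))) / 2"
        using cot_antimono[of "d n" "d (Suc n)"] dm[of n] d[of n] d[of "Suc n"] step n assms(2)
        by (simp add: norm_mult del: of_real_divide of_real_diff)
      finally show "cmod ((\<Sum>n=a..<Suc n. e (f n)) + w (Suc n) * e (f (Suc n)))
        \<le> 1 / 2 + 1 / (4 * \<delta>) + (cot (pi * d a) - cot (pi * d (Suc n))) / 2"
        using step n by (simp add: diff_divide_distrib)
    qed
  qed
  show ?thesis
  proof (cases "a = b")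
    case True
    thus ?thesis using assms by (simp add: field_simps)
  next
    case False
    define m where "m = b - 1"
    have m: "b = Suc m" "a \<le> m" "m < b" using False assms(1) by (auto simp: m_def)
    have "(\<Sum>n=a..b. e (f n)) = (\<Sum>n=a..<m. e (f n)) + e (f m) + e (f (Suc m))"
      using m by (simp add: atLeastLessThanSuc_atLeastAtMost[symmetric])
    also have "\<dots> = ((\<Sum>n=a..<m. e (f n)) + w m * e (f m)) - w m * e (f (Suc m)) + e (f (Suc m))"
      using e2[of m] m by (simp add: algebra_simps)
    also have "cmod \<dots> \<le> cmod ((\<Sum>n=a..<m. e (f n)) + w m * e (f m)) + cmod (w m) + 1"
    proof -
      have "cmod (u - v + w) \<le> cmod u + cmod v + cmod w" for u v w
        using norm_triangle_ineq[of "u - v" w] norm_triangle_ineq4[of u v] by simp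
      from this[of "(\<Sum>n=a..<m. e (f n)) + w m * e (f m)" "w m * e (f (Suc m))" "e (f (Suc m))"]
      show ?thesis by (simp add: norm_mult)
    qed
    also have "\<dots> \<le> 1 / \<delta> + 2"
    proof -
      have "cmod ((\<Sum>n=a..<m. e (f n)) + w m * e (f m))
          \<le> 1 / 2 + 1 / (4 * \<delta>) + (cot (pi * d a) - cot (pi * d m)) / 2"
        using key[OF m(2)] m(3) by blast
      moreover have "cmod (w m) \<le> 1 / 2 + 1 / (4 * \<delta>)" using wn m by blast
      moreover have "\<bar>cot (pi * d a)\<bar> \<le> 1 / (2 * \<delta>)" "\<bar>cot (pi * d m)\<bar> \<le> 1 / (2 * \<delta>)"
        using d m assms(2) by (auto intro!: abs_cot_le)
      moreover have lin: "x + y + 1 \<le> u + 2"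
        if "x \<le> 1 / 2 + u / 4 + (p - q) / 2" "y \<le> 1 / 2 + u / 4" "\<bar>p\<bar> \<le> u / 2" "\<bar>q\<bar> \<le> u / 2"
        for x y u p q :: real
        using that by argo
      moreover have "1 / (4 * \<delta>) = 1 / \<delta> / 4" "1 / (2 * \<delta>) = 1 / \<delta> / 2" by simp_all
      ultimately show ?thesis
        by (intro lin[where p = "cot (pi * d a)" and q = "cot (pi * d m)"]) simp_all
    qed
    also have "\<dots> \<le> 2 / \<delta>" using assms by (simp add: field_simps)
    finally show ?thesis .
  qed
qed

section \<open>The second difference test and van der Corput's inequality\<close>

lemma sum_increments:
  fixes f :: "nat \<Rightarrow> real"
  assumes "a \<le> b" "\<And>n. a \<le> n \<Longrightarrow> n < b \<Longrightarrow> l \<le> f (Suc n) - f n \<and> f (Suc n) - f n \<le> u"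
  shows "l * real (b - a) \<le> f b - f a" "f b - f a \<le> u * real (b - a)"
proof -
  have "l * real (b - a) \<le> f b - f a \<and> f b - f a \<le> u * real (b - a)"
    using assms
  proof (induction b rule: dec_induct)
    case (step n)
    hence "l * real (n - a) \<le> f n - f a \<and> f n - f a \<le> u * real (n - a)" by auto
    moreover have "l \<le> f (Suc n) - f n \<and> f (Suc n) - f n \<le> u" using step by auto
    moreover have "real (Suc n - a) = real (n - a) + 1" using step by (simp add: of_nat_diff)
    ultimately show ?case by (auto simp: algebra_simps)
  qed auto
  thus "l * real (b - a) \<le> f b - f a" "f b - f a \<le> u * real (b - a)" by auto
qed

lemma card_le_of_spacing:
  fixes d :: "nat \<Rightarrow> real"
  assumes "0 < \<mu>" "0 \<le> \<delta>" "S \<subseteq> {..<P}" 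
  assumes inc: "\<And>n. Suc n < P \<Longrightarrow> \<mu> \<le> d (Suc n) - d n"
  assumes S: "\<And>n. n \<in> S \<Longrightarrow> x \<le> d n \<and> d n \<le> x + \<delta>"
  shows "real (card S) \<le> \<delta> / \<mu> + 1"
proof (cases "S = {}")
  case False
  have fin: "finite S" using assms(3) finite_subset by blast
  define a b where "a = Min S" and "b = Max S"
  have ab: "a \<in> S" "b \<in> S" "a \<le> b" "b < P"
    using False fin assms(3) by (auto simp: a_def b_def)
  have "S \<subseteq> {a..b}" using fin by (auto simp: a_def b_def)
  hence "card S \<le> card {a..b}" by (intro card_mono) auto
  hence c: "real (card S) \<le> real (b - a) + 1" using ab by simp
  have "\<mu> * real (b - a) \<le> d b - d a"
    using ab inc by (intro sum_increments(1)[where u = "Max ((\<lambda>n. d (Suc n) - d n) ` {a..<b})"]) auto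
  also have "\<dots> \<le> \<delta>" using S[OF ab(1)] S[OF ab(2)] by auto
  finally have "real (b - a) \<le> \<delta> / \<mu>" using assms(1) by (simp add: field_simps)
  with c show ?thesis by simp
qed (use assms in auto)

text \<open>The discrete form of van der Corput's second derivative test. The first differences
  increase in steps between \<mu> and \<kappa> \<mu>, so they meet at most \<kappa> \<mu> P + 2 unit
  intervals. Within one of these, the indices whose difference is within \<delta> of an end are few
  by spacing, and the Kuzmin-Landau inequality handles the block in between.\<close>

lemma second_difference_test:
  fixes f :: "nat \<Rightarrow> real"
  assumes "0 < \<mu>" "1 \<le> \<kappa>"
  assumes bd: "\<And>n. n < P \<Longrightarrow> \<mu> \<le> (f (Suc (Suc n)) - f (Suc n)) - (f (Suc n) - f n)"
    "\<And>n. n < P \<Longrightarrow> (f (Suc (Suc n)) - f (Suc n)) - (f (Suc n) - f n) \<le> \<kappa> * \<mu>"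
  shows "cmod (\<Sum>n<P. e (f n)) \<le> 5 * real P * \<kappa> * sqrt \<mu> + 10 / sqrt \<mu>"
proof (cases "\<mu> \<ge> 1 / 4")
  \<comment> \<open>Here the right-hand side already exceeds the number of terms. In the other case
    \<delta> < 1 / 2, so the two end zones of a unit interval do not overlap.\<close>
  case True
  hence "sqrt (1 / 4) \<le> sqrt \<mu>" using real_sqrt_le_mono by blast
  hence s: "1 / 2 \<le> sqrt \<mu>" by (simp add: real_sqrt_divide)
  have "cmod (\<Sum>n<P. e (f n)) \<le> real P"
    using norm_sum[of "\<lambda>n. e (f n)" "{..<P}"] by simp
  also have "\<dots> \<le> 5 * real P * (1 * (1 / 2))" by simp
  also have "\<dots> \<le> 5 * real P * (\<kappa> * sqrt \<mu>)"
    using assms s by (intro mult_mono) auto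
  finally show ?thesis using assms by (simp add: mult.assoc add_increasing2)
next
  case False
  \<comment> \<open>The end zones contribute about \<delta> / \<mu> and the middle 2 / \<delta>; the
    choice \<open>sqrt \<mu>\<close> makes both of order 1 / \<delta>.\<close>
  define \<delta> where "\<delta> = sqrt \<mu>"
  have \<delta>: "\<delta> > 0" "\<delta> * \<delta> = \<mu>" using assms by (auto simp: \<delta>_def)
  have "\<delta> < sqrt (1 / 4)" unfolding \<delta>_def using False by (intro real_sqrt_less_mono) auto
  hence \<delta>2: "\<delta> < 1 / 2" by (simp add: real_sqrt_divide)
  define d where "d n = f (Suc n) - f n" for n
  have inc: "\<mu> \<le> d (Suc n) - d n" "d (Suc n) - d n \<le> \<kappa> * \<mu>" if "n < P" for n
    using bd[OF that] by (auto simp: d_def)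
  have mono: "d m \<le> d n" if "m \<le> n" "n < P" for m n
    using sum_increments(1)[of m n 0 d "\<kappa> * \<mu>"] inc that assms(1)
    by (smt (verit) mult_eq_0_iff order.strict_trans order_less_imp_le)
  have sep: "cmod (\<Sum>n\<in>S. e (f n)) \<le> 1 / \<delta> + 1"
    if "S \<subseteq> {..<P}" "\<And>n. n \<in> S \<Longrightarrow> x \<le> d n \<and> d n \<le> x + \<delta>" for S x
  proof -
    have "cmod (\<Sum>n\<in>S. e (f n)) \<le> real (card S)"
      using norm_sum[of "\<lambda>n. e (f n)" S] by simp
    also have "\<dots> \<le> \<delta> / \<mu> + 1"
      using that inc assms(1) \<delta> by (intro card_le_of_spacing[where x = x and P = P and d = d]) auto
    also have "\<delta> / \<mu> = 1 / \<delta>" using \<delta> assms(1) by (simp add: field_simps)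
    finally show ?thesis .
  qed
  have mid: "cmod (\<Sum>n | n < P \<and> of_int k + \<delta> \<le> d n \<and> d n \<le> of_int k + 1 - \<delta>. e (f n)) \<le> 2 / \<delta>" 
    (is "cmod (sum _ ?B) \<le> _") for k :: int
  proof (cases "?B = {}")
    case True
    show ?thesis unfolding True using \<delta> by simp
  next
    case False
    have fin: "finite ?B" by auto
    define a b where "a = Min ?B" and "b = Max ?B"
    have ab: "a \<in> ?B" "b \<in> ?B" "a \<le> b"
      using Min_in[OF fin False] Max_in[OF fin False] Min_le[OF fin Max_in[OF fin False]]
      unfolding a_def b_def by blast+
    \<comment> \<open>Monotonicity of \<open>d\<close> makes this level set a full interval of
      indices, as the Kuzmin-Landau inequality demands.\<close>
    have "?B = {a..b}"
    proof
      show "?B \<subseteq> {a..b}" using Min_le[OF fin] Max_ge[OF fin] unfolding a_def b_def by auto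
      show "{a..b} \<subseteq> ?B"
      proof
        fix n assume "n \<in> {a..b}"
        thus "n \<in> ?B" using ab mono[of a n] mono[of n b] by auto
      qed
    qed
    moreover have "cmod (\<Sum>n=a..b. e (f n)) \<le> 2 / \<delta>"
    proof (rule kuzmin_landau[where k = k])
      fix n assume n: "a \<le> n" "Suc n < b"
      show "f (Suc n) - f n \<le> f (Suc (Suc n)) - f (Suc n)"
        using mono[of n "Suc n"] n ab by (simp add: d_def)
    next
      fix n assume n: "a \<le> n" "n < b"
      show "of_int k + \<delta> \<le> f (Suc n) - f n" "f (Suc n) - f n \<le> of_int k + 1 - \<delta>"
        using mono[of a n] mono[of n b] n ab by (auto simp: d_def)
    qed (use ab \<delta> \<delta>2 in auto)
    ultimately show ?thesis by simp
  qed
  have fib: "cmod (\<Sum>n | n < P \<and> \<lfloor>d n\<rfloor> = k. e (f n)) \<le> 5 / \<delta>" for k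
  proof -
    let ?A = "{n. n < P \<and> of_int k \<le> d n \<and> d n < of_int k + \<delta>}"
    let ?B = "{n. n < P \<and> of_int k + \<delta> \<le> d n \<and> d n \<le> of_int k + 1 - \<delta>}"
    let ?C = "{n. n < P \<and> of_int k + 1 - \<delta> < d n \<and> d n < of_int k + 1}"
    have "{n. n < P \<and> \<lfloor>d n\<rfloor> = k} = ?A \<union> (?B \<union> ?C)"
      using \<delta> \<delta>2 by (auto simp: floor_eq_iff)
    moreover have "(\<Sum>n\<in>?A \<union> (?B \<union> ?C). e (f n)) = (\<Sum>n\<in>?A. e (f n)) + (\<Sum>n\<in>?B \<union> ?C. e (f n))"
      using \<delta>2 by (intro sum.union_disjoint) auto
    moreover have "(\<Sum>n\<in>?B \<union> ?C. e (f n)) = (\<Sum>n\<in>?B. e (f n)) + (\<Sum>n\<in>?C. e (f n))"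
      by (intro sum.union_disjoint) auto
    moreover have "cmod (\<Sum>n\<in>?A. e (f n)) \<le> 1 / \<delta> + 1"
      by (rule sep[where x = "of_int k"]) auto
    moreover have "cmod (\<Sum>n\<in>?C. e (f n)) \<le> 1 / \<delta> + 1"
      by (rule sep[where x = "of_int k + 1 - \<delta>"]) auto
    ultimately have "cmod (\<Sum>n | n < P \<and> \<lfloor>d n\<rfloor> = k. e (f n)) \<le> (1 / \<delta> + 1) + (2 / \<delta> + (1 / \<delta> + 1))"
      using mid[of k] by (metis (no_types, lifting) add_mono norm_triangle_mono)
    also have "\<dots> = 4 / \<delta> + 2" by simp
    also have "2 \<le> 1 / \<delta>" using \<delta>(1) \<delta>2 by (simp add: field_simps)
    also have "4 / \<delta> + 1 / \<delta> = 5 / \<delta>" by simp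
    finally show ?thesis by simp
  qed
  show ?thesis
  proof (cases "P = 0")
    case False
    let ?K = "(\<lambda>n. \<lfloor>d n\<rfloor>) ` {..<P}"
    have K: "?K \<subseteq> {\<lfloor>d 0\<rfloor>..\<lfloor>d (P - 1)\<rfloor>}"
      using mono False by (auto intro!: floor_mono)
    have "d (P - 1) - d 0 \<le> \<kappa> * \<mu> * real (P - 1 - 0)"
      using inc by (intro sum_increments(2)[where l = \<mu>]) auto
    also have "\<dots> \<le> \<kappa> * \<mu> * real P" using assms by (intro mult_left_mono) auto
    finally have dd: "d (P - 1) - d 0 \<le> \<kappa> * \<mu> * real P" .
    have "\<lfloor>d 0\<rfloor> \<le> \<lfloor>d (P - 1)\<rfloor>" using mono[of 0 "P - 1"] False by (intro floor_mono) auto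
    hence "real (card {\<lfloor>d 0\<rfloor>..\<lfloor>d (P - 1)\<rfloor>}) = of_int \<lfloor>d (P - 1)\<rfloor> - of_int \<lfloor>d 0\<rfloor> + 1"
      by simp
    also have "\<dots> \<le> \<kappa> * \<mu> * real P + 2" using dd by linarith
    finally have cK: "real (card ?K) \<le> \<kappa> * \<mu> * real P + 2"
      using card_mono[OF _ K] by (smt (verit) finite_atLeastAtMost_int of_nat_mono)
    have "(\<Sum>n<P. e (f n)) = (\<Sum>k\<in>?K. \<Sum>n | n \<in> {..<P} \<and> \<lfloor>d n\<rfloor> = k. e (f n))"
      by (rule sum.image_gen) auto
    also have "cmod \<dots> \<le> (\<Sum>k\<in>?K. 5 / \<delta>)"
      using fib by (intro sum_norm_le) auto
    also have "\<dots> = real (card ?K) * (5 / \<delta>)" by simp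
    also have "\<dots> \<le> (\<kappa> * \<mu> * real P + 2) * (5 / \<delta>)"
      using cK \<delta> by (intro mult_right_mono) auto
    also have "\<dots> = 5 * real P * \<kappa> * sqrt \<mu> + 10 / sqrt \<mu>"
      using \<delta> unfolding \<delta>_def[symmetric] by (simp add: field_simps flip: \<delta>(2))
    finally show ?thesis .
  qed (use assms in auto)
qed

text \<open>Averaging over H shifts writes H times the sum as a sum over m of inner sums of the H
  values z (m - h). Cauchy-Schwarz over the P + H relevant m squares the inner sums, and after
  interchanging summations only correlations at differences of two shifts remain; the diagonal gives
  the squares.\<close>

lemma van_der_corput:
  fixes z :: "nat \<Rightarrow> complex"
  assumes "H > 0"
  shows "(cmod (\<Sum>n<P. z n))\<^sup>2 \<le> (real P + real H) / real H *
    ((\<Sum>n<P. (cmod (z n))\<^sup>2) + 2 * (\<Sum>h\<in>{1..<H}. cmod (\<Sum>n<P - h. z (n + h) * cnj (z n))))"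
proof -
  \<comment> \<open>The sequence is extended by zero outside \<open>{..<P}\<close>; the condition
    \<open>h \<le> m\<close> guards against truncated subtraction.\<close>
  define g where "g m h = (if h \<le> m \<and> m - h < P then z (m - h) else 0)" for m h
  define T where "T h = (\<Sum>n<P - h. z (n + h) * cnj (z n))" for h
  have gsum: "(\<Sum>m<P + H. g m h) = (\<Sum>n<P. z n)" if "h < H" for h
  proof -
    have "(\<Sum>m<P + H. g m h) = (\<Sum>m\<in>{h..<P + h}. z (m - h))"
      unfolding g_def using that by (intro sum.mono_neutral_cong_right) auto
    also have "\<dots> = (\<Sum>n<P. z n)"
      by (rule sum.reindex_bij_witness[of _ "\<lambda>n. n + h" "\<lambda>m. m - h"]) auto
    finally show ?thesis .
  qed
  have corr: "(\<Sum>m<P + H. g m h1 * cnj (g m h2)) = T (h2 - h1)" if "h1 \<le> h2" "h2 < H" for h1 h2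
  proof -
    have "(\<Sum>m<P + H. g m h1 * cnj (g m h2)) = (\<Sum>m\<in>{h2..<P + h1}. z (m - h1) * cnj (z (m - h2)))"
      unfolding g_def using that by (intro sum.mono_neutral_cong_right) auto
    also have "\<dots> = (\<Sum>n<P - (h2 - h1). z (n + (h2 - h1)) * cnj (z n))"
      by (rule sum.reindex_bij_witness[of _ "\<lambda>n. n + h2" "\<lambda>m. m - h2"]) (use that in auto)
    finally show ?thesis by (simp add: T_def)
  qed
  have ncorr: "cmod (\<Sum>m<P + H. g m h1 * cnj (g m h2)) = cmod (T (if h1 \<le> h2 then h2 - h1 else h1 - h2))"
    if "h1 < H" "h2 < H" for h1 h2
  proof (cases "h1 \<le> h2")
    case False
    have "(\<Sum>m<P + H. g m h1 * cnj (g m h2)) = cnj (\<Sum>m<P + H. g m h2 * cnj (g m h1))"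
      by (simp add: mult.commute)
    thus ?thesis using corr[of h2 h1] that False by simp
  qed (use corr that in simp)
  have T0: "cmod (T 0) = (\<Sum>n<P. (cmod (z n))\<^sup>2)"
  proof -
    have "T 0 = of_real (\<Sum>n<P. (cmod (z n))\<^sup>2)"
      unfolding T_def of_real_sum complex_norm_square by simp
    thus ?thesis by (simp add: sum_nonneg del: of_real_sum)
  qed
  define B where "B = (\<Sum>h\<in>{1..<H}. cmod (T h))"
  \<comment> \<open>For fixed \<open>h1\<close> every nonzero distance occurs at most twice among
    the \<open>h2\<close>, once on each side.\<close>
  have row: "(\<Sum>h2<H. cmod (T (if h1 \<le> h2 then h2 - h1 else h1 - h2))) \<le> cmod (T 0) + 2 * B"
    if h1: "h1 < H" for h1
  proof -
    have "{..<H} = {..<h1} \<union> insert h1 {h1<..<H}" using h1 by auto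
    moreover have "sum F ({..<h1} \<union> insert h1 {h1<..<H}) = sum F {..<h1} + sum F (insert h1 {h1<..<H})"
      for F :: "nat \<Rightarrow> real"
      by (intro sum.union_disjoint) auto
    ultimately have "(\<Sum>h2<H. cmod (T (if h1 \<le> h2 then h2 - h1 else h1 - h2))) =
       (\<Sum>h2\<in>{..<h1}. cmod (T (if h1 \<le> h2 then h2 - h1 else h1 - h2))) +
       (\<Sum>h2\<in>insert h1 {h1<..<H}. cmod (T (if h1 \<le> h2 then h2 - h1 else h1 - h2)))"
      by simp
    also have "\<dots> = (\<Sum>h2\<in>{..<h1}. cmod (T (h1 - h2))) + (cmod (T 0) + (\<Sum>h2\<in>{h1<..<H}. cmod (T (h2 - h1))))"
      by simp
    also have "(\<Sum>h2\<in>{..<h1}. cmod (T (h1 - h2))) = (\<Sum>h\<in>{1..h1}. cmod (T h))"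
      by (rule sum.reindex_bij_witness[of _ "\<lambda>h. h1 - h" "\<lambda>h. h1 - h"]) auto
    also have "\<dots> \<le> B" unfolding B_def using h1 by (intro sum_mono2) auto
    also have "(\<Sum>h2\<in>{h1<..<H}. cmod (T (h2 - h1))) = (\<Sum>h\<in>{1..<H - h1}. cmod (T h))"
      by (rule sum.reindex_bij_witness[of _ "\<lambda>h. h + h1" "\<lambda>h. h - h1"]) auto
    also have "\<dots> \<le> B" unfolding B_def by (intro sum_mono2) auto
    finally show ?thesis by simp
  qed
  have sq: "(cmod (\<Sum>h<H. g m h))\<^sup>2 = Re (\<Sum>h1<H. \<Sum>h2<H. g m h1 * cnj (g m h2))" for m
  proof -
    have "(\<Sum>h1<H. \<Sum>h2<H. g m h1 * cnj (g m h2)) = (\<Sum>h<H. g m h) * cnj (\<Sum>h<H. g m h)"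
      by (simp only: cnj_sum sum_product)
    thus ?thesis by (simp only: complex_norm_square[symmetric] Re_complex_of_real)
  qed
  have "(\<Sum>m<P + H. (cmod (\<Sum>h<H. g m h))\<^sup>2) =
      Re (\<Sum>m<P + H. \<Sum>h1<H. \<Sum>h2<H. g m h1 * cnj (g m h2))"
    by (simp only: sq Re_sum)
  also have "(\<Sum>m<P + H. \<Sum>h1<H. \<Sum>h2<H. g m h1 * cnj (g m h2)) =
     (\<Sum>h1<H. \<Sum>m<P + H. \<Sum>h2<H. g m h1 * cnj (g m h2))"
    by (rule sum.swap)
  also have "\<dots> = (\<Sum>h1<H. \<Sum>h2<H. \<Sum>m<P + H. g m h1 * cnj (g m h2))"
    by (intro sum.cong refl sum.swap)
  also have "Re \<dots> \<le> cmod (\<Sum>h1<H. \<Sum>h2<H. \<Sum>m<P + H. g m h1 * cnj (g m h2))"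
    by (rule complex_Re_le_cmod)
  also have "\<dots> \<le> (\<Sum>h1<H. \<Sum>h2<H. cmod (\<Sum>m<P + H. g m h1 * cnj (g m h2)))"
    by (intro sum_norm_le norm_sum)
  also have "\<dots> = (\<Sum>h1<H. \<Sum>h2<H. cmod (T (if h1 \<le> h2 then h2 - h1 else h1 - h2)))"
    by (intro sum.cong refl ncorr) auto
  also have "\<dots> \<le> (\<Sum>h1<H. cmod (T 0) + 2 * B)"
    by (intro sum_mono row) auto
  also have "\<dots> = real H * (cmod (T 0) + 2 * B)" by simp
  finally have square_sum: "(\<Sum>m<P + H. (cmod (\<Sum>h<H. g m h))\<^sup>2) \<le> real H * (cmod (T 0) + 2 * B)" .
  have "real H * cmod (\<Sum>n<P. z n) = cmod (\<Sum>h<H. \<Sum>m<P + H. g m h)"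
    by (simp add: gsum norm_mult)
  also have "\<dots> = cmod (\<Sum>m<P + H. \<Sum>h<H. g m h)" by (subst sum.swap) (rule refl)
  also have "\<dots> \<le> (\<Sum>m<P + H. cmod (\<Sum>h<H. g m h))" by (rule norm_sum)
  finally have "(real H * cmod (\<Sum>n<P. z n))\<^sup>2 \<le> (\<Sum>m<P + H. 1 * cmod (\<Sum>h<H. g m h))\<^sup>2"
    by (intro power_mono) auto
  also have "\<dots> \<le> (\<Sum>m<P + H. 1\<^sup>2) * (\<Sum>m<P + H. (cmod (\<Sum>h<H. g m h))\<^sup>2)"
    by (rule Cauchy_Schwarz_ineq_sum)
  also have "\<dots> \<le> (\<Sum>m<P + H. 1\<^sup>2) * (real H * (cmod (T 0) + 2 * B))"
    using square_sum by (intro mult_left_mono sum_nonneg) auto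
  also have "(\<Sum>m<P + H. 1\<^sup>2) = real P + real H" by simp
  finally have "real H * (real H * (cmod (\<Sum>n<P. z n))\<^sup>2) \<le> real H * ((real P + real H) * (cmod (T 0) + 2 * B))"
    by (simp add: power2_eq_square mult_ac)
  hence "real H * (cmod (\<Sum>n<P. z n))\<^sup>2 \<le> (real P + real H) * (cmod (T 0) + 2 * B)"
    using assms by simp
  hence "(cmod (\<Sum>n<P. z n))\<^sup>2 \<le> (real P + real H) / real H * (cmod (T 0) + 2 * B)"
    using assms by (simp add: field_simps)
  thus ?thesis unfolding T0 B_def by (simp only: T_def)
qed

section \<open>Iterated differences and the tests of higher order\<close>

definition fdiff :: "(nat \<Rightarrow> real) \<Rightarrow> nat \<Rightarrow> real" where
  "fdiff f n = f (Suc n) - f n"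

lemma fdiff_pow_sum: "(fdiff ^^ k) (\<lambda>n. \<Sum>i<h. f (n + i)) n = (\<Sum>i<h. (fdiff ^^ k) f (n + i))"
  by (induction k arbitrary: n) (auto simp: fdiff_def sum_subtractf)

text \<open>A shift by h is a sum of h unit steps. Hence the k-th difference of the differenced
  phase collects h consecutive differences of order k + 1: bounds \<mu> and \<kappa> \<mu> become h
  \<mu> and \<kappa> h \<mu>, with the same \<kappa>.\<close>

lemma fdiff_pow_shift: "(fdiff ^^ k) (\<lambda>n. f (n + h) - f n) n = (\<Sum>i<h. (fdiff ^^ Suc k) f (n + i))"
proof -
  have "f (n + h) - f n = (\<Sum>i<h. fdiff f (n + i))" for n
    by (induction h) (auto simp: fdiff_def)
  thus ?thesis by (simp only: fdiff_pow_sum funpow_Suc_right o_def)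
qed

text \<open>Differencing in the sense of van der Corput lowers \<open>q\<close> by one and replaces \<open>\<epsilon>\<close> by \<open>\<epsilon>\<^sup>2\<close>, so the exponent \<open>a\<close>
  satisfies \<open>a(q + 1) = 2 a(q) + 3\<close>.\<close>

lemma higher_difference_test:
  "\<exists>a C. C > 0 \<and> (\<forall>(f :: nat \<Rightarrow> real) P P' \<mu> \<kappa> \<epsilon>. 0 < \<epsilon> \<longrightarrow> \<epsilon> \<le> 1 / 2 \<longrightarrow> 0 < \<mu> \<longrightarrow> 1 \<le> \<kappa> \<longrightarrow>
      \<kappa>\<^sup>2 * \<mu> \<le> \<epsilon> ^ a \<longrightarrow> 1 \<le> \<epsilon> ^ a * \<mu> * (real P)\<^sup>2 \<longrightarrow> 1 \<le> \<epsilon> ^ a * real P \<longrightarrow> P' \<le> P \<longrightarrow>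
      (\<forall>n<P'. \<mu> \<le> (fdiff ^^ Suc (Suc q)) f n \<and> (fdiff ^^ Suc (Suc q)) f n \<le> \<kappa> * \<mu>) \<longrightarrow>
      cmod (\<Sum>n<P'. e (f n)) \<le> C * \<epsilon> * real P)"
proof (induction q)
  case 0
  \<comment> \<open>With exponent 2 the hypotheses say \<kappa> sqrt \<mu> \<le> \<epsilon> and 1 /
    sqrt \<mu> \<le> \<epsilon> P; the constant is 5 + 10 from
    \<open>second_difference_test\<close>.\<close>
  show ?case
  proof (intro exI[of _ "2 :: nat"] exI[of _ "15 :: real"] conjI allI impI)
    fix f :: "nat \<Rightarrow> real" and P P' \<mu> \<kappa> and \<epsilon> :: real
    assume as: "0 < \<epsilon>" "\<epsilon> \<le> 1 / 2" "0 < \<mu>" "1 \<le> \<kappa>" "\<kappa>\<^sup>2 * \<mu> \<le> \<epsilon>\<^sup>2" "1 \<le> \<epsilon>\<^sup>2 * \<mu> * (real P)\<^sup>2"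
      "P' \<le> P" "\<forall>n<P'. \<mu> \<le> (fdiff ^^ Suc (Suc 0)) f n \<and> (fdiff ^^ Suc (Suc 0)) f n \<le> \<kappa> * \<mu>"
    have "sqrt (\<kappa>\<^sup>2 * \<mu>) \<le> sqrt (\<epsilon>\<^sup>2)" using as by (intro real_sqrt_le_mono)
    hence 1: "\<kappa> * sqrt \<mu> \<le> \<epsilon>" using as by (simp add: real_sqrt_mult)
    have "sqrt 1 \<le> sqrt (\<epsilon>\<^sup>2 * \<mu> * (real P)\<^sup>2)" using as by (intro real_sqrt_le_mono)
    hence 2: "1 / sqrt \<mu> \<le> \<epsilon> * real P" using as by (simp add: real_sqrt_mult field_simps)
    have "cmod (\<Sum>n<P'. e (f n)) \<le> 5 * real P' * \<kappa> * sqrt \<mu> + 10 / sqrt \<mu>"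
      using as by (intro second_difference_test) (auto simp: fdiff_def)
    also have "\<dots> = 5 * real P' * (\<kappa> * sqrt \<mu>) + 10 * (1 / sqrt \<mu>)" by simp
    also have "\<dots> \<le> 5 * real P * \<epsilon> + 10 * (\<epsilon> * real P)"
      using 1 2 as by (intro add_mono mult_mono) auto
    finally show "cmod (\<Sum>n<P'. e (f n)) \<le> 15 * \<epsilon> * real P" by simp
  qed simp
next
  case (Suc q)
  then obtain a C where C: "C > 0" and IH: "\<And>(f :: nat \<Rightarrow> real) P P' \<mu> \<kappa> \<epsilon>. 0 < \<epsilon> \<Longrightarrow> \<epsilon> \<le> 1 / 2 \<Longrightarrow> 0 < \<mu> \<Longrightarrow> 1 \<le> \<kappa> \<Longrightarrow>
      \<kappa>\<^sup>2 * \<mu> \<le> \<epsilon> ^ a \<Longrightarrow> 1 \<le> \<epsilon> ^ a * \<mu> * (real P)\<^sup>2 \<Longrightarrow> 1 \<le> \<epsilon> ^ a * real P \<Longrightarrow> P' \<le> P \<Longrightarrow>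
      (\<And>n. n < P' \<Longrightarrow> \<mu> \<le> (fdiff ^^ Suc (Suc q)) f n \<and> (fdiff ^^ Suc (Suc q)) f n \<le> \<kappa> * \<mu>) \<Longrightarrow>
      cmod (\<Sum>n<P'. e (f n)) \<le> C * \<epsilon> * real P" by blast
  show ?case
  proof (intro exI[of _ "2 * a + 3"] exI[of _ "2 + 4 * C"] conjI allI impI)
    fix f :: "nat \<Rightarrow> real" and P P' \<mu> \<kappa> and \<epsilon> :: real
    assume as: "0 < \<epsilon>" "\<epsilon> \<le> 1 / 2" "0 < \<mu>" "1 \<le> \<kappa>" "\<kappa>\<^sup>2 * \<mu> \<le> \<epsilon> ^ (2 * a + 3)" 
      "1 \<le> \<epsilon> ^ (2 * a + 3) * \<mu> * (real P)\<^sup>2" "1 \<le> \<epsilon> ^ (2 * a + 3) * real P"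
      "P' \<le> P" "\<forall>n<P'. \<mu> \<le> (fdiff ^^ Suc (Suc (Suc q))) f n \<and> (fdiff ^^ Suc (Suc (Suc q))) f n \<le> \<kappa> * \<mu>"
    \<comment> \<open>With about \<epsilon>^-2 shifts the diagonal costs P^2 / H \<le> \<epsilon>^2
      P^2, and the correlations need only be smaller than P by a factor of order
      \<epsilon>^2.\<close>
    define H where "H = nat \<lceil>1 / \<epsilon>\<^sup>2\<rceil>"
    have e2: "\<epsilon>\<^sup>2 \<le> 1 / 2" "\<epsilon>\<^sup>2 \<le> 1" "0 < \<epsilon>\<^sup>2"
      using as power_mono[of \<epsilon> "1/2" 2] by (auto simp: power2_eq_square)
    have "0 < 1 / \<epsilon>\<^sup>2" using e2 by simp
    hence H1: "1 / \<epsilon>\<^sup>2 \<le> real H" "H > 0" unfolding H_def by linarith+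
    have "real H \<le> 1 / \<epsilon>\<^sup>2 + 1" using \<open>0 < 1 / \<epsilon>\<^sup>2\<close> unfolding H_def by linarith
    moreover have "1 \<le> 1 / \<epsilon>\<^sup>2" using e2 by (simp add: field_simps)
    moreover have "1 / \<epsilon>\<^sup>2 + 1 / \<epsilon>\<^sup>2 = 2 / \<epsilon>\<^sup>2" by simp
    ultimately have H2: "real H \<le> 2 / \<epsilon>\<^sup>2" by linarith
    \<comment> \<open>The factor (\<epsilon>^2)^a serves the induction hypothesis at \<epsilon>^2.
      The remaining \<epsilon>^3 pays for h < H \<le> 2 / \<epsilon>^2, because 2 \<epsilon> \<le>
      1.\<close>
    have p3: "\<epsilon> ^ (2 * a + 3) = (\<epsilon>\<^sup>2) ^ a * \<epsilon> ^ 3" by (simp add: power_add power_mult)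
    have pa: "(\<epsilon>\<^sup>2) ^ a \<le> 1" "(\<epsilon>\<^sup>2) ^ a > 0" using e2 by (auto intro: power_le_one)
    have e3: "\<epsilon> ^ 3 \<le> 1" "\<epsilon> ^ 3 > 0" using as by (auto intro: power_le_one)
    have "real H \<le> real P"
    proof -
      have "real H \<le> 2 / \<epsilon>\<^sup>2" by fact
      also have "\<dots> \<le> 1 / \<epsilon> ^ 3" using as by (simp add: field_simps power2_eq_square power3_eq_cube)
      also have "\<dots> \<le> 1 / \<epsilon> ^ (2 * a + 3)" unfolding p3 using pa e3 by (intro frac_le) (auto intro: mult_left_le_one_le)
      also have "\<dots> \<le> real P" using as by (simp add: field_simps)
      finally show ?thesis .
    qed
    \<comment> \<open>The correlation has only P' - h terms, possibly very few, while the size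
      conditions refer to the unchanged P. This is why the statement separates the two
      lengths.\<close>
    have Th: "cmod (\<Sum>n<P' - h. e (f (n + h)) * cnj (e (f n))) \<le> C * \<epsilon>\<^sup>2 * real P" if h: "h \<in> {1..<H}" for h
    proof -
      have "(\<Sum>n<P' - h. e (f (n + h)) * cnj (e (f n))) = (\<Sum>n<P' - h. e (f (n + h) - f n))"
        by (simp add: e_diff)
      also have "cmod \<dots> \<le> C * \<epsilon>\<^sup>2 * real P"
      proof (rule IH[where \<mu> = "real h * \<mu>" and \<kappa> = \<kappa>])
        have "\<kappa>\<^sup>2 * (real h * \<mu>) = real h * (\<kappa>\<^sup>2 * \<mu>)" by simp
        also have "\<dots> \<le> (2 / \<epsilon>\<^sup>2) * \<epsilon> ^ (2 * a + 3)"
          using h H2 as e2 by (intro mult_mono) auto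
        also have "\<dots> = (\<epsilon>\<^sup>2) ^ a * (2 * \<epsilon>)" using as unfolding p3 by (simp add: power2_eq_square power3_eq_cube)
        also have "\<dots> \<le> (\<epsilon>\<^sup>2) ^ a" using pa as by (simp add: mult_left_le)
        finally show "\<kappa>\<^sup>2 * (real h * \<mu>) \<le> (\<epsilon>\<^sup>2) ^ a" .
        have le: "\<epsilon> ^ (2 * a + 3) \<le> (\<epsilon>\<^sup>2) ^ a" unfolding p3 using pa e3 by (intro mult_left_le) auto
        have "\<epsilon> ^ (2 * a + 3) * \<mu> * (real P)\<^sup>2 \<le> (\<epsilon>\<^sup>2) ^ a * (real h * \<mu>) * (real P)\<^sup>2"
          using le h as pa by (intro mult_mono) auto
        with as show "1 \<le> (\<epsilon>\<^sup>2) ^ a * (real h * \<mu>) * (real P)\<^sup>2" by linarith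
        have "\<epsilon> ^ (2 * a + 3) * real P \<le> (\<epsilon>\<^sup>2) ^ a * real P" using le by (intro mult_right_mono) auto
        with as show "1 \<le> (\<epsilon>\<^sup>2) ^ a * real P" by linarith
        fix n assume n: "n < P' - h"
        have *: "(fdiff ^^ Suc (Suc q)) (\<lambda>n. f (n + h) - f n) n = (\<Sum>i<h. (fdiff ^^ Suc (Suc (Suc q))) f (n + i))"
          by (rule fdiff_pow_shift)
        have b: "\<mu> \<le> (fdiff ^^ Suc (Suc (Suc q))) f (n + i) \<and> (fdiff ^^ Suc (Suc (Suc q))) f (n + i) \<le> \<kappa> * \<mu>" if "i < h" for i
          using as(9) n that by (auto simp del: funpow.simps)
        have "(\<Sum>i<h. \<mu>) \<le> (\<Sum>i<h. (fdiff ^^ Suc (Suc (Suc q))) f (n + i))"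
          using b by (intro sum_mono) (auto simp del: funpow.simps)
        moreover have "(\<Sum>i<h. (fdiff ^^ Suc (Suc (Suc q))) f (n + i)) \<le> (\<Sum>i<h. \<kappa> * \<mu>)"
          using b by (intro sum_mono) (auto simp del: funpow.simps)
        ultimately show "real h * \<mu> \<le> (fdiff ^^ Suc (Suc q)) (\<lambda>n. f (n + h) - f n) n \<and>
          (fdiff ^^ Suc (Suc q)) (\<lambda>n. f (n + h) - f n) n \<le> \<kappa> * (real h * \<mu>)"
          unfolding * by (simp add: mult_ac del: funpow.simps)
      qed (use h as e2 in auto)
      finally show ?thesis .
    qed
    have "(cmod (\<Sum>n<P'. e (f n)))\<^sup>2 \<le> (real P' + real H) / real H *
      ((\<Sum>n<P'. (cmod (e (f n)))\<^sup>2) + 2 * (\<Sum>h\<in>{1..<H}. cmod (\<Sum>n<P' - h. e (f (n + h)) * cnj (e (f n)))))"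
      by (rule van_der_corput) fact
    also have "\<dots> \<le> (2 * real P) / real H * (real P + 2 * (real H * (C * \<epsilon>\<^sup>2 * real P)))"
    proof (intro mult_mono add_mono divide_right_mono)
      have "(\<Sum>h\<in>{1..<H}. cmod (\<Sum>n<P' - h. e (f (n + h)) * cnj (e (f n)))) \<le> (\<Sum>h\<in>{1..<H}. C * \<epsilon>\<^sup>2 * real P)"
        by (intro sum_mono Th)
      also have "\<dots> = real (H - 1) * (C * \<epsilon>\<^sup>2 * real P)" by simp
      also have "\<dots> \<le> real H * (C * \<epsilon>\<^sup>2 * real P)" using C e2 by (intro mult_right_mono) auto
      finally show "(\<Sum>h\<in>{1..<H}. cmod (\<Sum>n<P' - h. e (f (n + h)) * cnj (e (f n)))) \<le> real H * (C * \<epsilon>\<^sup>2 * real P)" .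
    qed (use as \<open>real H \<le> real P\<close> in \<open>auto intro!: add_nonneg_nonneg sum_nonneg\<close>)
    also have "\<dots> = (2 * (real P)\<^sup>2) * (1 / real H) + 4 * C * \<epsilon>\<^sup>2 * (real P)\<^sup>2"
      using H1 by (simp add: field_simps power2_eq_square)
    also have "\<dots> \<le> (2 * (real P)\<^sup>2) * \<epsilon>\<^sup>2 + 4 * C * \<epsilon>\<^sup>2 * (real P)\<^sup>2"
      using H1 e2 by (intro add_right_mono mult_left_mono) (auto simp: field_simps)
    also have "\<dots> = (2 + 4 * C) * (\<epsilon> * real P)\<^sup>2" by (simp add: algebra_simps power2_eq_square)
    also have "\<dots> \<le> (2 + 4 * C)\<^sup>2 * (\<epsilon> * real P)\<^sup>2"
      using C by (intro mult_right_mono) (auto simp: power2_eq_square)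
    also have "\<dots> = ((2 + 4 * C) * \<epsilon> * real P)\<^sup>2" by (simp add: power_mult_distrib)
    finally show "cmod (\<Sum>n<P'. e (f n)) \<le> (2 + 4 * C) * \<epsilon> * real P"
      using C as by (rule_tac power2_le_imp_le) auto
  qed (use C in simp)
qed

section \<open>Phases that are multiples of a power\<close>

lemma fdiff_pow_bounds:
  fixes g :: "nat \<Rightarrow> real \<Rightarrow> real"
  assumes der: "\<And>i x. i < k \<Longrightarrow> a \<le> x \<Longrightarrow> x \<le> b \<Longrightarrow> (g i has_real_derivative g (Suc i) x) (at x)"
    and bd: "\<And>x. a \<le> x \<Longrightarrow> x \<le> b \<Longrightarrow> l \<le> g k x \<and> g k x \<le> u"
    and "a \<le> x0 + real n" "x0 + real n + real k \<le> b"
  shows "l \<le> (fdiff ^^ k) (\<lambda>n. g 0 (x0 + real n)) n \<and> (fdiff ^^ k) (\<lambda>n. g 0 (x0 + real n)) n \<le> u"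
  using assms
proof (induction k arbitrary: g b)
  case (Suc k)
  \<comment> \<open>One difference is peeled off; the derivatives of \<open>h 0\<close> are again
    differences of derivatives. The mean value theorem places \<open>h k x\<close> in the range of
    \<open>g (Suc k)\<close>, and the interval shrinks by one.\<close>
  define h where "h i x = g i (x + 1) - g i x" for i x
  have "l \<le> (fdiff ^^ k) (\<lambda>n. h 0 (x0 + real n)) n \<and> (fdiff ^^ k) (\<lambda>n. h 0 (x0 + real n)) n \<le> u"
  proof (rule Suc.IH[where b = "b - 1"])
    fix i x assume ix: "i < k" "a \<le> x" "x \<le> b - 1"
    have "(g i has_real_derivative g (Suc i) (x + 1)) (at (x + 1))"
      using Suc.prems(1)[of i "x + 1"] ix by auto
    hence "((\<lambda>x. g i (x + 1)) has_real_derivative g (Suc i) (x + 1)) (at x)"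
      by (simp add: DERIV_shift)
    moreover have "(g i has_real_derivative g (Suc i) x) (at x)"
      using Suc.prems(1)[of i x] ix by auto
    ultimately show "(h i has_real_derivative h (Suc i) x) (at x)"
      unfolding h_def by (rule DERIV_diff)
  next
    fix x assume x: "a \<le> x" "x \<le> b - 1"
    have "\<exists>z>x. z < x + 1 \<and> g k (x + 1) - g k x = (x + 1 - x) * g (Suc k) z"
      using x by (intro MVT2 Suc.prems(1)) auto
    then obtain z where z: "x < z" "z < x + 1" "h k x = g (Suc k) z" by (auto simp: h_def)
    show "l \<le> h k x \<and> h k x \<le> u"
      using Suc.prems(2)[of z] z x by auto
  qed (use Suc.prems in auto)
  moreover have "(\<lambda>n. h 0 (x0 + real n)) = fdiff (\<lambda>n. g 0 (x0 + real n))"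
    by (auto simp: h_def fdiff_def fun_eq_iff add_ac)
  ultimately show ?case by (simp add: funpow_Suc_right del: funpow.simps)
qed simp

text \<open>On the logarithmic scale only the size of the exponent matters, not its sign. This
  limits the variation of x^r over the range kept in \<open>power_phase_test\<close> to a power of
  \<epsilon>.\<close>

lemma powr_ratio_bounds:
  assumes "0 < \<epsilon>" "\<epsilon> \<le> y" "y \<le> 1 / \<epsilon>" "\<bar>r\<bar> \<le> real b" "\<epsilon> \<le> 1"
  shows "\<epsilon> ^ b \<le> y powr r" "y powr r \<le> 1 / \<epsilon> ^ b"
proof -
  have y: "y > 0" using assms by simp
  have "ln \<epsilon> \<le> ln y" "ln y \<le> ln (1 / \<epsilon>)" using assms y by (subst ln_le_cancel_iff; simp)+
  moreover have "ln (1 / \<epsilon>) = - ln \<epsilon>" using assms by (simp add: ln_div)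
  ultimately have l: "\<bar>ln y\<bar> \<le> - ln \<epsilon>" by linarith
  have "\<bar>r * ln y\<bar> \<le> real b * (- ln \<epsilon>)"
    unfolding abs_mult using assms l by (intro mult_mono) auto
  hence "exp (real b * ln \<epsilon>) \<le> exp (r * ln y)" "exp (r * ln y) \<le> exp (- (real b * ln \<epsilon>))"
    by (auto simp: abs_le_iff)
  moreover have "exp (real b * ln \<epsilon>) = \<epsilon> ^ b" using assms by (simp add: exp_of_nat_mult)
  ultimately show "\<epsilon> ^ b \<le> y powr r" "y powr r \<le> 1 / \<epsilon> ^ b"
    using y by (auto simp: powr_def exp_minus divide_inverse)
qed

definition falling :: "real \<Rightarrow> nat \<Rightarrow> real" where
  "falling c k = (\<Prod>j<k. c - real j)"

text \<open>The derivative of order q + 2 is l times \<open>falling c (q + 2)\<close> times x^(c - q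
  - 2). Away from 0 its size varies little, so the first \<epsilon> P terms are estimated trivially
  and on the rest the ratio \<kappa> of upper to lower bound is a power of 1 / \<epsilon>. The two
  conditions on |l| P^c say that this derivative is small compared with 1 and large compared with
  P^-2.\<close>

lemma power_phase_test:
  fixes c :: real
  assumes "falling c (q + 2) \<noteq> 0"
  shows "\<exists>K C. C > 0 \<and> (\<forall>\<epsilon> l P. 0 < \<epsilon> \<longrightarrow> \<epsilon> \<le> 1 / 2 \<longrightarrow> \<epsilon> \<le> \<bar>falling c (q + 2)\<bar> \<longrightarrow>
     \<epsilon> * \<bar>falling c (q + 2)\<bar> \<le> 1 \<longrightarrow> q + 2 \<le> P \<longrightarrow> 1 \<le> \<epsilon> ^ K * real P \<longrightarrow>
     real P ^ q \<le> \<epsilon> ^ K * (\<bar>l\<bar> * real P powr c) \<longrightarrow> \<bar>l\<bar> * real P powr c \<le> \<epsilon> ^ K * real P ^ (q + 2) \<longrightarrow>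
     cmod (\<Sum>m=1..P. e (l * real m powr c)) \<le> C * \<epsilon> * real P)"
proof -
  define G where "G = \<bar>falling c (q + 2)\<bar>"
  have G: "G > 0" using assms by (simp add: G_def)
  define r where "r = c - real (q + 2)"
  define b where "b = nat \<lceil>\<bar>r\<bar>\<rceil>"
  have b: "\<bar>r\<bar> \<le> real b" by (simp add: b_def)
  obtain a C where C: "C > 0" and test: "\<And>(f :: nat \<Rightarrow> real) P P' \<mu> \<kappa> \<epsilon>. 0 < \<epsilon> \<Longrightarrow> \<epsilon> \<le> 1 / 2 \<Longrightarrow> 0 < \<mu> \<Longrightarrow> 1 \<le> \<kappa> \<Longrightarrow>
      \<kappa>\<^sup>2 * \<mu> \<le> \<epsilon> ^ a \<Longrightarrow> 1 \<le> \<epsilon> ^ a * \<mu> * (real P)\<^sup>2 \<Longrightarrow> 1 \<le> \<epsilon> ^ a * real P \<Longrightarrow> P' \<le> P \<Longrightarrow>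
      (\<And>n. n < P' \<Longrightarrow> \<mu> \<le> (fdiff ^^ Suc (Suc q)) f n \<and> (fdiff ^^ Suc (Suc q)) f n \<le> \<kappa> * \<mu>) \<Longrightarrow>
      cmod (\<Sum>n<P'. e (f n)) \<le> C * \<epsilon> * real P"
    using higher_difference_test[of q] by blast
  define K where "K = a + 3 * b + 1"
  show ?thesis
  proof (intro exI[of _ K] exI[of _ "C + 2"] conjI allI impI)
    fix \<epsilon> l :: real and P :: nat
    assume as0: "0 < \<epsilon>" "\<epsilon> \<le> 1 / 2" "\<epsilon> \<le> \<bar>falling c (q + 2)\<bar>" "\<epsilon> * \<bar>falling c (q + 2)\<bar> \<le> 1"
      "q + 2 \<le> P" "1 \<le> \<epsilon> ^ K * real P"
      "real P ^ q \<le> \<epsilon> ^ K * (\<bar>l\<bar> * real P powr c)" "\<bar>l\<bar> * real P powr c \<le> \<epsilon> ^ K * real P ^ (q + 2)"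
    note as = as0(1,2) as0(3,4)[folded G_def] as0(5-)
    have P: "real P > 0" using as by simp
    have l: "\<bar>l\<bar> > 0"
    proof (rule ccontr)
      assume "\<not> \<bar>l\<bar> > 0"
      hence "real P ^ q \<le> 0" using as(7) by simp
      moreover have "real P ^ q > 0" using P by simp
      ultimately show False by linarith
    qed
    have ple: "\<epsilon> ^ m \<le> \<epsilon> ^ n" if "n \<le> m" for m n using as that by (intro power_decreasing) auto
    define P0 where "P0 = nat \<lceil>\<epsilon> * real P\<rceil>"
    have eP1: "1 \<le> \<epsilon> * real P"
    proof -
      have "1 \<le> \<epsilon> ^ K * real P" by fact
      also have "\<dots> \<le> \<epsilon> ^ 1 * real P" by (intro mult_right_mono ple) (auto simp: K_def)
      finally show ?thesis by simp
    qed
    have P0: "\<epsilon> * real P \<le> real P0" "real P0 \<le> \<epsilon> * real P + 1" "1 \<le> P0"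
      using eP1 unfolding P0_def by linarith+
    have "\<epsilon> * real P \<le> (1/2) * real P" using as P by (intro mult_right_mono) auto
    hence P0P: "P0 \<le> P" using P0 as(5) by linarith
    \<comment> \<open>The derivative is normalised to be positive; the sum is at most conjugated,
      which leaves its norm unchanged.\<close>
    define s where "s = sgn (l * falling c (q + 2))"
    have "l * falling c (q + 2) \<noteq> 0" using l assms by simp
    hence s: "s = 1 \<or> s = -1" "s * (l * falling c (q + 2)) = \<bar>l\<bar> * G"
      unfolding s_def G_def abs_mult[symmetric] by (auto simp: sgn_if)
    define f where "f n = s * (l * (real P0 + real n) powr c)" for n
    define g where "g i x = s * (l * (falling c i * x powr (c - real i)))" for i x
    define \<mu> where "\<mu> = \<bar>l\<bar> * G * real P powr r * \<epsilon> ^ b"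
    define \<kappa> where "\<kappa> = 1 / \<epsilon> ^ (2 * b)"
    have \<mu>: "\<mu> > 0" using l G P as by (simp add: \<mu>_def)
    have pr: "real P powr c = real P powr r * real P ^ (q + 2)"
      using P unfolding r_def powr_realpow[OF P, symmetric] powr_add[symmetric] by simp
    have fg: "f = (\<lambda>n. g 0 (real P0 + real n))"
      by (auto simp: f_def g_def falling_def)
    have main: "cmod (\<Sum>n<P + 1 - P0. e (f n)) \<le> C * \<epsilon> * real P"
    proof (rule test[where \<mu> = \<mu> and \<kappa> = \<kappa>])
      show "1 \<le> \<kappa>" using as by (simp add: \<kappa>_def power_le_one)
      have "\<bar>l\<bar> * real P powr r * real P ^ (q + 2) \<le> \<epsilon> ^ K * real P ^ (q + 2)"
        using as(8) by (simp add: pr mult.assoc)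
      hence u: "\<bar>l\<bar> * real P powr r \<le> \<epsilon> ^ K"
        using P by (metis mult_le_cancel_right_pos zero_less_power)
      have "\<kappa>\<^sup>2 * \<mu> = (\<bar>l\<bar> * real P powr r) * G * (\<epsilon> ^ b / \<epsilon> ^ (4 * b))"
        by (simp add: \<kappa>_def \<mu>_def power_divide power_mult[symmetric] mult_ac)
      also have "\<epsilon> ^ b / \<epsilon> ^ (4 * b) = 1 / \<epsilon> ^ (3 * b)"
        using as power_add[of \<epsilon> b "3 * b"] by (simp add: field_simps)
      also have "(\<bar>l\<bar> * real P powr r) * G * (1 / \<epsilon> ^ (3 * b)) \<le> \<epsilon> ^ K * G * (1 / \<epsilon> ^ (3 * b))"
        using u G as by (intro mult_right_mono) auto
      also have "\<dots> = \<epsilon> ^ a * (\<epsilon> * G)" using as by (simp add: K_def power_add)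
      also have "\<dots> \<le> \<epsilon> ^ a" using as by (intro mult_left_le) auto
      finally show "\<kappa>\<^sup>2 * \<mu> \<le> \<epsilon> ^ a" .
      have "1 * real P ^ q \<le> (\<epsilon> ^ K * \<bar>l\<bar> * real P powr r * (real P)\<^sup>2) * real P ^ q"
        using as(7) by (simp add: pr power_add power2_eq_square mult_ac)
      hence "1 \<le> \<epsilon> ^ K * \<bar>l\<bar> * real P powr r * (real P)\<^sup>2"
        using P by (metis mult_le_cancel_right_pos zero_less_power)
      also have "\<dots> \<le> (\<epsilon> ^ (a + b) * G) * \<bar>l\<bar> * real P powr r * (real P)\<^sup>2"
      proof -
        have "\<epsilon> ^ K \<le> \<epsilon> ^ (a + b + 1)" by (rule ple) (simp add: K_def)
        also have "\<dots> = \<epsilon> ^ (a + b) * \<epsilon>" by simp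
        also have "\<dots> \<le> \<epsilon> ^ (a + b) * G" using as by (intro mult_left_mono) auto
        finally show ?thesis by (intro mult_right_mono) auto
      qed
      also have "\<dots> = \<epsilon> ^ a * \<mu> * (real P)\<^sup>2" by (simp add: \<mu>_def power_add mult_ac)
      finally show "1 \<le> \<epsilon> ^ a * \<mu> * (real P)\<^sup>2" .
      have "\<epsilon> ^ K * real P \<le> \<epsilon> ^ a * real P" using P by (intro mult_right_mono ple) (auto simp: K_def)
      thus "1 \<le> \<epsilon> ^ a * real P" using as by linarith
      show "P + 1 - P0 \<le> P" using P0 by simp
      fix n assume n: "n < P + 1 - P0"
      \<comment> \<open>The interval reaches up to \<open>2 * real P\<close> because a difference of
        order q + 2 looks q + 2 \<le> P steps ahead of a point that is at most P.\<close>
      have "\<mu> \<le> (fdiff ^^ (q + 2)) (\<lambda>n. g 0 (real P0 + real n)) n \<and>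
            (fdiff ^^ (q + 2)) (\<lambda>n. g 0 (real P0 + real n)) n \<le> \<kappa> * \<mu>"
      proof (rule fdiff_pow_bounds[where a = "real P0" and b = "2 * real P"])
        fix i x assume x: "real P0 \<le> x"
        hence "x > 0" using P0 by simp
        hence "(g i has_real_derivative s * (l * (falling c i * ((c - real i) * x powr (c - real i - 1))))) (at x)"
          unfolding g_def by (intro DERIV_cmult has_real_derivative_powr)
        thus "(g i has_real_derivative g (Suc i) x) (at x)"
          by (simp add: g_def falling_def diff_diff_eq add_ac mult_ac)
      next
        fix x assume x: "real P0 \<le> x" "x \<le> 2 * real P"
        define y where "y = x / real P"
        have x0: "x > 0" using x P0 by simp
        have y: "\<epsilon> \<le> y" "y \<le> 2" "y > 0" using x P P0 x0 by (auto simp: y_def field_simps)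
        have "(2::real) \<le> 1 / \<epsilon>" using as by (simp add: field_simps)
        hence y1: "y \<le> 1 / \<epsilon>" using y by linarith
        have xr: "x powr r = real P powr r * y powr r"
          using x0 P by (simp add: y_def powr_divide)
        have g: "g (q + 2) x = \<bar>l\<bar> * G * real P powr r * y powr r"
          using s(2) xr by (simp add: g_def r_def mult.assoc [symmetric])
        note yb = powr_ratio_bounds[OF as(1) y(1) y1 b]
        have "\<mu> \<le> g (q + 2) x" unfolding g \<mu>_def using yb as G l by (intro mult_left_mono) auto
        moreover have "g (q + 2) x \<le> \<bar>l\<bar> * G * real P powr r * (1 / \<epsilon> ^ b)"
          unfolding g using yb as G l by (intro mult_left_mono) auto
        moreover have "\<bar>l\<bar> * G * real P powr r * (1 / \<epsilon> ^ b) = \<kappa> * \<mu>"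
        proof -
          have "\<epsilon> ^ (b * 2) = \<epsilon> ^ b * \<epsilon> ^ b" by (simp add: power_mult power2_eq_square)
          thus ?thesis using as by (simp add: \<kappa>_def \<mu>_def field_simps)
        qed
        ultimately show "\<mu> \<le> g (q + 2) x \<and> g (q + 2) x \<le> \<kappa> * \<mu>" by simp
      next
        show "real P0 + real n + real (q + 2) \<le> 2 * real P" using n as(5) P0P by linarith
      qed auto
      thus "\<mu> \<le> (fdiff ^^ Suc (Suc q)) f n \<and> (fdiff ^^ Suc (Suc q)) f n \<le> \<kappa> * \<mu>"
        unfolding fg by (simp del: funpow.simps)
    qed (use as \<mu> in auto)
    have sgn: "cmod (\<Sum>n<P + 1 - P0. e (l * real (P0 + n) powr c)) = cmod (\<Sum>n<P + 1 - P0. e (f n))"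
    proof (cases "s = 1")
      case False
      with s have "s = -1" by auto
      hence "(\<Sum>n<P + 1 - P0. e (f n)) = cnj (\<Sum>n<P + 1 - P0. e (l * real (P0 + n) powr c))"
        by (simp add: f_def e_uminus)
      thus ?thesis by (simp only: complex_mod_cnj)
    qed (simp add: f_def)
    have "(\<Sum>m=1..P. e (l * real m powr c)) = 
        (\<Sum>m\<in>{1..<P0} \<union> {P0..P}. e (l * real m powr c))"
      using P0P P0 by (intro sum.cong) auto
    also have "\<dots> = (\<Sum>m\<in>{1..<P0}. e (l * real m powr c)) + (\<Sum>m\<in>{P0..P}. e (l * real m powr c))"
      by (intro sum.union_disjoint) auto
    also have "(\<Sum>m\<in>{P0..P}. e (l * real m powr c)) = (\<Sum>n<P + 1 - P0. e (l * real (P0 + n) powr c))"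
      by (rule sum.reindex_bij_witness[of _ "\<lambda>n. P0 + n" "\<lambda>m. m - P0"]) auto
    also have "cmod ((\<Sum>m\<in>{1..<P0}. e (l * real m powr c)) + \<dots>) \<le> real P0 - 1 + C * \<epsilon> * real P"
    proof (rule order.trans[OF norm_triangle_ineq add_mono])
      show "cmod (\<Sum>m\<in>{1..<P0}. e (l * real m powr c)) \<le> real P0 - 1"
        using norm_sum[of "\<lambda>m. e (l * real m powr c)" "{1..<P0}"] P0 by simp
    qed (use main sgn in simp)
    also have "\<dots> \<le> (C + 2) * \<epsilon> * real P"
      using P0 eP1 by (simp add: algebra_simps)
    finally show "cmod (\<Sum>m=1..P. e (l * real m powr c)) \<le> (C + 2) * \<epsilon> * real P" .
  qed (use C in simp)
qed

lemma falling_nonzero: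
  assumes "c \<notin> \<int>"
  shows "falling c k \<noteq> 0"
  using assms by (auto simp: falling_def)

text \<open>With \<open>T = |l| P\<^sup>c\<close>, the test of order \<open>q + 2\<close> applies when \<open>T\<close> lies between \<open>P\<^sup>q\<close> and \<open>P\<^bsup>q+2\<^esup>\<close> up to powers of
  the logarithm. These ranges overlap, and \<open>q \<le> c\<close> is enough
  to cover all \<open>T\<close> up to \<open>P\<^sup>c\<close> times a power of the logarithm.\<close>

lemma power_phase_sum:
  fixes c :: real and D :: nat
  assumes "c \<notin> \<int>" "c > 0"
  shows "\<exists>B::nat. \<forall>\<^sub>F P in sequentially. \<forall>l. ln (real P) ^ B \<le> \<bar>l\<bar> * real P powr c \<longrightarrow> \<bar>l\<bar> \<le> ln (real P) ^ D \<longrightarrow>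
    cmod (\<Sum>m=1..P. e (l * real m powr c)) \<le> real P / ln (real P) ^ D"
proof -
  define Q where "Q = nat \<lfloor>c\<rfloor>"
  have cQ: "c < real Q + 1" using assms by (simp add: Q_def)
  have "\<forall>q. \<exists>K C. C > 0 \<and> (\<forall>\<epsilon> l P. 0 < \<epsilon> \<longrightarrow> \<epsilon> \<le> 1 / 2 \<longrightarrow> \<epsilon> \<le> \<bar>falling c (q + 2)\<bar> \<longrightarrow>
     \<epsilon> * \<bar>falling c (q + 2)\<bar> \<le> 1 \<longrightarrow> q + 2 \<le> P \<longrightarrow> 1 \<le> \<epsilon> ^ K * real P \<longrightarrow>
     real P ^ q \<le> \<epsilon> ^ K * (\<bar>l\<bar> * real P powr c) \<longrightarrow> \<bar>l\<bar> * real P powr c \<le> \<epsilon> ^ K * real P ^ (q + 2) \<longrightarrow>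
     cmod (\<Sum>m=1..P. e (l * real m powr c)) \<le> C * \<epsilon> * real P)"
    using power_phase_test falling_nonzero[OF assms(1)] by blast
  then obtain Kf Cf where Cf: "\<And>q. Cf q > (0::real)" and test: "\<And>q \<epsilon> l P. 0 < \<epsilon> \<Longrightarrow> \<epsilon> \<le> 1 / 2 \<Longrightarrow> \<epsilon> \<le> \<bar>falling c (q + 2)\<bar> \<Longrightarrow>
     \<epsilon> * \<bar>falling c (q + 2)\<bar> \<le> 1 \<Longrightarrow> q + 2 \<le> P \<Longrightarrow> 1 \<le> \<epsilon> ^ Kf q * real P \<Longrightarrow>
     real P ^ q \<le> \<epsilon> ^ Kf q * (\<bar>l\<bar> * real P powr c) \<Longrightarrow> \<bar>l\<bar> * real P powr c \<le> \<epsilon> ^ Kf q * real P ^ (q + 2) \<Longrightarrow>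
     cmod (\<Sum>m=1..P. e (l * real m powr c)) \<le> Cf q * \<epsilon> * real P"
    by metis
  define K where "K = Max (Kf ` {..Q})"
  define C where "C = Max (Cf ` {..Q})"
  define \<gamma> where "\<gamma> = Min ((\<lambda>q. \<bar>falling c (q + 2)\<bar>) ` {..Q})"
  define \<Gamma> where "\<Gamma> = Max ((\<lambda>q. \<bar>falling c (q + 2)\<bar>) ` {..Q})"
  have K: "Kf q \<le> K" and C: "Cf q \<le> C" and g: "\<gamma> \<le> \<bar>falling c (q + 2)\<bar>" "\<bar>falling c (q + 2)\<bar> \<le> \<Gamma>"
    if "q \<le> Q" for q
    using that by (auto simp: K_def C_def \<gamma>_def \<Gamma>_def)
  have \<gamma>: "\<gamma> > 0" unfolding \<gamma>_def using falling_nonzero[OF assms(1)] by auto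
  have "((\<lambda>P::nat. 1 / ln (real P)) \<longlongrightarrow> 0) sequentially" by real_asymp
  hence ev1: "\<forall>\<^sub>F P in sequentially. 1 / ln (real P) < min (1 / 2) (min \<gamma> (1 / (\<bar>\<Gamma>\<bar> + \<bar>C\<bar> + 1)))"
    by (rule order_tendstoD(2)) (use \<gamma> in auto)
  have ev2: "\<forall>\<^sub>F P in sequentially. ln (real P) ^ ((D + 1) * (2 * K)) \<le> real P" by real_asymp
  have ev3: "\<forall>\<^sub>F P in sequentially. ln (real P) ^ (D + (D + 1) * K) \<le> real P" by real_asymp
  have ev4: "\<forall>\<^sub>F P in sequentially. P \<ge> Q + 4" by (rule eventually_ge_at_top)
  show ?thesis
  proof (rule exI[of _ "(D + 1) * K"], use ev1 ev2 ev3 ev4 in eventually_elim, safe)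
    fix P :: nat and l :: real
    define L where "L = ln (real P)"
    \<comment> \<open>One logarithm more than demanded, to absorb the constant \<open>Cf q\<close>
      at the end.\<close>
    define \<epsilon> where "\<epsilon> = 1 / L ^ (D + 1)"
    define T where "T = \<bar>l\<bar> * real P powr c"
    assume as: "1 / ln (real P) < min (1 / 2) (min \<gamma> (1 / (\<bar>\<Gamma>\<bar> + \<bar>C\<bar> + 1)))"
      "ln (real P) ^ ((D + 1) * (2 * K)) \<le> real P" "ln (real P) ^ (D + (D + 1) * K) \<le> real P" "P \<ge> Q + 4"
      "ln (real P) ^ ((D + 1) * K) \<le> \<bar>l\<bar> * real P powr c" "\<bar>l\<bar> \<le> ln (real P) ^ D"
    note as' = as[folded L_def, folded T_def]
    have P: "real P > 1" using as by simp
    have L0: "L > 0" using P by (simp add: L_def)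
    have L2: "L > 2" using as'(1) L0 by (simp add: field_simps)
    have eL: "\<epsilon> \<le> 1 / L"
    proof -
      have "L ^ 1 \<le> L ^ (D + 1)" using L2 by (intro power_increasing) auto
      thus ?thesis using L0 unfolding \<epsilon>_def by (intro divide_left_mono) auto
    qed
    have e0: "\<epsilon> > 0" using L0 by (simp add: \<epsilon>_def)
    have e1: "\<epsilon> \<le> 1 / 2" "\<epsilon> \<le> \<gamma>" using eL as'(1) by auto
    have "\<epsilon> \<le> 1 / (\<bar>\<Gamma>\<bar> + \<bar>C\<bar> + 1)" using eL as'(1) by auto
    hence e2: "\<epsilon> * (\<bar>\<Gamma>\<bar> + \<bar>C\<bar> + 1) \<le> 1" by (simp add: field_simps)
    have eK: "\<epsilon> ^ K = 1 / L ^ ((D + 1) * K)" unfolding \<epsilon>_def power_one_over power_mult ..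
    have "1 \<le> \<epsilon> ^ K * T" using as'(5) L0 unfolding eK by (simp add: field_simps)
    hence ex: "\<exists>q\<le>Q. real P ^ q \<le> \<epsilon> ^ K * T" by (intro exI[of _ 0]) auto
    \<comment> \<open>The largest order whose lower condition holds. Below \<open>Q\<close>, failure
      at q + 1 gives the upper condition with a factor P to spare against powers of the logarithm;
      at \<open>Q\<close> it follows from the bound on |l| and c < Q + 1.\<close>
    define q where "q = (GREATEST q. q \<le> Q \<and> real P ^ q \<le> \<epsilon> ^ K * T)"
    have q: "q \<le> Q" "real P ^ q \<le> \<epsilon> ^ K * T"
      using GreatestI_ex_nat[of "\<lambda>q. q \<le> Q \<and> real P ^ q \<le> \<epsilon> ^ K * T" Q] ex unfolding q_def by auto
    have up: "T \<le> \<epsilon> ^ K * real P ^ (q + 2)"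
    proof (cases "q = Q")
      case True
      have "T \<le> L ^ D * real P powr c" unfolding T_def using as'(6) by (intro mult_right_mono) auto
      also have "\<dots> \<le> L ^ D * real P powr real (Q + 1)"
        using L0 P cQ by (intro mult_left_mono powr_mono) auto
      also have "\<dots> = L ^ D * real P ^ (Q + 1)" using P by (subst powr_realpow) auto
      also have "\<dots> = L ^ (D + (D + 1) * K) * (\<epsilon> ^ K * real P ^ (Q + 1))"
        unfolding eK using L0 by (simp add: power_add)
      also have "\<dots> \<le> real P * (\<epsilon> ^ K * real P ^ (Q + 1))"
        using as'(3) e0 by (intro mult_right_mono) auto
      finally show ?thesis using True by (simp add: mult_ac)
    next
      case False
      hence "\<not> (Suc q \<le> Q \<and> real P ^ Suc q \<le> \<epsilon> ^ K * T)"
        using Greatest_le_nat[of "\<lambda>q. q \<le> Q \<and> real P ^ q \<le> \<epsilon> ^ K * T" "Suc q" Q] unfolding q_def[symmetric] by auto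
      hence "\<epsilon> ^ K * T \<le> real P ^ Suc q" using q False by auto
      hence "T \<le> L ^ ((D + 1) * K) * real P ^ Suc q" unfolding eK using L0 by (simp add: field_simps)
      also have "\<dots> = L ^ ((D + 1) * (2 * K)) * (\<epsilon> ^ K * real P ^ Suc q)"
        unfolding eK using L0 by (simp add: power_add power_mult power2_eq_square field_simps)
      also have "\<dots> \<le> real P * (\<epsilon> ^ K * real P ^ Suc q)"
        using as'(2) e0 by (intro mult_right_mono) auto
      finally show ?thesis by (simp add: mult_ac)
    qed
    have pK: "\<epsilon> ^ K \<le> \<epsilon> ^ Kf q" using K[OF q(1)] e0 e1 by (intro power_decreasing) auto
    have T0: "T \<ge> 0" by (simp add: T_def)
    have "cmod (\<Sum>m=1..P. e (l * real m powr c)) \<le> Cf q * \<epsilon> * real P"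
    proof (rule test)
      show "\<epsilon> \<le> \<bar>falling c (q + 2)\<bar>" using e1 g[OF q(1)] by linarith
      have "\<epsilon> * \<bar>falling c (q + 2)\<bar> \<le> \<epsilon> * (\<bar>\<Gamma>\<bar> + \<bar>C\<bar> + 1)"
        using g[OF q(1)] e0 by (intro mult_left_mono) auto
      thus "\<epsilon> * \<bar>falling c (q + 2)\<bar> \<le> 1" using e2 by linarith
      show "q + 2 \<le> P" using q as' by simp
      have "L ^ ((D + 1) * K) \<le> L ^ ((D + 1) * (2 * K))" using L2 by (intro power_increasing) auto
      hence "1 \<le> \<epsilon> ^ K * real P" using as'(2) L0 unfolding eK by (simp add: field_simps)
      also have "\<dots> \<le> \<epsilon> ^ Kf q * real P" using pK by (intro mult_right_mono) auto
      finally show "1 \<le> \<epsilon> ^ Kf q * real P" .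
      have "real P ^ q \<le> \<epsilon> ^ Kf q * T" using q(2) mult_right_mono[OF pK T0] by linarith
      thus "real P ^ q \<le> \<epsilon> ^ Kf q * (\<bar>l\<bar> * real P powr c)" by (simp add: T_def)
      have "T \<le> \<epsilon> ^ Kf q * real P ^ (q + 2)"
        using up mult_right_mono[OF pK, of "real P ^ (q + 2)"] by simp
      thus "\<bar>l\<bar> * real P powr c \<le> \<epsilon> ^ Kf q * real P ^ (q + 2)" by (simp add: T_def)
    qed (use e0 e1 in auto)
    also have "\<dots> \<le> (L * (1 / L ^ (D + 1))) * real P"
    proof -
      have "\<bar>C\<bar> \<le> L"
      proof -
        have "1 / L < 1 / (\<bar>\<Gamma>\<bar> + \<bar>C\<bar> + 1)" using as'(1) by simp
        hence "\<bar>\<Gamma>\<bar> + \<bar>C\<bar> + 1 < L" using L0 by (simp add: field_simps)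
        thus ?thesis by simp
      qed
      hence "Cf q \<le> L" using C[OF q(1)] by linarith
      thus ?thesis unfolding \<epsilon>_def using L0 by (intro mult_right_mono) auto
    qed
    also have "\<dots> = real P / L ^ D" using L0 by simp
    finally show "cmod (\<Sum>m=1..P. e (l * real m powr c)) \<le> real P / ln (real P) ^ D" by (simp add: L_def)
  qed
qed

section \<open>Removing the floor function\<close>

lemma e_add_of_int [simp]: "e (x + of_int k) = e x" "e (of_int k + x) = e x"
  by (simp_all add: e_add)

lemma e_power: "e (real n * x) = e x ^ n"
  by (induction n) (simp_all add: e_add distrib_right)

lemma norm_one_minus_e: "cmod (1 - e x) = 2 * \<bar>sin (pi * x)\<bar>"
proof -
  define y where "y = pi * x"
  have "(cmod (1 - e x))\<^sup>2 = (1 - cos (2 * y))\<^sup>2 + (sin (2 * y))\<^sup>2"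
    by (simp add: cmod_power2 e_cis y_def mult.assoc)
  also have "\<dots> = (2 * sin y ^ 2)\<^sup>2 + (2 * sin y * cos y)\<^sup>2"
    by (simp add: cos_double_sin sin_double)
  also have "(2 * a\<^sup>2)\<^sup>2 + (2 * a * b)\<^sup>2 = (2 * a)\<^sup>2 * (a\<^sup>2 + b\<^sup>2)" for a b :: real
    by (simp add: power2_eq_square algebra_simps)
  finally have "(cmod (1 - e x))\<^sup>2 = (2 * \<bar>sin y\<bar>)\<^sup>2" by (simp add: power_mult_distrib)
  thus ?thesis unfolding y_def by (subst (asm) power2_eq_iff_nonneg) auto
qed

lemma norm_one_minus_e_le: "cmod (1 - e x) \<le> 2 * pi * \<bar>x\<bar>"
  using abs_sin_x_le_abs_x[of "pi * x"] by (simp add: norm_one_minus_e abs_mult)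

lemma geometric_e_le:
  assumes "0 < \<delta>" "\<delta> \<le> frac x" "frac x \<le> 1 - \<delta>"
  shows "cmod (\<Sum>j<K. e (real j * x)) \<le> 1 / (2 * \<delta>)"
proof -
  have ex: "e x = e (frac x)" using e_add_of_int(1)[of "frac x" "\<lfloor>x\<rfloor>"] by (simp add: frac_def)
  have s: "2 * \<delta> \<le> sin (pi * frac x)" by (rule sin_pi_ge'[OF assms])
  have n: "4 * \<delta> \<le> cmod (1 - e x)" using s assms(1) unfolding ex norm_one_minus_e by simp
  hence ne: "e x \<noteq> 1" using assms(1) by auto
  have "(\<Sum>j<K. e (real j * x)) = (1 - e x ^ K) / (1 - e x)"
    using ne by (simp add: e_power sum_gp_strict)
  also have "cmod \<dots> = cmod (1 - e x ^ K) / cmod (1 - e x)" by (rule norm_divide)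
  also have "\<dots> \<le> 2 / (4 * \<delta>)"
  proof (rule frac_le)
    show "cmod (1 - e x ^ K) \<le> 2"
      using norm_triangle_ineq4[of 1 "e x ^ K"] by (simp add: norm_power)
  qed (use assms n in auto)
  finally show ?thesis by simp
qed

lemma norm_sq_sum_e:
  "complex_of_real ((cmod (\<Sum>j<K. e (real j * x)))\<^sup>2) = (\<Sum>j<K. \<Sum>k<K. e (of_int (int j - int k) * x))"
  unfolding complex_norm_square cnj_sum sum_product
  by (intro sum.cong refl) (simp add: left_diff_distrib e_diff)

lemma sum_e_roots:
  assumes "K > 0" "\<bar>k\<bar> < int K"
  shows "(\<Sum>r<K. e (of_int k * (real r / real K))) = (if k = 0 then of_nat K else 0)"
proof (cases "k = 0")
  case False
  define x where "x = of_int k / real K"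
  have "e x \<noteq> 1"
  proof
    assume "e x = 1"
    hence "sin (pi * x) = 0" using norm_one_minus_e[of x] by simp
    then obtain i where "pi * x = of_int i * pi" using sin_zero_iff_int2 by auto
    hence "x = of_int i" by simp
    hence "of_int k = (of_int (i * int K) :: real)" using assms by (simp add: x_def field_simps)
    hence "k = i * int K" by (simp only: of_int_eq_iff)
    thus False using assms False by (auto simp: abs_mult)
  qed
  moreover have "(\<Sum>r<K. e (of_int k * (real r / real K))) = (\<Sum>r<K. e x ^ r)"
    by (intro sum.cong refl) (simp add: x_def e_power[symmetric] field_simps)
  moreover have "e x ^ K = 1"
    using e_of_int[of k] assms by (simp add: x_def e_power[symmetric])
  ultimately show ?thesis using False by (simp add: sum_gp_strict)
qed (use assms in auto)

text \<open>Interpolation at the points \<open>r / K\<close> with the Fejer kernel: the weights are nonnegative, sum to one, and are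
  trigonometric polynomials in \<open>x\<close>. Hence the discontinuous factor in
  \<open>e(\<theta>\<lfloor>x\<rfloor>) = e(\<theta> x) e(-\<theta> {x})\<close> is removed without Fourier series.\<close>

definition fejer_weight :: "nat \<Rightarrow> nat \<Rightarrow> real \<Rightarrow> real" where
  "fejer_weight K r x = (cmod (\<Sum>j<K. e (real j * (x - real r / real K))))\<^sup>2 / (real K)\<^sup>2"

lemma fejer_weight_nonneg [simp]: "0 \<le> fejer_weight K r x"
  by (simp add: fejer_weight_def)

text \<open>Separates x from the node r / K: for fixed r the weight is a combination of
  \<open>e\<close> at integer multiples of x, the multiples being below K in absolute value. The
  number of pairs is K^2, matching the normalisation.\<close>

lemma fejer_weight_expand:
  "complex_of_real (fejer_weight K r x) = 
     (\<Sum>j<K. \<Sum>k<K. e (of_int (int j - int k) * x) * e (of_int (int k - int j) * (real r / real K))) / (of_nat K)\<^sup>2"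
proof -
  have "complex_of_real (fejer_weight K r x) = 
    (\<Sum>j<K. \<Sum>k<K. e (of_int (int j - int k) * (x - real r / real K))) / (of_nat K)\<^sup>2"
    unfolding fejer_weight_def of_real_divide norm_sq_sum_e by simp
  also have "(\<Sum>j<K. \<Sum>k<K. e (of_int (int j - int k) * (x - real r / real K))) = 
     (\<Sum>j<K. \<Sum>k<K. e (of_int (int j - int k) * x) * e (of_int (int k - int j) * (real r / real K)))"
    by (intro sum.cong refl) (simp add: e_add[symmetric] algebra_simps diff_divide_distrib)
  finally show ?thesis .
qed

text \<open>Summation over the nodes annihilates all pairs j \<noteq> k by orthogonality of the K-th
  roots of unity.\<close>

lemma sum_fejer_weight:
  assumes "K > 0"
  shows "(\<Sum>r<K. fejer_weight K r x) = 1"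
proof -
  have "complex_of_real (\<Sum>r<K. fejer_weight K r x) = 
    (\<Sum>r<K. \<Sum>j<K. \<Sum>k<K. e (of_int (int j - int k) * x) * e (of_int (int k - int j) * (real r / real K))) / (of_nat K)\<^sup>2"
    by (simp only: of_real_sum fejer_weight_expand sum_divide_distrib)
  also have "(\<Sum>r<K. \<Sum>j<K. \<Sum>k<K. e (of_int (int j - int k) * x) * e (of_int (int k - int j) * (real r / real K)))
     = (\<Sum>j<K. \<Sum>r<K. \<Sum>k<K. e (of_int (int j - int k) * x) * e (of_int (int k - int j) * (real r / real K)))"
    by (rule sum.swap)
  also have "\<dots> = (\<Sum>j<K. \<Sum>k<K. \<Sum>r<K. e (of_int (int j - int k) * x) * e (of_int (int k - int j) * (real r / real K)))"
    by (intro sum.cong refl sum.swap)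
  also have "\<dots> = (\<Sum>j<K. \<Sum>k<K. if k = j then of_nat K else 0)"
  proof (intro sum.cong refl)
    fix j k assume jk: "j \<in> {..<K}" "k \<in> {..<K}"
    have "(\<Sum>r<K. e (of_int (int j - int k) * x) * e (of_int (int k - int j) * (real r / real K)))
      = e (of_int (int j - int k) * x) * (\<Sum>r<K. e (of_int (int k - int j) * (real r / real K)))"
      by (simp only: sum_distrib_left)
    also have "\<dots> = (if k = j then of_nat K else 0)"
      using jk assms by (subst sum_e_roots) auto
    finally show "(\<Sum>r<K. e (of_int (int j - int k) * x) * e (of_int (int k - int j) * (real r / real K)))
      = (if k = j then of_nat K else 0)" .
  qed
  also have "\<dots> = (of_nat K)\<^sup>2" by (simp add: power2_eq_square)
  finally have "complex_of_real (\<Sum>r<K. fejer_weight K r x) = complex_of_real 1" using assms by simp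
  thus ?thesis by (simp only: of_real_eq_iff)
qed

text \<open>Nodes within \<delta> of the fractional part carry total weight at most 1, and there the
  interpolated function moves by at most pi \<delta>, as |\<theta>| \<le> 1 / 2. At every other node
  the geometric sum makes the weight O(1 / (K \<delta>)^2). The fractional part has to stay \<delta>
  away from 0 and 1: the function jumps there, and a node at the opposite end would be close modulo
  1.\<close>

lemma fejer_interpolation:
  assumes "K > 0" "0 < \<delta>" "\<delta> \<le> frac x" "frac x \<le> 1 - \<delta>" "\<bar>\<theta>\<bar> \<le> 1 / 2"
  shows "cmod (e (- \<theta> * frac x) - (\<Sum>r<K. fejer_weight K r x * e (- \<theta> * (real r / real K))))
     \<le> pi * \<delta> + 1 / (2 * real K * \<delta>\<^sup>2)"
proof -
  let ?w = "\<lambda>r. fejer_weight K r x"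
  have w0: "?w r \<ge> 0" for r by (simp add: fejer_weight_def)
  have "(\<Sum>r<K. complex_of_real (?w r)) = 1"
    using sum_fejer_weight[OF assms(1), of x] by (simp flip: of_real_sum)
  hence "e (- \<theta> * frac x) = (\<Sum>r<K. complex_of_real (?w r) * e (- \<theta> * frac x))"
    by (simp add: sum_distrib_right[symmetric])
  hence "e (- \<theta> * frac x) - (\<Sum>r<K. ?w r * e (- \<theta> * (real r / real K))) =
    (\<Sum>r<K. complex_of_real (?w r) * e (- \<theta> * frac x)) - (\<Sum>r<K. ?w r * e (- \<theta> * (real r / real K)))"
    by (rule arg_cong)
  also have "\<dots> = (\<Sum>r<K. ?w r * (e (- \<theta> * frac x) - e (- \<theta> * (real r / real K))))"
    by (simp only: sum_subtractf[symmetric] right_diff_distrib)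
  finally have "cmod (e (- \<theta> * frac x) - (\<Sum>r<K. ?w r * e (- \<theta> * (real r / real K)))) =
    cmod (\<Sum>r<K. ?w r * (e (- \<theta> * frac x) - e (- \<theta> * (real r / real K))))"
    by (rule arg_cong)
  also have "\<dots> \<le> (\<Sum>r<K. ?w r * (pi * \<delta>) + 1 / (2 * (real K)\<^sup>2 * \<delta>\<^sup>2))"
  proof (rule sum_norm_le)
    fix r assume r: "r \<in> {..<K}"
    define u where "u = real r / real K"
    have u: "0 \<le> u" "u < 1" using r assms(1) by (auto simp: u_def)
    have n: "cmod (?w r * (e (- \<theta> * frac x) - e (- \<theta> * u))) = ?w r * cmod (e (- \<theta> * frac x) - e (- \<theta> * u))"
      using w0 by (simp add: norm_mult)
    show "cmod (?w r * (e (- \<theta> * frac x) - e (- \<theta> * (real r / real K)))) \<le> ?w r * (pi * \<delta>) + 1 / (2 * (real K)\<^sup>2 * \<delta>\<^sup>2)"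
    proof (cases "\<bar>frac x - u\<bar> < \<delta>")
      case True
      have "e (- \<theta> * frac x) - e (- \<theta> * u) = e (- \<theta> * frac x) * (1 - e (\<theta> * (frac x - u)))"
        by (simp add: right_diff_distrib e_add[symmetric])
      hence "cmod (e (- \<theta> * frac x) - e (- \<theta> * u)) = cmod (1 - e (\<theta> * (frac x - u)))"
        by (simp add: norm_mult)
      also have "\<dots> \<le> 2 * pi * \<bar>\<theta> * (frac x - u)\<bar>" by (rule norm_one_minus_e_le)
      also have "\<dots> = 2 * pi * (\<bar>\<theta>\<bar> * \<bar>frac x - u\<bar>)" by (simp add: abs_mult)
      also have "\<dots> \<le> 2 * pi * ((1 / 2) * \<delta>)" using True assms by (intro mult_left_mono mult_mono) auto
      finally have "cmod (e (- \<theta> * frac x) - e (- \<theta> * u)) \<le> pi * \<delta>" by simp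
      hence "?w r * cmod (e (- \<theta> * frac x) - e (- \<theta> * u)) \<le> ?w r * (pi * \<delta>)"
        using w0 by (intro mult_left_mono)
      moreover have "0 \<le> 1 / (2 * (real K)\<^sup>2 * \<delta>\<^sup>2)" by simp
      ultimately show ?thesis unfolding u_def[symmetric] n by linarith
    next
      case False
      have nn: "0 \<le> frac x - u + 1" using u frac_ge_0[of x] by linarith
      \<comment> \<open>To feed the geometric sum, x - u must be \<delta> away from the integers
        also when the node lies to the right of \<open>frac x\<close> and the difference wraps
        around.\<close>
      have fr: "frac (x - u) = (if u \<le> frac x then frac x - u else frac x - u + 1)"
      proof -
        have "x - u = of_int \<lfloor>x\<rfloor> + (frac x - u)" by (simp add: frac_def)
        hence "frac (x - u) = frac (of_int \<lfloor>x\<rfloor> + (frac x - u))" by (rule arg_cong)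
        also have "\<dots> = frac (frac x - u)" by simp
        also have "\<dots> = (if u \<le> frac x then frac x - u else frac x - u + 1)"
          using u nn frac_lt_1[of x] by (auto simp: frac_unique_iff)
        finally show ?thesis .
      qed
      have "cmod (\<Sum>j<K. e (real j * (x - u))) \<le> 1 / (2 * \<delta>)"
        using False assms u fr by (intro geometric_e_le) (auto split: if_splits)
      hence "(cmod (\<Sum>j<K. e (real j * (x - u))))\<^sup>2 \<le> (1 / (2 * \<delta>))\<^sup>2" by (intro power_mono) auto
      hence "?w r \<le> (1 / (2 * \<delta>))\<^sup>2 / (real K)\<^sup>2"
        unfolding fejer_weight_def u_def by (intro divide_right_mono) auto
      also have "\<dots> = 1 / (4 * (real K)\<^sup>2 * \<delta>\<^sup>2)" by (simp add: power2_eq_square mult_ac)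
      finally have w: "?w r \<le> 1 / (4 * (real K)\<^sup>2 * \<delta>\<^sup>2)" .
      have "cmod (e (- \<theta> * frac x) - e (- \<theta> * u)) \<le> 2"
        using norm_triangle_ineq4[of "e (- \<theta> * frac x)" "e (- \<theta> * u)"] by simp
      hence "?w r * cmod (e (- \<theta> * frac x) - e (- \<theta> * u)) \<le> 1 / (4 * (real K)\<^sup>2 * \<delta>\<^sup>2) * 2"
        using w w0 by (intro mult_mono) auto
      moreover have "1 / (4 * (real K)\<^sup>2 * \<delta>\<^sup>2) * 2 = 1 / (2 * (real K)\<^sup>2 * \<delta>\<^sup>2)" by simp
      moreover have "0 \<le> ?w r * (pi * \<delta>)" using w0 assms by simp
      ultimately show ?thesis unfolding u_def[symmetric] n by linarith
    qed
  qed
  also have "\<dots> = (\<Sum>r<K. ?w r) * (pi * \<delta>) + real K * (1 / (2 * (real K)\<^sup>2 * \<delta>\<^sup>2))"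
    by (simp add: sum.distrib sum_distrib_right)
  also have "\<dots> = pi * \<delta> + 1 / (2 * real K * \<delta>\<^sup>2)"
    using assms by (simp add: sum_fejer_weight power2_eq_square)
  finally show ?thesis .
qed

text \<open>A Fejer kernel as majorant of a neighbourhood of the integers: if x is within 1 / (6 J)
  of one, all angles 2 pi j x with j < J lie within pi / 3 of a full turn, so the J unit vectors add
  up to at least J / 2.\<close>

lemma near_integer_fejer:
  assumes "J > 0" "frac x < 1 / (6 * real J) \<or> frac x > 1 - 1 / (6 * real J)"
  shows "1 \<le> 4 / (real J)\<^sup>2 * (cmod (\<Sum>j<J. e (real j * x)))\<^sup>2"
proof -
  obtain y and k :: int where y: "x = y + of_int k" "\<bar>y\<bar> \<le> 1 / (6 * real J)"
  proof (cases "frac x < 1 / (6 * real J)")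
    case True
    show ?thesis using that[of "frac x" "\<lfloor>x\<rfloor>"] True frac_ge_0[of x] by (simp add: frac_def)
  next
    case False
    show ?thesis using that[of "frac x - 1" "\<lfloor>x\<rfloor> + 1"] False assms frac_lt_1[of x] by (auto simp: frac_def)
  qed
  have "Re (e (real j * x)) \<ge> 1 / 2" if "j < J" for j
  proof -
    have "real j * x = real j * y + of_int (int j * k)" by (simp add: y algebra_simps)
    hence "e (real j * x) = e (real j * y)" by (simp only: e_add_of_int)
    hence "Re (e (real j * x)) = cos (2 * pi * (real j * y))" by (simp add: e_cis)
    also have "\<dots> = cos \<bar>2 * pi * (real j * y)\<bar>" by (rule cos_abs_real[symmetric])
    also have "\<dots> \<ge> cos (pi / 3)"
    proof (rule cos_monotone_0_pi_le)
      have "real j * \<bar>y\<bar> \<le> real J * (1 / (6 * real J))" using that y by (intro mult_mono) auto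
      hence "real j * \<bar>y\<bar> \<le> 1 / 6" using assms by simp
      hence "2 * pi * (real j * \<bar>y\<bar>) \<le> 2 * pi * (1 / 6)" by (intro mult_left_mono) auto
      thus "\<bar>2 * pi * (real j * y)\<bar> \<le> pi / 3" by (simp add: abs_mult)
    qed auto
    finally show ?thesis by (simp add: cos_60)
  qed
  hence "(\<Sum>j<J. 1 / 2) \<le> (\<Sum>j<J. Re (e (real j * x)))" by (intro sum_mono) auto
  also have "\<dots> = Re (\<Sum>j<J. e (real j * x))" by simp
  also have "\<dots> \<le> cmod (\<Sum>j<J. e (real j * x))" by (rule complex_Re_le_cmod)
  finally have "(real J / 2)\<^sup>2 \<le> (cmod (\<Sum>j<J. e (real j * x)))\<^sup>2"
    by (intro power_mono) auto
  thus ?thesis using assms by (simp add: field_simps power2_eq_square)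
qed

text \<open>The majorant is summed over m. Its diagonal gives 4 P / J; the other pairs, fewer than
  J^2, are exponential sums over m, again normalised by J^2.\<close>

lemma card_near_integer:
  fixes x :: "nat \<Rightarrow> real"
  assumes "J > 0" and E: "\<And>k::int. k \<noteq> 0 \<Longrightarrow> \<bar>k\<bar> < int J \<Longrightarrow> cmod (\<Sum>m=1..P. e (of_int k * x m)) \<le> E"
    and "E \<ge> 0"
  shows "real (card {m\<in>{1..P}. frac (x m) < 1 / (6 * real J) \<or> frac (x m) > 1 - 1 / (6 * real J)})
     \<le> 4 * real P / real J + 4 * E"
proof -
  let ?F = "\<lambda>m. (cmod (\<Sum>j<J. e (real j * x m)))\<^sup>2"
  let ?S = "{m\<in>{1..P}. frac (x m) < 1 / (6 * real J) \<or> frac (x m) > 1 - 1 / (6 * real J)}"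
  have "real (card ?S) = (\<Sum>m\<in>?S. 1)" by simp
  also have "\<dots> \<le> (\<Sum>m\<in>?S. 4 / (real J)\<^sup>2 * ?F m)"
    using near_integer_fejer[OF assms(1)] by (intro sum_mono) auto
  also have "\<dots> \<le> (\<Sum>m=1..P. 4 / (real J)\<^sup>2 * ?F m)" by (intro sum_mono2) auto
  also have "\<dots> = 4 / (real J)\<^sup>2 * (\<Sum>m=1..P. ?F m)" by (rule sum_distrib_left[symmetric])
  also have "(\<Sum>m=1..P. ?F m) \<le> real J * real P + (real J)\<^sup>2 * E"
  proof -
    have "complex_of_real (\<Sum>m=1..P. ?F m) = (\<Sum>m=1..P. \<Sum>j<J. \<Sum>k<J. e (of_int (int j - int k) * x m))"
      by (simp only: of_real_sum norm_sq_sum_e)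
    also have "\<dots> = (\<Sum>j<J. \<Sum>m=1..P. \<Sum>k<J. e (of_int (int j - int k) * x m))" by (rule sum.swap)
    also have "\<dots> = (\<Sum>j<J. \<Sum>k<J. \<Sum>m=1..P. e (of_int (int j - int k) * x m))"
      by (intro sum.cong refl sum.swap)
    finally have "cmod (complex_of_real (\<Sum>m=1..P. ?F m)) = 
      cmod (\<Sum>j<J. \<Sum>k<J. \<Sum>m=1..P. e (of_int (int j - int k) * x m))" by (rule arg_cong)
    also have "\<dots> \<le> (\<Sum>j<J. \<Sum>k<J. (if k = j then real P else 0) + E)"
    proof (intro sum_norm_le)
      fix j k assume jk: "j \<in> {..<J}" "k \<in> {..<J}"
      show "cmod (\<Sum>m=1..P. e (of_int (int j - int k) * x m)) \<le> (if k = j then real P else 0) + E"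
        using E[of "int j - int k"] jk assms(3) by auto
    qed
    also have "\<dots> = real J * real P + (real J)\<^sup>2 * E" by (simp add: sum.distrib power2_eq_square algebra_simps)
    finally show ?thesis unfolding norm_of_real by (simp add: sum_nonneg)
  qed
  hence "4 / (real J)\<^sup>2 * (\<Sum>m=1..P. ?F m) \<le> 4 / (real J)\<^sup>2 * (real J * real P + (real J)\<^sup>2 * E)"
    by (intro mult_left_mono) auto
  also have "4 / (real J)\<^sup>2 * (real J * real P + (real J)\<^sup>2 * E) = 4 * real P / real J + 4 * E"
    using assms by (simp add: field_simps power2_eq_square)
  finally show ?thesis by simp
qed

text \<open>Away from the integers the factor \<open>e (- \<theta> * frac (x m))\<close> is replaced
  by its interpolation, at total cost 19 P / J. At the exceptional m both have norm at most 1, and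
  \<open>card_near_integer\<close> yields 8 P / J + 8 E for them. What remains are sums with phases
  (\<theta> + k) x m.\<close>

lemma floor_phase_bound:
  fixes x :: "nat \<Rightarrow> real"
  assumes "J > 0" "\<bar>\<theta>\<bar> \<le> 1 / 2" "E \<ge> 0"
    and E1: "\<And>k::int. k \<noteq> 0 \<Longrightarrow> \<bar>k\<bar> < int J \<Longrightarrow> cmod (\<Sum>m=1..P. e (of_int k * x m)) \<le> E"
    and E2: "\<And>k::int. \<bar>k\<bar> < int (J ^ 3) \<Longrightarrow> cmod (\<Sum>m=1..P. e ((\<theta> + of_int k) * x m)) \<le> E"
  shows "cmod (\<Sum>m=1..P. e (\<theta> * of_int \<lfloor>x m\<rfloor>)) \<le> 27 * real P / real J + (8 + real J ^ 3) * E"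
proof -
  \<comment> \<open>With \<delta> of order 1 / J, taking J^3 nodes makes 1 / (K \<delta>^2) of order
    1 / J as well.\<close>
  define K where "K = J ^ 3"
  define \<delta> where "\<delta> = 1 / (6 * real J)"
  have K: "K > 0" and \<delta>: "\<delta> > 0" using assms by (auto simp: K_def \<delta>_def)
  let ?S = "{m\<in>{1..P}. frac (x m) < 1 / (6 * real J) \<or> frac (x m) > 1 - 1 / (6 * real J)}"
  define h where "h m = (\<Sum>r<K. fejer_weight K r (x m) * e (- \<theta> * (real r / real K)))" for m
  have fl: "e (\<theta> * of_int \<lfloor>x m\<rfloor>) = e (\<theta> * x m) * e (- \<theta> * frac (x m))" for m
    unfolding e_add[symmetric] frac_def by (rule arg_cong[of _ _ e]) (simp add: algebra_simps)
  have Jd: "pi * \<delta> + 1 / (2 * real K * \<delta>\<^sup>2) \<le> 19 / real J"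
  proof -
    have "pi * \<delta> \<le> 4 * \<delta>" using pi_less_4 \<delta> by (intro mult_right_mono) auto
    also have "\<dots> \<le> 1 / real J" using assms(1) by (simp add: \<delta>_def field_simps)
    finally have "pi * \<delta> \<le> 1 / real J" .
    moreover have "1 / (2 * real K * \<delta>\<^sup>2) = 18 / real J"
      using assms(1) by (simp add: K_def \<delta>_def field_simps power2_eq_square power3_eq_cube)
    ultimately have "pi * \<delta> + 1 / (2 * real K * \<delta>\<^sup>2) \<le> 1 / real J + 18 / real J" by linarith
    thus ?thesis by (simp add: add_divide_distrib[symmetric])
  qed
  have "cmod ((\<Sum>m=1..P. e (\<theta> * of_int \<lfloor>x m\<rfloor>)) - (\<Sum>m=1..P. e (\<theta> * x m) * h m)) =
      cmod (\<Sum>m=1..P. e (\<theta> * x m) * (e (- \<theta> * frac (x m)) - h m))"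
    unfolding fl by (simp add: sum_subtractf algebra_simps)
  also have "\<dots> \<le> (\<Sum>m=1..P. 19 / real J + (if m \<in> ?S then 2 else 0))"
  proof (rule sum_norm_le)
    fix m assume m: "m \<in> {1..P}"
    have n: "cmod (e (\<theta> * x m) * (e (- \<theta> * frac (x m)) - h m)) = cmod (e (- \<theta> * frac (x m)) - h m)"
      by (simp add: norm_mult)
    show "cmod (e (\<theta> * x m) * (e (- \<theta> * frac (x m)) - h m)) \<le> 19 / real J + (if m \<in> ?S then 2 else 0)"
    proof (cases "m \<in> ?S")
      case True
      have "cmod (h m) \<le> (\<Sum>r<K. fejer_weight K r (x m))"
        unfolding h_def by (rule sum_norm_le) (simp add: norm_mult)
      hence "cmod (h m) \<le> 1" using sum_fejer_weight[OF K] by simp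
      hence "cmod (e (- \<theta> * frac (x m)) - h m) \<le> 2"
        using norm_triangle_ineq4[of "e (- \<theta> * frac (x m))" "h m"] by simp
      moreover have "0 \<le> 19 / real J" by simp
      ultimately show ?thesis using True unfolding n by (simp only: if_True)
    next
      case False
      hence "cmod (e (- \<theta> * frac (x m)) - h m) \<le> pi * \<delta> + 1 / (2 * real K * \<delta>\<^sup>2)"
        unfolding h_def using m K \<delta> assms(2) by (intro fejer_interpolation) (auto simp: \<delta>_def)
      thus ?thesis using False Jd unfolding n by (simp only: if_False)
    qed
  qed
  also have "\<dots> = 19 * real P / real J + (\<Sum>m\<in>{1..P}. if m \<in> ?S then 2 else 0)"
    by (simp add: sum.distrib)
  also have "(\<Sum>m\<in>{1..P}. if m \<in> ?S then 2 else 0) = (\<Sum>m\<in>?S. (2::real))"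
    by (intro sum.mono_neutral_cong_right) auto
  also have "\<dots> = 2 * real (card ?S)" by simp
  also have "\<dots> \<le> 2 * (4 * real P / real J + 4 * E)"
    using card_near_integer[OF assms(1) E1 assms(3)] by simp
  finally have 1: "cmod ((\<Sum>m=1..P. e (\<theta> * of_int \<lfloor>x m\<rfloor>)) - (\<Sum>m=1..P. e (\<theta> * x m) * h m)) \<le> 27 * real P / real J + 8 * E"
    by (simp add: field_simps)
  have 2: "cmod (\<Sum>m=1..P. e (\<theta> * x m) * h m) \<le> real K * E"
  proof -
    have "(\<Sum>m=1..P. e (\<theta> * x m) * h m) = (\<Sum>r<K. e (- \<theta> * (real r / real K)) * 
        (\<Sum>m=1..P. e (\<theta> * x m) * fejer_weight K r (x m)))"
      unfolding h_def sum_distrib_left by (subst sum.swap) (intro sum.cong refl, simp add: mult_ac)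
    also have "cmod \<dots> \<le> (\<Sum>r<K. E)"
    proof (rule sum_norm_le)
      fix r assume "r \<in> {..<K}"
      have "(\<Sum>m=1..P. e (\<theta> * x m) * fejer_weight K r (x m)) = 
         (\<Sum>m=1..P. \<Sum>j<K. \<Sum>k<K. e (of_int (int k - int j) * (real r / real K)) * e ((\<theta> + of_int (int j - int k)) * x m)) / (of_nat K)\<^sup>2"
        unfolding fejer_weight_expand sum_divide_distrib sum_distrib_left
        by (intro sum.cong refl) (simp add: e_add distrib_right)
      also have "(\<Sum>m=1..P. \<Sum>j<K. \<Sum>k<K. e (of_int (int k - int j) * (real r / real K)) * e ((\<theta> + of_int (int j - int k)) * x m))
        = (\<Sum>j<K. \<Sum>m=1..P. \<Sum>k<K. e (of_int (int k - int j) * (real r / real K)) * e ((\<theta> + of_int (int j - int k)) * x m))"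
        by (rule sum.swap)
      also have "\<dots> = (\<Sum>j<K. \<Sum>k<K. \<Sum>m=1..P. e (of_int (int k - int j) * (real r / real K)) * e ((\<theta> + of_int (int j - int k)) * x m))"
        by (intro sum.cong refl sum.swap)
      also have "\<dots> = (\<Sum>j<K. \<Sum>k<K. e (of_int (int k - int j) * (real r / real K)) * (\<Sum>m=1..P. e ((\<theta> + of_int (int j - int k)) * x m)))"
        by (simp only: sum_distrib_left)
      finally have eq: "(\<Sum>m=1..P. e (\<theta> * x m) * fejer_weight K r (x m)) =
        (\<Sum>j<K. \<Sum>k<K. e (of_int (int k - int j) * (real r / real K)) * (\<Sum>m=1..P. e ((\<theta> + of_int (int j - int k)) * x m))) / (of_nat K)\<^sup>2" .
      \<comment> \<open>The K^2 pairs are cancelled by the normalisation of the weight: each node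
        costs E, all nodes together K E.\<close>
      have "cmod (\<Sum>j<K. \<Sum>k<K. e (of_int (int k - int j) * (real r / real K)) * (\<Sum>m=1..P. e ((\<theta> + of_int (int j - int k)) * x m)))
         \<le> (\<Sum>j<K. \<Sum>k<K. E)"
      proof (intro sum_norm_le)
        fix j k assume jk: "j \<in> {..<K}" "k \<in> {..<K}"
        show "cmod (e (of_int (int k - int j) * (real r / real K)) * (\<Sum>m=1..P. e ((\<theta> + of_int (int j - int k)) * x m))) \<le> E"
          unfolding norm_mult norm_e mult_1 using jk by (intro E2) (auto simp: K_def[symmetric])
      qed
      hence "cmod (\<Sum>m=1..P. e (\<theta> * x m) * fejer_weight K r (x m)) \<le> (\<Sum>j<K. \<Sum>k<K. E) / (real K)\<^sup>2"
        unfolding eq norm_divide norm_power norm_of_nat by (intro divide_right_mono) auto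
      also have "\<dots> = E" using K by (simp add: power2_eq_square)
      finally show "cmod (e (- \<theta> * (real r / real K)) * (\<Sum>m=1..P. e (\<theta> * x m) * fejer_weight K r (x m))) \<le> E"
        unfolding norm_mult norm_e mult_1 .
    qed
    finally show ?thesis by simp
  qed
  have "cmod (\<Sum>m=1..P. e (\<theta> * of_int \<lfloor>x m\<rfloor>)) \<le> (27 * real P / real J + 8 * E) + real K * E"
    using norm_triangle_ineq2[of "\<Sum>m=1..P. e (\<theta> * of_int \<lfloor>x m\<rfloor>)" "\<Sum>m=1..P. e (\<theta> * x m) * h m"] 1 2 by linarith
  thus ?thesis by (simp add: K_def algebra_simps)
qed

text \<open>For k \<noteq> 0 the frequency \<theta> + k is at least 1 / 2 in size, so the lower
  bound on |\<theta>| P^c matters only for k = 0.\<close>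

lemma floor_power_phase_sum:
  fixes c :: real and D :: nat
  assumes "c \<notin> \<int>" "c > 0"
  shows "\<exists>B::nat. \<forall>\<^sub>F P in sequentially. \<forall>\<theta>. \<bar>\<theta>\<bar> \<le> 1 / 2 \<longrightarrow> ln (real P) ^ B \<le> \<bar>\<theta>\<bar> * real P powr c \<longrightarrow>
    cmod (\<Sum>m=1..P. e (\<theta> * of_int \<lfloor>real m powr c\<rfloor>)) \<le> real P / ln (real P) ^ D"
proof -
  \<comment> \<open>J is about L^(D + 1), so frequencies reach J^3, of order L^(3 D + 3), and the
    error E enters with a factor of order J^3. The choice covers both and leaves a saving of L^(D +
    4) in that term.\<close>
  define D' where "D' = 4 * D + 8"
  obtain B :: nat where B: "\<forall>\<^sub>F P in sequentially. \<forall>l. ln (real P) ^ B \<le> \<bar>l\<bar> * real P powr c \<longrightarrow> \<bar>l\<bar> \<le> ln (real P) ^ D' \<longrightarrow>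
    cmod (\<Sum>m=1..P. e (l * real m powr c)) \<le> real P / ln (real P) ^ D'"
    using power_phase_sum[OF assms] by blast
  \<comment> \<open>28 = 27 + 1: the surplus logarithm in J absorbs the constant 27 of
    \<open>floor_phase_bound\<close> together with the remaining term.\<close>
  have ev1: "\<forall>\<^sub>F P in sequentially. ln (real P) \<ge> 28" by real_asymp
  have ev2: "\<forall>\<^sub>F P in sequentially. ln (real P) ^ B \<le> 1 / 2 * real P powr c" using assms(2) by real_asymp
  show ?thesis
  proof (rule exI[of _ B], use B ev1 ev2 eventually_gt_at_top[of 0] in eventually_elim, safe)
    fix P :: nat and \<theta> :: real
    define L where "L = ln (real P)"
    assume "\<forall>l. ln (real P) ^ B \<le> \<bar>l\<bar> * real P powr c \<longrightarrow> \<bar>l\<bar> \<le> ln (real P) ^ D' \<longrightarrow>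
      cmod (\<Sum>m=1..P. e (l * real m powr c)) \<le> real P / ln (real P) ^ D'"
    hence IH: "cmod (\<Sum>m=1..P. e (l * real m powr c)) \<le> real P / L ^ D'"
      if "L ^ B \<le> \<bar>l\<bar> * real P powr c" "\<bar>l\<bar> \<le> L ^ D'" for l
      using that by (auto simp: L_def)
    assume "28 \<le> ln (real P)" "ln (real P) ^ B \<le> 1 / 2 * real P powr c" "\<bar>\<theta>\<bar> \<le> 1 / 2" "ln (real P) ^ B \<le> \<bar>\<theta>\<bar> * real P powr c" "P > 0"
    hence L: "28 \<le> L" "L ^ B \<le> 1 / 2 * real P powr c" "\<bar>\<theta>\<bar> \<le> 1 / 2" "L ^ B \<le> \<bar>\<theta>\<bar> * real P powr c" "P > 0"
      by (auto simp: L_def)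
    define J where "J = nat \<lceil>L ^ (D + 1)\<rceil>"
    have L1: "1 \<le> L ^ n" for n using L(1) by (intro one_le_power) auto
    have J: "L ^ (D + 1) \<le> real J" "real J \<le> L ^ (D + 1) + 1" "J > 0"
      using L1[of "D + 1"] unfolding J_def by linarith+
    have "real J \<le> 2 * L ^ (D + 1)" using J(2) L1[of "D + 1"] by linarith
    hence "real J ^ 3 \<le> (2 * L ^ (D + 1)) ^ 3" by (intro power_mono) auto
    also have "\<dots> = 8 * L ^ (3 * (D + 1))" by (simp only: power_mult_distrib power_mult[symmetric] mult.commute[of "D + 1" 3]) simp
    finally have J3: "real J ^ 3 \<le> 8 * L ^ (3 * (D + 1))" .
    have "8 + real J ^ 3 \<le> 8 * L ^ (3 * (D + 1)) + 8 * L ^ (3 * (D + 1))"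
      using J3 L1[of "3 * (D + 1)"] by linarith
    also have "\<dots> \<le> L * L ^ (3 * (D + 1))" using L(1) L1[of "3 * (D + 1)"] by simp
    also have "\<dots> = L ^ (3 * D + 4)" by (simp add: numeral_eq_Suc)
    finally have J8: "8 + real J ^ 3 \<le> L ^ (3 * D + 4)" .
    also have "\<dots> \<le> L ^ D'" using L by (intro power_increasing) (auto simp: D'_def)
    finally have JD: "8 + real J ^ 3 \<le> L ^ D'" .
    have J1: "real J \<le> real J ^ 3" using J by (intro self_le_power) auto
    define E where "E = real P / L ^ D'"
    have E0: "E \<ge> 0" using L1[of D'] by (simp add: E_def)
    have "cmod (\<Sum>m=1..P. e (\<theta> * of_int \<lfloor>real m powr c\<rfloor>)) \<le> 27 * real P / real J + (8 + real J ^ 3) * E"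
    proof (rule floor_phase_bound)
      fix k :: int assume k: "k \<noteq> 0" "\<bar>k\<bar> < int J"
      have "\<bar>real_of_int k\<bar> < real J" using k by linarith
      hence k2: "\<bar>real_of_int k\<bar> \<le> L ^ D'" using JD J1 by linarith
      have "1 \<le> \<bar>k\<bar>" using k by linarith
      hence "1 / 2 * real P powr c \<le> \<bar>real_of_int k\<bar> * real P powr c"
        by (intro mult_right_mono) (linarith, simp)
      thus "cmod (\<Sum>m = 1..P. e (real_of_int k * real m powr c)) \<le> E"
        unfolding E_def using L(2) k2 by (intro IH) linarith+
    next
      fix k :: int assume k: "\<bar>k\<bar> < int (J ^ 3)"
      have "\<bar>real_of_int k\<bar> < real (J ^ 3)" using k by linarith
      hence "\<bar>real_of_int k\<bar> < real J ^ 3" by simp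
      hence k2: "\<bar>\<theta> + real_of_int k\<bar> \<le> L ^ D'" using JD L(3) by linarith
      have "L ^ B \<le> \<bar>\<theta> + real_of_int k\<bar> * real P powr c"
      proof (cases "k = 0")
        case False
        hence "1 \<le> \<bar>k\<bar>" by linarith
        hence "1 / 2 * real P powr c \<le> \<bar>\<theta> + real_of_int k\<bar> * real P powr c"
          using L(3) by (intro mult_right_mono) (linarith, simp)
        thus ?thesis using L(2) by linarith
      qed (use L in auto)
      thus "cmod (\<Sum>m = 1..P. e ((\<theta> + real_of_int k) * real m powr c)) \<le> E"
        unfolding E_def using k2 by (intro IH)
    qed (use J L E0 in auto)
    also have "\<dots> \<le> 27 * real P / L ^ (D + 1) + L ^ (3 * D + 4) * E"
      using J J8 E0 L1[of "D + 1"] by (intro add_mono frac_le mult_right_mono) auto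
    also have "L ^ (3 * D + 4) * E \<le> real P / L ^ (D + 1)"
    proof -
      have "L ^ D' = L ^ (3 * D + 4) * L ^ (D + 4)" unfolding D'_def power_add[symmetric] by (rule arg_cong[of _ _ "power L"]) simp
      hence "L ^ (3 * D + 4) * E = real P / L ^ (D + 4)" using L(1) by (simp add: E_def)
      also have "\<dots> \<le> real P / L ^ (D + 1)" using L(1) L1[of "D + 1"] by (intro divide_left_mono power_increasing) auto
      finally show ?thesis .
    qed
    also have "27 * real P / L ^ (D + 1) + real P / L ^ (D + 1) = real P / L ^ D * (28 / L)"
      using L(1) by (simp add: field_simps)
    also have "\<dots> \<le> real P / L ^ D * 1" using L(1) L1[of D] by (intro mult_left_mono) auto
    finally show "cmod (\<Sum>m=1..P. e (\<theta> * of_int \<lfloor>real m powr c\<rfloor>)) \<le> real P / ln (real P) ^ D"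
      by (simp add: L_def)
  qed
qed

section \<open>The zeta function near the line \<open>Re s = 1\<close>\<close>

text \<open>Meant for positive real bases; as an explicit exponential it is entire in
  \<open>s\<close> by inspection, whatever the base.\<close>

definition cpow :: "real \<Rightarrow> complex \<Rightarrow> complex" where
  "cpow x s = exp (s * of_real (ln x))"

lemma norm_cpow: "x > 0 \<Longrightarrow> cmod (cpow x s) = x powr Re s"
  by (simp add: cpow_def powr_def)

lemma cpow_add: "cpow x (s + t) = cpow x s * cpow x t"
  by (simp add: cpow_def exp_add distrib_right)

lemma cpow_mult: "x > 0 \<Longrightarrow> y > 0 \<Longrightarrow> cpow (x * y) s = cpow x s * cpow y s"
  by (simp add: cpow_def ln_mult exp_add distrib_left)

lemma cpow_one_left [simp]: "cpow 1 s = 1"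
  by (simp add: cpow_def)

lemma cpow_one_right [simp]: "x > 0 \<Longrightarrow> cpow x 1 = of_real x"
  by (simp add: cpow_def exp_of_real)

lemma DERIV_cpow_minus: "((\<lambda>s. cpow x (- s)) has_field_derivative - (of_real (ln x) * cpow x (- s))) (at s within S)"
  unfolding cpow_def by (auto intro!: derivative_eq_intros)

lemma holomorphic_cpow [holomorphic_intros]: "f holomorphic_on S \<Longrightarrow> (\<lambda>s. cpow x (f s)) holomorphic_on S"
  unfolding cpow_def by (intro holomorphic_intros)

lemma cpow_vector_derivative:
  assumes "x > 0"
  shows "((\<lambda>x. cpow x s) has_vector_derivative s * cpow x (s - 1)) (at x)"
proof -
  have "((\<lambda>x. s * of_real (ln x)) has_vector_derivative s * of_real (1 / x)) (at x)"
    using assms by (intro has_vector_derivative_mult_right has_vector_derivative_of_real)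
      (auto simp: has_real_derivative_iff_has_vector_derivative[symmetric] intro!: derivative_eq_intros)
  hence "((exp \<circ> (\<lambda>x. s * of_real (ln x))) has_vector_derivative (s * of_real (1 / x)) * exp (s * of_real (ln x))) (at x)"
    by (rule field_vector_diff_chain_at) (rule DERIV_exp)
  moreover have "cpow x s = cpow x (s - 1) * of_real x"
    using cpow_add[of x "s - 1" 1] assms by simp
  ultimately show ?thesis using assms
    by (simp add: cpow_def[abs_def] o_def mult_ac)
qed

lemma powr_minus_vector_derivative:
  assumes "x > 0"
  shows "((\<lambda>x. - (C / \<sigma>) * x powr (- \<sigma>)) has_vector_derivative (if \<sigma> = 0 then 0 else C * x powr (- \<sigma> - 1))) (at x)"
  unfolding has_real_derivative_iff_has_vector_derivative[symmetric]
  using assms by (auto intro!: derivative_eq_intros simp: powr_diff field_simps)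

text \<open>The derivative -s x^(-s-1) is dominated by |s| x^(-Re s - 1), which is integrated
  exactly. Keeping the difference of powers, rather than a bound for it, lets sums over n telescope
  later.\<close>

lemma cpow_diff_bound:
  assumes "0 < a" "a \<le> b" "Re s > 0"
  shows "cmod (cpow b (- s) - cpow a (- s)) \<le> cmod s / Re s * (a powr (- Re s) - b powr (- Re s))"
proof (cases "a = b")
  case False
  have "norm (cpow b (- s) - cpow a (- s)) \<le> 
     - (cmod s / Re s) * b powr (- Re s) - (- (cmod s / Re s) * a powr (- Re s))"
  proof (rule differentiable_bound_general[where f' = "\<lambda>x. - s * cpow x (- s - 1)" and 
      \<phi>' = "\<lambda>x. cmod s * x powr (- Re s - 1)"])
    show "a < b" using False assms by simp
    show "continuous_on {a..b} (\<lambda>x. cpow x (- s))"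
      using assms
      by (intro continuous_at_imp_continuous_on ballI has_vector_derivative_continuous[OF cpow_vector_derivative]) auto
    show "continuous_on {a..b} (\<lambda>x. - (cmod s / Re s) * x powr - Re s)"
      using assms by (intro continuous_intros) auto
  next
    fix x assume x: "a < x" "x < b"
    show "((\<lambda>x. cpow x (- s)) has_vector_derivative - s * cpow x (- s - 1)) (at x)"
      using x assms by (intro cpow_vector_derivative) auto
    show "((\<lambda>x. - (cmod s / Re s) * x powr - Re s) has_vector_derivative cmod s * x powr (- Re s - 1)) (at x)"
      using powr_minus_vector_derivative[of x "cmod s" "Re s"] x assms by auto
    show "cmod (- s * cpow x (- s - 1)) \<le> cmod s * x powr (- Re s - 1)"
      using x assms by (simp add: norm_mult norm_cpow)
  qed
  thus ?thesis by (simp add: algebra_simps)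
qed auto

text \<open>This is (s - 1) times the integral of n^(-s) - x^(-s) over [n, n + 1] in closed form: a
  term of the zeta series compared with its integral.\<close>

definition zeta_term :: "nat \<Rightarrow> complex \<Rightarrow> complex" where
  "zeta_term n s = (s - 1) * cpow (real n) (- s) - (cpow (real n) (1 - s) - cpow (real n + 1) (1 - s))"

lemma zeta_term_bound:
  assumes "n > 0" "Re s > 0"
  shows "cmod (zeta_term n s) \<le> cmod (s - 1) * (cmod s / Re s * (real n powr (- Re s) - (real n + 1) powr (- Re s)))"
    (is "_ \<le> ?B")
proof -
  \<comment> \<open>An antiderivative in x of (s - 1) (n^(-s) - x^(-s)); its increment over
    [n, n + 1] is the term.\<close>
  define \<phi> where "\<phi> x = (s - 1) * cpow (real n) (- s) * of_real x + cpow x (1 - s)" for x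
  have d: "(\<phi> has_vector_derivative (s - 1) * (cpow (real n) (- s) - cpow x (- s))) (at x)" if "x > 0" for x
  proof -
    have "((\<lambda>x. (s - 1) * cpow (real n) (- s) * of_real x) has_vector_derivative (s - 1) * cpow (real n) (- s) * of_real 1) (at x)"
      by (intro has_vector_derivative_mult_right has_vector_derivative_of_real) (rule DERIV_ident)
    moreover have "((\<lambda>x. cpow x (1 - s)) has_vector_derivative (1 - s) * cpow x ((1 - s) - 1)) (at x)"
      by (rule cpow_vector_derivative) fact
    ultimately show ?thesis unfolding \<phi>_def
      by (rule has_vector_derivative_add[THEN has_vector_derivative_eq_rhs]) (simp add: algebra_simps)
  qed
  have "norm (\<phi> (real n + 1) - \<phi> (real n)) \<le> ?B * (real n + 1) - ?B * real n"
  proof (rule differentiable_bound_general[where f' = "\<lambda>x. (s - 1) * (cpow (real n) (- s) - cpow x (- s))" and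
       \<phi>' = "\<lambda>x. ?B"])
    show "continuous_on {real n..real n + 1} \<phi>"
      using assms d by (intro continuous_at_imp_continuous_on ballI has_vector_derivative_continuous[OF d]) auto
  next
    fix x assume x: "real n < x" "x < real n + 1"
    show "(\<phi> has_vector_derivative (s - 1) * (cpow (real n) (- s) - cpow x (- s))) (at x)"
      using x by (intro d) auto
    show "((*) ?B has_vector_derivative ?B) (at x)"
      by (rule has_vector_derivative_mult_right[OF has_vector_derivative_id, THEN has_vector_derivative_eq_rhs]) simp
    have "cmod (cpow (real n) (- s) - cpow x (- s)) \<le> cmod s / Re s * (real n powr (- Re s) - x powr (- Re s))"
      using cpow_diff_bound[of "real n" x s] assms x by (simp add: norm_minus_commute)
    also have "\<dots> \<le> cmod s / Re s * (real n powr (- Re s) - (real n + 1) powr (- Re s))"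
      using assms x by (intro mult_left_mono diff_left_mono powr_mono2') auto
    finally show "cmod ((s - 1) * (cpow (real n) (- s) - cpow x (- s))) \<le> ?B"
      unfolding norm_mult by (intro mult_left_mono) auto
  qed (use assms in \<open>auto intro!: continuous_intros\<close>)
  moreover have "\<phi> (real n + 1) - \<phi> (real n) = zeta_term n s"
    by (simp add: \<phi>_def zeta_term_def algebra_simps)
  moreover have "?B * (real n + 1) - ?B * real n = ?B"
    by (simp only: right_diff_distrib[symmetric]) simp
  ultimately show ?thesis by (simp only:)
qed

lemma powr_diff_bound:
  assumes "n > 0" "\<sigma> > 0"
  shows "real n powr (- \<sigma>) - (real n + 1) powr (- \<sigma>) \<le> \<sigma> * real n powr (- \<sigma> - 1)"
proof -
  have der: "((\<lambda>x. x powr (- \<sigma>)) has_real_derivative - \<sigma> * x powr (- \<sigma> - 1)) (at x)" if "real n \<le> x" for x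
    using that assms by (intro has_real_derivative_powr) auto
  have "\<exists>z>real n. z < real n + 1 \<and> (real n + 1) powr (- \<sigma>) - real n powr (- \<sigma>) = 
      (real n + 1 - real n) * (- \<sigma> * z powr (- \<sigma> - 1))"
    by (intro MVT2 der) auto
  then obtain z where z: "z > real n" "(real n + 1) powr (- \<sigma>) - real n powr (- \<sigma>) = - \<sigma> * z powr (- \<sigma> - 1)"
    by auto
  have "\<sigma> * z powr (- \<sigma> - 1) \<le> \<sigma> * real n powr (- \<sigma> - 1)"
    using z assms by (intro mult_left_mono powr_mono2') auto
  thus ?thesis using z by simp
qed

lemma zeta_term_bound':
  assumes "n > 0" "Re s > 0"
  shows "cmod (zeta_term n s) \<le> cmod (s - 1) * cmod s * real n powr (- Re s - 1)"
proof -
  have "cmod (zeta_term n s) \<le> cmod (s - 1) * (cmod s / Re s * (real n powr (- Re s) - (real n + 1) powr (- Re s)))"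
    by (rule zeta_term_bound[OF assms])
  also have "\<dots> \<le> cmod (s - 1) * (cmod s / Re s * (Re s * real n powr (- Re s - 1)))"
    using assms powr_diff_bound[of n "Re s"] by (intro mult_left_mono) auto
  finally show ?thesis using assms by simp
qed

text \<open>This is \<open>(s - 1) \<zeta>(s)\<close> continued to \<open>Re s > 0\<close>: because of the factor \<open>s - 1\<close> every term is entire
  and the pole of \<open>\<zeta>\<close> needs no separate treatment.\<close>

definition zeta_reg :: "complex \<Rightarrow> complex" where
  "zeta_reg s = 1 + (\<Sum>n. zeta_term (Suc n) s)"

lemma summable_powr_Suc: "\<sigma> > 1 \<Longrightarrow> summable (\<lambda>n. real (Suc n) powr (- \<sigma>))"
  by (subst summable_Suc_iff) (simp add: summable_real_powr_iff)

lemma summable_zeta_term: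
  assumes "Re s > 0"
  shows "summable (\<lambda>n. norm (zeta_term (Suc n) s))"
proof (rule summable_comparison_test')
  show "summable (\<lambda>n. cmod (s - 1) * cmod s * real (Suc n) powr (- (Re s + 1)))"
    using assms by (intro summable_mult summable_powr_Suc) auto
  show "norm (norm (zeta_term (Suc n) s)) \<le> cmod (s - 1) * cmod s * real (Suc n) powr (- (Re s + 1))" for n
    using zeta_term_bound'[of "Suc n" s] assms by (simp add: minus_diff_commute)
qed

lemma zeta_reg_holomorphic: "zeta_reg holomorphic_on {s. Re s > 0}"
proof -
  have "(\<lambda>s. \<Sum>n. zeta_term (Suc n) s) holomorphic_on {s. Re s > 0}"
  proof (rule holomorphic_uniform_sequence[where f = "\<lambda>N s. \<Sum>n<N. zeta_term (Suc n) s"])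
    show "open {s. Re s > 0}" by (rule open_halfspace_Re_gt)
    show "(\<lambda>s. \<Sum>n<N. zeta_term (Suc n) s) holomorphic_on {s. Re s > 0}" for N
      unfolding zeta_term_def by (intro holomorphic_intros)
    fix x assume "x \<in> {s. Re s > 0}"
    hence x: "Re x > 0" by simp
    define d where "d = Re x / 2"
    define R where "R = cmod x + d"
    have d: "d > 0" "d \<le> Re x - d" using x by (auto simp: d_def)
    have R: "R \<ge> 0" using d by (simp add: R_def)
    have *: "d \<le> Re s" "cmod s \<le> R" if "s \<in> cball x d" for s
    proof -
      have "\<bar>Re (x - s)\<bar> \<le> d" using that abs_Re_le_cmod[of "x - s"] by (simp add: dist_norm)
      thus "d \<le> Re s" using d by (simp add: abs_le_iff)
      show "cmod s \<le> R" using that norm_triangle_ineq2[of s x] by (simp add: dist_norm norm_minus_commute R_def)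
    qed
    have "uniform_limit (cball x d) (\<lambda>N s. \<Sum>n<N. zeta_term (Suc n) s) (\<lambda>s. \<Sum>n. zeta_term (Suc n) s) sequentially"
    proof (rule Weierstrass_m_test)
      show "summable (\<lambda>n. (R + 1) * R * real (Suc n) powr (- (d + 1)))"
        using d by (intro summable_mult summable_powr_Suc) auto
      fix n s assume s: "s \<in> cball x d"
      have "cmod (zeta_term (Suc n) s) \<le> cmod (s - 1) * cmod s * real (Suc n) powr (- Re s - 1)"
        using *[OF s] d by (intro zeta_term_bound') auto
      also have "\<dots> \<le> (R + 1) * R * real (Suc n) powr (- (d + 1))"
        using *[OF s] d R norm_triangle_ineq4[of s 1] by (intro mult_mono powr_mono) auto
      finally show "cmod (zeta_term (Suc n) s) \<le> (R + 1) * R * real (Suc n) powr (- (d + 1))" .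
    qed
    moreover have "cball x d \<subseteq> {s. Re s > 0}" using * d by force
    ultimately show "\<exists>d>0. cball x d \<subseteq> {s. Re s > 0} \<and>
       uniform_limit (cball x d) (\<lambda>N s. \<Sum>n<N. zeta_term (Suc n) s) (\<lambda>s. \<Sum>n. zeta_term (Suc n) s) sequentially"
      using d by blast
  qed
  thus ?thesis unfolding zeta_reg_def[abs_def] by (intro holomorphic_intros)
qed

lemma zeta_term_partial_sum:
  "(\<Sum>n<N. zeta_term (Suc n) s) = (s - 1) * (\<Sum>n<N. cpow (real (Suc n)) (- s)) - 1 + cpow (real N + 1) (1 - s)"
  by (induction N) (simp_all add: zeta_term_def algebra_simps)

text \<open>The bounds for the tail telescope to their first value. Three truncations are used: N =
  0 near the pole, N about |Im s| for the growth of zeta, and N tending to infinity for the series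
  on Re s > 1.\<close>

lemma zeta_reg_approx:
  assumes "Re s > 0"
  shows "cmod (zeta_reg s - ((s - 1) * (\<Sum>n<N. cpow (real (Suc n)) (- s)) + cpow (real N + 1) (1 - s)))
     \<le> cmod (s - 1) * (cmod s / Re s * (real N + 1) powr (- Re s))"
proof -
  have sm: "summable (\<lambda>n. zeta_term (Suc n) s)" using summable_zeta_term[OF assms] by (rule summable_norm_cancel)
  define h where "h n = - ((real n + 1) powr (- Re s))" for n
  have "h \<longlonglongrightarrow> - 0" unfolding h_def using assms by (intro tendsto_minus) real_asymp
  hence "(\<lambda>n. h (Suc n) - h n) sums (- 0 - h 0)" by (rule telescope_sums)
  hence "(\<lambda>n. h (Suc (n + N)) - h (n + N)) sums (- h N)"
  proof -
    have "(\<lambda>n. h (n + N)) \<longlonglongrightarrow> - 0" using \<open>h \<longlonglongrightarrow> - 0\<close> by (rule LIMSEQ_ignore_initial_segment)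
    from telescope_sums[OF this] show ?thesis by simp
  qed
  hence tail: "(\<lambda>n. cmod (s - 1) * (cmod s / Re s * (h (Suc (n + N)) - h (n + N)))) sums 
      (cmod (s - 1) * (cmod s / Re s * (real N + 1) powr (- Re s)))"
    unfolding h_def[of N] minus_minus by (intro sums_mult)
  have "zeta_reg s - ((s - 1) * (\<Sum>n<N. cpow (real (Suc n)) (- s)) + cpow (real N + 1) (1 - s)) =
     (\<Sum>n. zeta_term (Suc n) s) - (\<Sum>n<N. zeta_term (Suc n) s)"
    by (simp add: zeta_reg_def zeta_term_partial_sum)
  also have "\<dots> = (\<Sum>n. zeta_term (Suc (n + N)) s)"
    using suminf_split_initial_segment[OF sm, of N] by simp
  also have "cmod \<dots> \<le> (\<Sum>n. cmod (s - 1) * (cmod s / Re s * (h (Suc (n + N)) - h (n + N))))"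
  proof (rule norm_suminf_le)
    show "cmod (zeta_term (Suc (n + N)) s) \<le> cmod (s - 1) * (cmod s / Re s * (h (Suc (n + N)) - h (n + N)))" for n
      using zeta_term_bound[of "Suc (n + N)" s] assms by (simp add: h_def add_ac)
    show "summable (\<lambda>n. cmod (s - 1) * (cmod s / Re s * (h (Suc (n + N)) - h (n + N))))"
      using tail by (rule sums_summable)
  qed
  also have "\<dots> = cmod (s - 1) * (cmod s / Re s * (real N + 1) powr (- Re s))"
    using tail by (rule sums_unique[symmetric])
  finally show ?thesis .
qed

lemma zeta_reg_1 [simp]: "zeta_reg 1 = 1"
  using zeta_reg_approx[of 1 0] by (simp add: cpow_def)

definition zeta_fun :: "complex \<Rightarrow> complex" where
  "zeta_fun s = zeta_reg s / (s - 1)"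

lemma zeta_fun_holomorphic: "zeta_fun holomorphic_on {s. Re s > 0} - {1}"
  unfolding zeta_fun_def using zeta_reg_holomorphic
  by (intro holomorphic_intros) (auto intro: holomorphic_on_subset)

lemma zeta_fun_sums:
  assumes "Re s > 1"
  shows "(\<lambda>n. cpow (real (Suc n)) (- s)) sums zeta_fun s"
proof -
  have ns: "s \<noteq> 1" using assms by auto
  have "(\<lambda>N. (real N + 1) powr (1 - Re s)) \<longlonglongrightarrow> 0" using assms by real_asymp
  hence "(\<lambda>N. cmod (cpow (real N + 1) (1 - s))) \<longlonglongrightarrow> 0"
    by (simp add: norm_cpow)
  hence 1: "(\<lambda>N. cpow (real N + 1) (1 - s)) \<longlonglongrightarrow> 0" by (rule tendsto_norm_zero_cancel)
  have "(\<lambda>N. cmod (s - 1) * (cmod s / Re s * (real N + 1) powr (- Re s))) \<longlonglongrightarrow> 0" using assms by real_asymp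
  hence "(\<lambda>N. zeta_reg s - ((s - 1) * (\<Sum>n<N. cpow (real (Suc n)) (- s)) + cpow (real N + 1) (1 - s))) \<longlonglongrightarrow> 0"
    by (rule Lim_null_comparison[rotated]) (use zeta_reg_approx[of s] assms in auto)
  from tendsto_add[OF this 1] 
  have "(\<lambda>N. zeta_reg s - (s - 1) * (\<Sum>n<N. cpow (real (Suc n)) (- s))) \<longlonglongrightarrow> 0" by simp
  from tendsto_divide[OF tendsto_diff[OF tendsto_const this] tendsto_const, of "s - 1" "zeta_reg s"] ns
  have "(\<lambda>N. \<Sum>n<N. cpow (real (Suc n)) (- s)) \<longlonglongrightarrow> zeta_reg s / (s - 1)" by simp
  thus ?thesis unfolding sums_def zeta_fun_def .
qed

section \<open>Growth of zeta and its derivative near the line Re s = 1\<close>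

lemma sum_inverse_le_ln: "N > 0 \<Longrightarrow> (\<Sum>n<N. 1 / real (Suc n)) \<le> 1 + ln (real N)"
proof (induction N)
  case (Suc N)
  show ?case
  proof (cases "N = 0")
    case False
    have "ln (real N / real (Suc N)) \<le> real N / real (Suc N) - 1"
      using False by (intro ln_le_minus_one) auto
    hence "1 / real (Suc N) \<le> ln (real (Suc N)) - ln (real N)"
      using False by (simp add: ln_div field_simps)
    thus ?thesis using Suc False by simp
  qed simp
qed simp

lemma ln_abs_add_3: "1 \<le> ln (\<bar>t\<bar> + 3 :: real)"
proof -
  have "exp 1 \<le> \<bar>t\<bar> + 3" using exp_le by linarith
  thus ?thesis by (simp add: ln_ge_iff)
qed

text \<open>Truncation at about |Im s|. In the region considered x^(1 - Re s) \<le> exp 1 \<le> 3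
  for 1 \<le> x \<le> |Im s| + 3, so the partial sum is dominated by three times a harmonic sum,
  while |s| N^(-Re s) stays bounded. The condition |Im s| \<ge> \<tau> controls the division by s -
  1.\<close>

lemma zeta_fun_bound:
  assumes "\<tau> > 0"
  shows "\<exists>C>0. \<forall>s. \<bar>Im s\<bar> \<ge> \<tau> \<longrightarrow> 1 / 2 \<le> Re s \<longrightarrow> Re s \<le> 3 \<longrightarrow> 1 - 1 / ln (\<bar>Im s\<bar> + 3) \<le> Re s \<longrightarrow>
     cmod (zeta_fun s) \<le> C * ln (\<bar>Im s\<bar> + 3)"
proof (intro exI[of _ "24 + 3 / \<tau>"] conjI allI impI)
  fix s assume s: "\<bar>Im s\<bar> \<ge> \<tau>" "1 / 2 \<le> Re s" "Re s \<le> 3" "1 - 1 / ln (\<bar>Im s\<bar> + 3) \<le> Re s"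
  define t where "t = \<bar>Im s\<bar>"
  define L where "L = ln (t + 3)"
  define N where "N = nat \<lfloor>t\<rfloor> + 1"
  have L: "L \<ge> 1" using ln_abs_add_3[of t] by (simp add: L_def t_def)
  have t: "t \<ge> 0" by (simp add: t_def)
  have N: "real N + 1 \<le> t + 2" "t \<le> real N" "N > 0" using t unfolding N_def by linarith+
  have pw: "x powr (1 - Re s) \<le> 3" if "1 \<le> x" "x \<le> t + 3" for x
  proof -
    have "ln x \<le> L" unfolding L_def using that by simp
    have "(1 - Re s) * ln x \<le> 1"
    proof (cases "Re s \<le> 1")
      case True
      have "(1 - Re s) * ln x \<le> (1 / L) * L"
        using s(4) True \<open>ln x \<le> L\<close> that L by (intro mult_mono) (auto simp: L_def t_def)
      thus ?thesis using L by simp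
    next
      case False
      have "(1 - Re s) * ln x \<le> 0" using False that by (intro mult_nonpos_nonneg) auto
      thus ?thesis by simp
    qed
    hence "x powr (1 - Re s) \<le> exp 1" using that by (simp add: powr_def)
    thus ?thesis using exp_le by linarith
  qed
  have s1: "cmod (s - 1) \<ge> \<tau>" using abs_Im_le_cmod[of "s - 1"] s by simp
  hence ns: "s \<noteq> 1" using assms by auto
  have sn: "cmod s \<le> t + 3" using cmod_le[of s] s by (simp add: t_def)
  have A: "cmod (\<Sum>n<N. cpow (real (Suc n)) (- s)) \<le> 6 * L"
  proof -
    have "cmod (\<Sum>n<N. cpow (real (Suc n)) (- s)) \<le> (\<Sum>n<N. 3 * (1 / real (Suc n)))"
    proof (rule sum_norm_le)
      fix n assume n: "n \<in> {..<N}"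
      have "cmod (cpow (real (Suc n)) (- s)) = real (Suc n) powr (1 - Re s) / real (Suc n)"
        by (simp add: norm_cpow powr_diff powr_minus divide_inverse)
      also have "\<dots> \<le> 3 / real (Suc n)"
        using n N by (intro divide_right_mono pw) auto
      finally show "cmod (cpow (real (Suc n)) (- s)) \<le> 3 * (1 / real (Suc n))" by simp
    qed
    also have "\<dots> = 3 * (\<Sum>n<N. 1 / real (Suc n))" by (rule sum_distrib_left[symmetric])
    also have "\<dots> \<le> 3 * (1 + ln (real N))" using sum_inverse_le_ln[OF N(3)] by (intro mult_left_mono) auto
    also have "ln (real N) \<le> L" unfolding L_def using N by simp
    finally show ?thesis using L by simp
  qed
  have B: "cmod (cpow (real N + 1) (1 - s)) \<le> 3" using pw[of "real N + 1"] N by (simp add: norm_cpow)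
  have C: "cmod s / Re s * (real N + 1) powr (- Re s) \<le> 18"
  proof -
    have "(real N + 1) powr (- Re s) = (real N + 1) powr (1 - Re s) / (real N + 1)"
      by (simp add: powr_diff powr_minus divide_inverse)
    also have "\<dots> \<le> 3 / (t + 1)" using N t by (intro frac_le pw) auto
    finally have p: "(real N + 1) powr (- Re s) \<le> 3 / (t + 1)" .
    have "cmod s / Re s \<le> (t + 3) / (1 / 2)" using sn s t by (intro frac_le) auto
    hence "cmod s / Re s * (real N + 1) powr (- Re s) \<le> ((t + 3) / (1 / 2)) * (3 / (t + 1))"
      using p s t by (intro mult_mono) auto
    also have "\<dots> \<le> 18" using t by (simp add: field_simps)
    finally show ?thesis .
  qed
  have "cmod (zeta_reg s) \<le> cmod ((s - 1) * (\<Sum>n<N. cpow (real (Suc n)) (- s))) + cmod (cpow (real N + 1) (1 - s)) + 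
     cmod (s - 1) * (cmod s / Re s * (real N + 1) powr (- Re s))"
  proof -
    have tri: "cmod z \<le> cmod a + cmod b + r" if "cmod (z - (a + b)) \<le> r" for z a b r
      using norm_triangle_ineq2[of z "a + b"] norm_triangle_ineq[of a b] that by linarith
    show ?thesis using s by (intro tri zeta_reg_approx) auto
  qed
  also have "\<dots> \<le> cmod (s - 1) * (6 * L) + 3 + cmod (s - 1) * 18"
    unfolding norm_mult using A B C by (intro add_mono mult_left_mono) auto
  also have "3 \<le> cmod (s - 1) * (3 / \<tau>)" using s1 assms by (simp add: field_simps)
  finally have "cmod (zeta_reg s) \<le> cmod (s - 1) * (6 * L + 3 / \<tau> + 18)" by (simp add: algebra_simps)
  hence "cmod (zeta_fun s) \<le> 6 * L + 3 / \<tau> + 18"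
    using ns by (simp add: zeta_fun_def norm_divide field_simps)
  also have "\<dots> \<le> 6 * L + 3 / \<tau> * L + 18 * L" using L assms mult_left_mono[OF L, of "3 / \<tau>"] by (intro add_mono) auto
  also have "\<dots> = (24 + 3 / \<tau>) * L" by (simp add: algebra_simps)
  finally show "cmod (zeta_fun s) \<le> (24 + 3 / \<tau>) * ln (\<bar>Im s\<bar> + 3)" by (simp add: L_def t_def)
qed (use assms in \<open>simp add: add_pos_pos\<close>)

text \<open>Cauchy's estimate on a circle of radius m / L with L = ln (|Im s| + 3): a derivative
  costs one more logarithm. The region is narrower than in \<open>zeta_fun_bound\<close> so that the
  circle fits, and \<open>m\<close> also keeps it away from the real axis.\<close>

lemma zeta_fun_deriv_bound:
  assumes "\<tau> > 0"
  shows "\<exists>C>0. \<forall>s. \<bar>Im s\<bar> \<ge> \<tau> \<longrightarrow> Re s \<le> 2 \<longrightarrow> 1 - 1 / (4 * ln (\<bar>Im s\<bar> + 3)) \<le> Re s \<longrightarrow>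
     cmod (zeta_fun s) \<le> C * ln (\<bar>Im s\<bar> + 3) \<and> cmod (deriv zeta_fun s) \<le> C * ln (\<bar>Im s\<bar> + 3) ^ 2"
proof -
  obtain C where C: "C > 0" and bd: "\<And>s. \<bar>Im s\<bar> \<ge> \<tau> / 2 \<Longrightarrow> 1 / 2 \<le> Re s \<Longrightarrow> Re s \<le> 3 \<Longrightarrow>
     1 - 1 / ln (\<bar>Im s\<bar> + 3) \<le> Re s \<Longrightarrow> cmod (zeta_fun s) \<le> C * ln (\<bar>Im s\<bar> + 3)"
    using zeta_fun_bound[of "\<tau> / 2"] assms by auto
  define m where "m = min (1 / 4) (\<tau> / 2)"
  have m: "m > 0" "m \<le> 1 / 4" "m \<le> \<tau> / 2" using assms by (auto simp: m_def)
  have zb: "cmod (zeta_fun w) \<le> 2 * C * ln (\<bar>Im s\<bar> + 3)"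
    if s: "\<bar>Im s\<bar> \<ge> \<tau>" "Re s \<le> 2" "1 - 1 / (4 * ln (\<bar>Im s\<bar> + 3)) \<le> Re s" and w: "cmod (w - s) \<le> m / ln (\<bar>Im s\<bar> + 3)" for s w
  proof -
    define L where "L = ln (\<bar>Im s\<bar> + 3)"
    have L: "L \<ge> 1" using ln_abs_add_3 by (simp add: L_def)
    have r: "m / L \<le> m" using L m by (simp add: field_simps)
    have r': "m / L \<le> 1 / (4 * L)" using L m by (simp add: field_simps)
    have re: "\<bar>Re w - Re s\<bar> \<le> m / L" using abs_Re_le_cmod[of "w - s"] w by (simp add: L_def)
    have im: "\<bar>Im w - Im s\<bar> \<le> m / L" using abs_Im_le_cmod[of "w - s"] w by (simp add: L_def)
    have s3: "1 - 1 / (4 * L) \<le> Re s" using s(3) by (simp add: L_def)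
    have q: "1 / (4 * L) \<le> 1 / 4" "1 / (2 * L) = 1 / (4 * L) + 1 / (4 * L)" using L by (simp_all add: field_simps)
    have im3: "\<bar>Im w\<bar> + 3 \<le> \<bar>Im s\<bar> + 4" using im r m by linarith
    have "\<bar>Im s\<bar> + 4 \<le> (\<bar>Im s\<bar> + 3)\<^sup>2" by (simp add: power2_eq_square algebra_simps)
    hence "ln (\<bar>Im w\<bar> + 3) \<le> ln ((\<bar>Im s\<bar> + 3)\<^sup>2)" using im3 by simp
    hence lnw: "ln (\<bar>Im w\<bar> + 3) \<le> 2 * L" by (simp add: ln_realpow L_def)
    have lnw1: "ln (\<bar>Im w\<bar> + 3) \<ge> 1" by (rule ln_abs_add_3)
    have "1 / (2 * L) \<le> 1 / ln (\<bar>Im w\<bar> + 3)" using lnw lnw1 by (intro divide_left_mono) auto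
    hence "cmod (zeta_fun w) \<le> C * ln (\<bar>Im w\<bar> + 3)"
      using re im r r' s3 q s m by (intro bd) linarith+
    also have "\<dots> \<le> C * (2 * L)" using C lnw by (intro mult_left_mono) auto
    finally show ?thesis by (simp add: L_def mult_ac)
  qed
  define C' where "C' = 2 * C + 2 * C / m"
  have C': "C' \<ge> 2 * C" "C' \<ge> 2 * C / m" "C' > 0" using C m by (auto simp: C'_def add_pos_pos)
  show ?thesis
  proof (intro exI[of _ C'] conjI allI impI)
    fix s assume s: "\<bar>Im s\<bar> \<ge> \<tau>" "Re s \<le> 2" "1 - 1 / (4 * ln (\<bar>Im s\<bar> + 3)) \<le> Re s"
    define L where "L = ln (\<bar>Im s\<bar> + 3)"
    have L: "L \<ge> 1" using ln_abs_add_3 by (simp add: L_def)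
    have "cmod (zeta_fun s) \<le> 2 * C * L" using zb[OF s, of s] m L by (simp add: L_def)
    also have "\<dots> \<le> C' * L" using C' L by (intro mult_right_mono) auto
    finally show "cmod (zeta_fun s) \<le> C' * ln (\<bar>Im s\<bar> + 3)" by (simp add: L_def)
    define r where "r = m / L"
    have "r \<le> m" using m L by (simp add: r_def field_simps)
    hence r: "r \<le> 1 / 4" "r \<le> \<tau> / 2" using m by linarith+
    have "r > 0" using m L by (simp add: r_def)
    have sub: "cball s r \<subseteq> {s. Re s > 0} - {1}"
    proof
      fix w assume "w \<in> cball s r"
      hence w: "cmod (w - s) \<le> r" by (simp add: dist_norm norm_minus_commute)
      have re: "\<bar>Re w - Re s\<bar> \<le> r" using abs_Re_le_cmod[of "w - s"] w by simp
      have im: "\<bar>Im w - Im s\<bar> \<le> r" using abs_Im_le_cmod[of "w - s"] w by simp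
      have "1 / (4 * L) \<le> 1 / 4" using L by (simp add: field_simps)
      hence "Re s \<ge> 3 / 4" using s(3) unfolding L_def[symmetric] by linarith
      hence "Re w > 0" using re r by linarith
      moreover have "Im w \<noteq> 0" using im r s assms by linarith
      hence "w \<noteq> 1" by auto
      ultimately show "w \<in> {s. Re s > 0} - {1}" by simp
    qed
    have hol: "zeta_fun holomorphic_on cball s r" using zeta_fun_holomorphic sub by (rule holomorphic_on_subset)
    have "cmod ((deriv ^^ 1) zeta_fun s) \<le> fact 1 * (2 * C * L) / r ^ 1"
    proof (rule Cauchy_inequality)
      show "zeta_fun holomorphic_on ball s r" using hol by (rule holomorphic_on_subset) auto
      show "continuous_on (cball s r) zeta_fun" using hol by (rule holomorphic_on_imp_continuous_on)
      fix x assume "cmod (s - x) = r"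
      thus "cmod (zeta_fun x) \<le> 2 * C * L"
        unfolding L_def by (intro zb s) (simp add: norm_minus_commute r_def L_def)
    qed fact
    also have "\<dots> = 2 * C / m * L\<^sup>2" using m L by (simp add: r_def power2_eq_square)
    also have "\<dots> \<le> C' * L\<^sup>2" using C' by (intro mult_right_mono) auto
    finally show "cmod (deriv zeta_fun s) \<le> C' * ln (\<bar>Im s\<bar> + 3) ^ 2" by (simp add: L_def)
  qed fact
qed

section \<open>Dirichlet series with coefficients of polylogarithmic size\<close>

definition polylog_bounded :: "(nat \<Rightarrow> real) \<Rightarrow> bool" where
  "polylog_bounded a \<longleftrightarrow> (\<exists>C j. \<forall>n>0. \<bar>a n\<bar> \<le> C * (1 + ln (real n)) ^ j)"

definition dirichlet :: "(nat \<Rightarrow> real) \<Rightarrow> complex \<Rightarrow> complex" where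
  "dirichlet a s = (\<Sum>n. of_real (a (Suc n)) * cpow (real (Suc n)) (- s))"

lemma polylog_bounded_mult_ln:
  assumes "polylog_bounded a"
  shows "polylog_bounded (\<lambda>n. a n * ln (real n))"
proof -
  obtain C j where C: "\<And>n. n > 0 \<Longrightarrow> \<bar>a n\<bar> \<le> C * (1 + ln (real n)) ^ j"
    using assms unfolding polylog_bounded_def by blast
  have "\<bar>a n * ln (real n)\<bar> \<le> C * (1 + ln (real n)) ^ Suc j" if "n > 0" for n
  proof -
    have l: "ln (real n) \<ge> 0" using that by simp
    have "\<bar>a n * ln (real n)\<bar> = \<bar>a n\<bar> * ln (real n)" using l by (simp add: abs_mult)
    also have "\<dots> \<le> C * (1 + ln (real n)) ^ j * (1 + ln (real n))"
      using C[OF that] l by (intro mult_mono) (auto intro: order.trans[OF abs_ge_zero])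
    finally show ?thesis by (simp add: mult_ac)
  qed
  thus ?thesis unfolding polylog_bounded_def by blast
qed

lemma polylog_bounded_mult_ln_power:
  "polylog_bounded a \<Longrightarrow> polylog_bounded (\<lambda>n. a n * ln (real n) ^ k)"
proof (induction k)
  case (Suc k)
  from polylog_bounded_mult_ln[OF Suc.IH[OF Suc.prems]] show ?case by (simp add: mult_ac)
qed simp

lemma summable_polylog:
  assumes "polylog_bounded a" "\<sigma> > 1"
  shows "summable (\<lambda>n. \<bar>a (Suc n)\<bar> * real (Suc n) powr (- \<sigma>))"
proof -
  obtain C j where C: "\<And>n. n > 0 \<Longrightarrow> \<bar>a n\<bar> \<le> C * (1 + ln (real n)) ^ j"
    using assms(1) unfolding polylog_bounded_def by blast
  define \<delta> where "\<delta> = (\<sigma> - 1) / 2"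
  have \<delta>: "\<delta> > 0" "\<sigma> = 1 + \<delta> + \<delta>" using assms(2) by (auto simp: \<delta>_def field_simps)
  have "summable (\<lambda>n. (1 + ln (real (Suc n))) ^ j * real (Suc n) powr (- \<sigma>))"
  proof (rule summable_comparison_test_bigo)
    show "summable (\<lambda>n. norm (real (Suc n) powr (- (1 + \<delta>))))"
      using summable_powr_Suc[of "1 + \<delta>"] \<delta> by simp
    show "(\<lambda>n. (1 + ln (real (Suc n))) ^ j * real (Suc n) powr (- \<sigma>)) \<in> O(\<lambda>n. real (Suc n) powr (- (1 + \<delta>)))"
      using \<delta>(1) unfolding \<delta>(2) by real_asymp
  qed
  hence "summable (\<lambda>n. C * ((1 + ln (real (Suc n))) ^ j * real (Suc n) powr (- \<sigma>)))" by (rule summable_mult)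
  thus ?thesis
  proof (rule summable_comparison_test'[where N = 0])
    fix n :: nat
    show "norm (\<bar>a (Suc n)\<bar> * real (Suc n) powr (- \<sigma>)) \<le> C * ((1 + ln (real (Suc n))) ^ j * real (Suc n) powr (- \<sigma>))"
      using mult_right_mono[OF C[of "Suc n"], of "real (Suc n) powr (- \<sigma>)"] by (simp add: abs_mult mult_ac)
  qed
qed

lemma norm_dirichlet_term: "cmod (of_real (a (Suc n)) * cpow (real (Suc n)) (- s)) = \<bar>a (Suc n)\<bar> * real (Suc n) powr (- Re s)"
  by (simp add: norm_mult norm_cpow)

lemma summable_norm_dirichlet:
  assumes "polylog_bounded a" "Re s > 1"
  shows "summable (\<lambda>n. cmod (of_real (a (Suc n)) * cpow (real (Suc n)) (- s)))"
  unfolding norm_dirichlet_term using assms by (rule summable_polylog)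

lemma dirichlet_sums:
  assumes "polylog_bounded a" "Re s > 1"
  shows "(\<lambda>n. of_real (a (Suc n)) * cpow (real (Suc n)) (- s)) sums dirichlet a s"
  unfolding dirichlet_def using summable_norm_cancel[OF summable_norm_dirichlet[OF assms]] by (rule summable_sums)

lemma dirichlet_has_derivative:
  assumes "polylog_bounded a" "Re s > 1"
  shows "(dirichlet a has_field_derivative - dirichlet (\<lambda>n. a n * ln (real n)) s) (at s)"
proof -
  let ?S = "{s. Re s > 1}"
  let ?f = "\<lambda>n s. of_real (a (Suc n)) * cpow (real (Suc n)) (- s)"
  let ?f' = "\<lambda>n s. - (of_real (a (Suc n) * ln (real (Suc n))) * cpow (real (Suc n)) (- s))"
  have "\<exists>g g'. \<forall>x\<in>?S. ((\<lambda>n. ?f n x) sums g x) \<and> ((\<lambda>n. ?f' n x) sums g' x) \<and> (g has_field_derivative g' x) (at x)"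
  proof (rule series_and_derivative_comparison_complex[of ?S ?f ?f'])
    show "open ?S" by (rule open_halfspace_Re_gt)
    show "(?f n has_field_derivative ?f' n x) (at x)" for n x
      by (rule DERIV_cmult[OF DERIV_cpow_minus, THEN DERIV_cong]) simp
    fix x assume x: "x \<in> ?S"
    define d where "d = (Re x - 1) / 2"
    have d: "d > 0" "1 + d = Re x - d" using x by (auto simp: d_def field_simps)
    have "\<forall>y\<in>ball x d \<inter> ?S. norm (?f n y) \<le> norm (complex_of_real (\<bar>a (Suc n)\<bar> * real (Suc n) powr (- (1 + d))))" for n
    proof
      fix y assume y: "y \<in> ball x d \<inter> ?S"
      hence "\<bar>Re (x - y)\<bar> \<le> d" using abs_Re_le_cmod[of "x - y"] by (simp add: dist_norm)
      hence "1 + d \<le> Re y" using d by (simp add: abs_le_iff)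
      hence "real (Suc n) powr (- Re y) \<le> real (Suc n) powr (- (1 + d))" by (intro powr_mono) auto
      thus "norm (?f n y) \<le> norm (complex_of_real (\<bar>a (Suc n)\<bar> * real (Suc n) powr (- (1 + d))))"
        unfolding norm_dirichlet_term norm_of_real by (simp add: abs_mult mult_left_mono)
    qed
    moreover have "summable (\<lambda>n. complex_of_real (\<bar>a (Suc n)\<bar> * real (Suc n) powr (- (1 + d))))"
      by (intro summable_of_real summable_polylog assms) (use d in auto)
    moreover have "range (\<lambda>n. complex_of_real (\<bar>a (Suc n)\<bar> * real (Suc n) powr (- (1 + d)))) \<subseteq> \<real>\<^sub>\<ge>\<^sub>0"
      by (auto simp del: of_real_mult simp: nonneg_Reals_of_real_iff)
    ultimately show "\<exists>d (h :: nat \<Rightarrow> complex). 0 < d \<and> summable h \<and> range h \<subseteq> \<real>\<^sub>\<ge>\<^sub>0 \<and>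
        (\<forall>\<^sub>F n in sequentially. \<forall>y\<in>ball x d \<inter> ?S. norm (?f n y) \<le> norm (h n))"
      using d(1) always_eventually by blast
  qed
  then obtain g g' where gg: "\<And>x. x \<in> ?S \<Longrightarrow> ((\<lambda>n. ?f n x) sums g x) \<and> ((\<lambda>n. ?f' n x) sums g' x) \<and> (g has_field_derivative g' x) (at x)"
    by blast
  have s: "s \<in> ?S" using assms by simp
  have "(dirichlet a has_field_derivative g' s) (at s)"
  proof (rule has_field_derivative_transform_within_open[where S = ?S])
    show "(g has_field_derivative g' s) (at s)" using gg[OF s] by blast
    show "open ?S" by (rule open_halfspace_Re_gt)
    show "g x = dirichlet a x" if "x \<in> ?S" for x
      using gg[OF that] dirichlet_sums[OF assms(1), of x] that sums_unique2 by auto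
  qed fact
  moreover have "g' s = - dirichlet (\<lambda>n. a n * ln (real n)) s"
    using gg[OF s] sums_minus[OF dirichlet_sums[OF polylog_bounded_mult_ln[OF assms(1)] assms(2)]] sums_unique2 by blast
  ultimately show ?thesis by simp
qed

lemma higher_deriv_dirichlet:
  assumes "polylog_bounded a" "Re s > 1"
  shows "(deriv ^^ k) (dirichlet a) s = (- 1) ^ k * dirichlet (\<lambda>n. a n * ln (real n) ^ k) s"
  using assms(2)
proof (induction k arbitrary: s)
  case (Suc k)
  have "\<forall>\<^sub>F z in nhds s. z \<in> {s. Re s > 1}"
    using Suc.prems by (intro eventually_nhds_in_open open_halfspace_Re_gt) auto
  hence "\<forall>\<^sub>F z in nhds s. (deriv ^^ k) (dirichlet a) z = (- 1) ^ k * dirichlet (\<lambda>n. a n * ln (real n) ^ k) z"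
    by eventually_elim (auto intro: Suc.IH)
  hence "deriv ((deriv ^^ k) (dirichlet a)) s = deriv (\<lambda>z. (- 1) ^ k * dirichlet (\<lambda>n. a n * ln (real n) ^ k) z) s"
    by (intro deriv_cong_ev) auto
  also have "\<dots> = (- 1) ^ k * (- dirichlet (\<lambda>n. a n * ln (real n) ^ k * ln (real n)) s)"
    by (intro DERIV_imp_deriv DERIV_cmult dirichlet_has_derivative polylog_bounded_mult_ln_power assms Suc.prems)
  finally show ?case by (simp add: mult_ac)
qed auto

lemma polylog_bounded_one: "polylog_bounded (\<lambda>n. 1)"
  unfolding polylog_bounded_def by (intro exI[of _ 1] exI[of _ 0]) auto

lemma polylog_bounded_diff:
  assumes "polylog_bounded a" "polylog_bounded b"
  shows "polylog_bounded (\<lambda>n. a n - b n)"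
proof -
  obtain C j where C: "\<And>n. n > 0 \<Longrightarrow> \<bar>a n\<bar> \<le> C * (1 + ln (real n)) ^ j"
    using assms unfolding polylog_bounded_def by blast
  obtain D k where D: "\<And>n. n > 0 \<Longrightarrow> \<bar>b n\<bar> \<le> D * (1 + ln (real n)) ^ k"
    using assms unfolding polylog_bounded_def by blast
  have "\<bar>a n - b n\<bar> \<le> (\<bar>C\<bar> + \<bar>D\<bar>) * (1 + ln (real n)) ^ (j + k)" if n: "n > 0" for n
  proof -
    have l: "1 + ln (real n) \<ge> 1" using n by simp
    have "\<bar>a n - b n\<bar> \<le> \<bar>a n\<bar> + \<bar>b n\<bar>" by (rule abs_triangle_ineq4)
    also have "\<dots> \<le> C * (1 + ln (real n)) ^ j + D * (1 + ln (real n)) ^ k"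
      by (intro add_mono C D n)
    also have "\<dots> \<le> \<bar>C\<bar> * (1 + ln (real n)) ^ (j + k) + \<bar>D\<bar> * (1 + ln (real n)) ^ (j + k)"
      using l by (intro add_mono mult_mono power_increasing) auto
    finally show ?thesis by (simp add: algebra_simps)
  qed
  thus ?thesis unfolding polylog_bounded_def by blast
qed

lemma polylog_bounded_mangoldt: "polylog_bounded mangoldt"
  unfolding polylog_bounded_def
proof (intro exI[of _ 1] allI impI)
  fix n :: nat assume "n > 0"
  thus "\<bar>mangoldt n\<bar> \<le> 1 * (1 + ln (real n)) ^ 1"
    using mangoldt_le[of n] by simp
qed

lemma dirichlet_one: "Re s > 1 \<Longrightarrow> dirichlet (\<lambda>n. 1) s = zeta_fun s"
  using zeta_fun_sums[of s] by (simp add: dirichlet_def sums_iff)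

lemma dirichlet_diff:
  assumes "polylog_bounded a" "polylog_bounded b" "Re s > 1"
  shows "dirichlet (\<lambda>n. a n - b n) s = dirichlet a s - dirichlet b s"
proof -
  have "(\<lambda>n. of_real (a (Suc n) - b (Suc n)) * cpow (real (Suc n)) (- s)) sums (dirichlet a s - dirichlet b s)"
    using sums_diff[OF dirichlet_sums[OF assms(1,3)] dirichlet_sums[OF assms(2,3)]]
    by (simp add: left_diff_distrib)
  from sums_unique2[OF dirichlet_sums[OF polylog_bounded_diff[OF assms(1,2)] assms(3)] this] show ?thesis .
qed

lemma dirichlet_has_sum:
  assumes "polylog_bounded a" "Re s > 1"
  shows "((\<lambda>n. of_real (a n) * cpow (real n) (- s)) has_sum dirichlet a s) {0<..}"
proof -
  let ?f = "\<lambda>n. of_real (a n) * cpow (real n) (- s)"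
  have "((?f \<circ> Suc) has_sum dirichlet a s) UNIV"
    by (rule norm_summable_imp_has_sum) (use summable_norm_dirichlet[OF assms] dirichlet_sums[OF assms] in \<open>simp_all add: o_def\<close>)
  hence "(?f has_sum dirichlet a s) (range Suc)" by (subst has_sum_reindex) auto
  also have "range Suc = {0<..}" using image_Suc_lessThan by (auto simp: image_iff gr0_conv_Suc)
  finally show ?thesis .
qed

lemma dirichlet_abs_summable:
  assumes "polylog_bounded a" "Re s > 1"
  shows "(\<lambda>n. norm (of_real (a n) * cpow (real n) (- s))) summable_on {0<..}"
proof -
  let ?f = "\<lambda>n. norm (of_real (a n) * cpow (real n) (- s))"
  have "(?f \<circ> Suc) summable_on UNIV"
    using summable_norm_dirichlet[OF assms] by (intro norm_summable_imp_summable_on) (simp add: o_def)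
  hence "?f summable_on (range Suc)" by (subst summable_on_reindex) auto
  also have "range Suc = {0<..}" by (auto simp: image_iff gr0_conv_Suc)
  finally show ?thesis .
qed

text \<open>\<Lambda>(d) summed over the divisors d of n is ln n. The product of the two absolutely
  convergent series is a sum over pairs (d, m), regrouped by n = d m.\<close>

lemma dirichlet_mangoldt_mult_zeta:
  assumes s: "Re s > 1"
  shows "dirichlet mangoldt s * zeta_fun s = dirichlet (\<lambda>n. ln (real n)) s"
proof -
  let ?A = "{0<..} :: nat set"
  define u where "u n = of_real (mangoldt n) * cpow (real n) (- s)" for n
  define v where "v n = cpow (real n) (- s)" for n
  have U: "(u has_sum dirichlet mangoldt s) ?A" "(\<lambda>n. norm (u n)) summable_on ?A"
    unfolding u_def by (rule dirichlet_has_sum dirichlet_abs_summable polylog_bounded_mangoldt s)+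
  have V: "(v has_sum zeta_fun s) ?A" "(\<lambda>n. norm (v n)) summable_on ?A"
    using dirichlet_has_sum[OF polylog_bounded_one s] dirichlet_abs_summable[OF polylog_bounded_one s]
    by (simp_all add: v_def[abs_def] dirichlet_one[OF s])
  define h where "h = (\<lambda>(d, m). u d * v m)"
  have "(\<lambda>z. norm (h z)) summable_on Sigma ?A (\<lambda>_. ?A)"
    unfolding Infinite_Sum.abs_summable_on_Sigma_iff
  proof (intro conjI ballI)
    show "(\<lambda>y. norm (h (x, y))) summable_on ?A" for x
      using V(2) unfolding h_def case_prod_conv norm_mult by (rule summable_on_cmult_right)
    have "(\<lambda>x. infsum (\<lambda>y. norm (h (x, y))) ?A) = (\<lambda>x. norm (u x) * infsum (\<lambda>y. norm (v y)) ?A)"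
      using V(2) by (simp add: h_def norm_mult infsum_cmult_right)
    moreover have "(\<lambda>x. norm (u x) * infsum (\<lambda>y. norm (v y)) ?A) summable_on ?A"
      using U(2) by (rule summable_on_cmult_left)
    ultimately show "(\<lambda>x. norm (infsum (\<lambda>y. norm (h (x, y))) ?A)) summable_on ?A"
      by (simp add: infsum_nonneg abs_mult)
  qed
  hence sm: "h summable_on Sigma ?A (\<lambda>_. ?A)" by (rule abs_summable_summable)
  have hs: "(h has_sum (dirichlet mangoldt s * zeta_fun s)) (Sigma ?A (\<lambda>_. ?A))"
  proof (rule has_sum_SigmaI[OF _ _ sm])
    show "((\<lambda>y. h (x, y)) has_sum (u x * zeta_fun s)) ?A" for x
      using V(1) unfolding h_def case_prod_conv by (rule has_sum_cmult_right)
    show "((\<lambda>x. u x * zeta_fun s) has_sum dirichlet mangoldt s * zeta_fun s) ?A"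
      using U(1) by (rule has_sum_cmult_left)
  qed
  define g where "g = (\<lambda>(n :: nat, d :: nat). complex_of_real (mangoldt d) * cpow (real n) (- s))"
  have "(h has_sum (dirichlet mangoldt s * zeta_fun s)) (Sigma ?A (\<lambda>_. ?A)) \<longleftrightarrow>
        (g has_sum (dirichlet mangoldt s * zeta_fun s)) (Sigma ?A (\<lambda>n. {d. d dvd n}))"
  proof (rule has_sum_reindex_bij_witness[where j = "\<lambda>(d, m). (d * m, d)" and i = "\<lambda>(n, d). (d, n div d)"])
    fix a assume "a \<in> Sigma ?A (\<lambda>_. ?A)"
    thus "g (case a of (d, m) \<Rightarrow> (d * m, d)) = h a"
      by (auto simp: g_def h_def u_def v_def cpow_mult)
  qed (auto simp: dvd_pos_nat elim!: dvdE)
  with hs have gs: "(g has_sum (dirichlet mangoldt s * zeta_fun s)) (Sigma ?A (\<lambda>n. {d. d dvd n}))" by simp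
  have "((\<lambda>n. of_real (ln (real n)) * cpow (real n) (- s)) has_sum (dirichlet mangoldt s * zeta_fun s)) ?A"
  proof (rule has_sum_SigmaD[OF gs])
    fix n assume n: "n \<in> ?A"
    have "((\<lambda>d. g (n, d)) has_sum (\<Sum>d | d dvd n. g (n, d))) {d. d dvd n}"
      using n by (intro has_sum_finite) auto
    also have "(\<Sum>d | d dvd n. g (n, d)) = of_real (\<Sum>d | d dvd n. mangoldt d) * cpow (real n) (- s)"
      by (simp add: g_def sum_distrib_right)
    also have "(\<Sum>d | d dvd n. mangoldt d :: real) = ln (real n)" using mangoldt_sum[of n, where ?'a = real] n by simp
    finally show "((\<lambda>d. g (n, d)) has_sum of_real (ln (real n)) * cpow (real n) (- s)) {d. d dvd n}" .
  qed
  moreover have "((\<lambda>n. of_real (ln (real n)) * cpow (real n) (- s)) has_sum dirichlet (\<lambda>n. ln (real n)) s) ?A"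
    using dirichlet_has_sum[OF polylog_bounded_mult_ln[OF polylog_bounded_one] s] by simp
  ultimately show ?thesis by (rule has_sum_unique)
qed

section \<open>The logarithm of zeta and lower bounds up to the line Re s = 1\<close>

text \<open>The coefficient at \<open>n = 1\<close> is \<open>0 / 0 = 0\<close>. The constant \<open>K\<close> in \<open>zeta_fun_eq_exp\<close> is 1, but all that
  matters is that it does not vanish.\<close>

definition log_zeta :: "complex \<Rightarrow> complex" where
  "log_zeta = dirichlet (\<lambda>n. mangoldt n / ln (real n))"

lemma polylog_bounded_mangoldt_over_ln: "polylog_bounded (\<lambda>n. mangoldt n / ln (real n))"
  unfolding polylog_bounded_def
proof (rule exI[of _ 1], rule exI[of _ 0], intro allI impI)
  fix n :: nat assume n: "n > 0"
  show "\<bar>mangoldt n / ln (real n)\<bar> \<le> 1 * (1 + ln (real n)) ^ 0"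
    using mangoldt_le[of n] n by (cases "n = 1") (auto simp: divide_le_eq)
qed

lemma zeta_fun_DERIV: "Re s > 1 \<Longrightarrow> (zeta_fun has_field_derivative - dirichlet (\<lambda>n. ln (real n)) s) (at s)"
proof -
  assume s: "Re s > 1"
  have "(dirichlet (\<lambda>n. 1) has_field_derivative - dirichlet (\<lambda>n. ln (real n)) s) (at s)"
    using dirichlet_has_derivative[OF polylog_bounded_one s] by simp
  thus ?thesis
    by (rule has_field_derivative_transform_within_open[where S = "{s. Re s > 1}"])
       (use s in \<open>auto simp: dirichlet_one open_halfspace_Re_gt\<close>)
qed

lemma log_zeta_DERIV: "Re s > 1 \<Longrightarrow> (log_zeta has_field_derivative - dirichlet mangoldt s) (at s)"
proof -
  assume s: "Re s > 1"
  have "mangoldt n / ln (real n) * ln (real n) = mangoldt n" for n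
    by (cases "n \<le> 1") (auto simp: le_Suc_eq)
  thus ?thesis unfolding log_zeta_def
    using dirichlet_has_derivative[OF polylog_bounded_mangoldt_over_ln s] by simp
qed

text \<open>The product of zeta and \<open>exp (- log_zeta s)\<close> has derivative zero on the
  half-plane, because the logarithmic derivative of zeta is minus the series of \<Lambda>. The
  modulus of zeta is thereby governed by the real part of \<open>log_zeta\<close>, a series of
  nonnegative weights times cosines.\<close>

lemma zeta_fun_eq_exp: "\<exists>K. K \<noteq> 0 \<and> (\<forall>s. Re s > 1 \<longrightarrow> zeta_fun s = K * exp (log_zeta s))"
proof -
  let ?S = "{s. Re s > 1}"
  have conv: "convex ?S" by (rule convex_halfspace_Re_gt)
  have "\<exists>K. \<forall>s\<in>?S. zeta_fun s * exp (- log_zeta s) = K"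
  proof (rule has_field_derivative_zero_constant[OF conv])
    fix s assume "s \<in> ?S"
    hence s: "Re s > 1" by simp
    have "((\<lambda>s. zeta_fun s * exp (- log_zeta s)) has_field_derivative 
       (- dirichlet (\<lambda>n. ln (real n)) s) * exp (- log_zeta s) + (exp (- log_zeta s) * (- (- dirichlet mangoldt s))) * zeta_fun s) (at s within ?S)"
      by (intro DERIV_mult DERIV_fun_exp DERIV_minus zeta_fun_DERIV log_zeta_DERIV s has_field_derivative_at_within)
    moreover have "(- dirichlet (\<lambda>n. ln (real n)) s) * exp (- log_zeta s) + (exp (- log_zeta s) * (- (- dirichlet mangoldt s))) * zeta_fun s = 0"
      unfolding dirichlet_mangoldt_mult_zeta[OF s, symmetric] by simp
    ultimately show "((\<lambda>s. zeta_fun s * exp (- log_zeta s)) has_field_derivative 0) (at s within ?S)"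
      by (rule DERIV_cong)
  qed
  then obtain K where K: "\<And>s. Re s > 1 \<Longrightarrow> zeta_fun s * exp (- log_zeta s) = K" by auto
  have eq: "zeta_fun s = K * exp (log_zeta s)" if "Re s > 1" for s
    using K[OF that] by (simp add: exp_minus field_simps)
  have "K \<noteq> 0"
  proof
    assume "K = 0"
    hence "zeta_fun 2 = 0" using eq[of 2] by simp
    moreover have "(\<lambda>n. Re (cpow (real (Suc n)) (- 2))) sums Re (zeta_fun 2)"
      using zeta_fun_sums[of 2] by (intro sums_Re) auto
    moreover have "Re (cpow (real (Suc n)) (- 2)) > 0" for n
    proof -
      have "cpow (real (Suc n)) (- 2) = complex_of_real (exp (- 2 * ln (real (Suc n))))"
        unfolding cpow_def exp_of_real[symmetric] by simp
      thus ?thesis by simp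
    qed
    ultimately show False using suminf_pos[of "\<lambda>n. Re (cpow (real (Suc n)) (- 2))"]
      by (auto simp: sums_iff)
  qed
  with eq show ?thesis by blast
qed

lemma zeta_fun_nonzero_Re_gt_1: "Re s > 1 \<Longrightarrow> zeta_fun s \<noteq> 0"
  using zeta_fun_eq_exp by force

text \<open>Nonnegativity of 3 + 4 cos x + cos 2x = 2 (1 + cos x)^2, applied to every term of the
  real part of \<open>log_zeta\<close> at \<sigma>, \<sigma> + i t and \<sigma> + 2 i t. The
  exponents 3 + 4 + 1 = 8 turn the constant into |K|^8.\<close>

lemma zeta_341:
  "\<exists>c>0. \<forall>\<sigma> t. \<sigma> > 1 \<longrightarrow> c \<le> cmod (zeta_fun (Complex \<sigma> 0)) ^ 3 * cmod (zeta_fun (Complex \<sigma> t)) ^ 4 * cmod (zeta_fun (Complex \<sigma> (2 * t)))"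
proof -
  obtain K where K: "K \<noteq> 0" "\<And>s. Re s > 1 \<Longrightarrow> zeta_fun s = K * exp (log_zeta s)"
    using zeta_fun_eq_exp by blast
  show ?thesis
  proof (intro exI[of _ "cmod K ^ 8"] conjI allI impI)
    fix \<sigma> t :: real assume \<sigma>: "\<sigma> > 1"
    let ?w = "\<lambda>n. mangoldt (Suc n) / ln (real (Suc n)) * real (Suc n) powr (- \<sigma>)"
    have re: "Re (complex_of_real (mangoldt (Suc n) / ln (real (Suc n))) * cpow (real (Suc n)) (- Complex \<sigma> y)) = ?w n * cos (y * ln (real (Suc n)))" for n y
      by (simp add: cpow_def Re_exp powr_def)
    have L: "(\<lambda>n. ?w n * cos (y * ln (real (Suc n)))) sums Re (log_zeta (Complex \<sigma> y))" for y
      unfolding re[symmetric] log_zeta_def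
      by (intro sums_Re dirichlet_sums polylog_bounded_mangoldt_over_ln) (use \<sigma> in simp)
    have "(\<lambda>n. 3 * (?w n * cos (0 * ln (real (Suc n)))) + 4 * (?w n * cos (t * ln (real (Suc n)))) + ?w n * cos (2 * t * ln (real (Suc n)))) sums
      (3 * Re (log_zeta (Complex \<sigma> 0)) + 4 * Re (log_zeta (Complex \<sigma> t)) + Re (log_zeta (Complex \<sigma> (2 * t))))"
      by (intro sums_add sums_mult L)
    moreover have "0 \<le> 3 * (?w n * cos (0 * ln (real (Suc n)))) + 4 * (?w n * cos (t * ln (real (Suc n)))) + ?w n * cos (2 * t * ln (real (Suc n)))" for n
    proof -
      define x where "x = t * ln (real (Suc n))"
      have "3 * (?w n * cos (0 * ln (real (Suc n)))) + 4 * (?w n * cos (t * ln (real (Suc n)))) + ?w n * cos (2 * t * ln (real (Suc n)))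
         = ?w n * (3 + 4 * cos x + cos (2 * x))"
        by (simp add: x_def algebra_simps)
      also have "3 + 4 * cos x + cos (2 * x) = 2 * (1 + cos x)\<^sup>2"
        unfolding cos_double_cos power2_eq_square by (simp add: algebra_simps)
      also have "?w n * (2 * (1 + cos x)\<^sup>2) \<ge> 0"
        by (intro mult_nonneg_nonneg divide_nonneg_nonneg mangoldt_nonneg) auto
      finally show ?thesis .
    qed
    ultimately have pos: "0 \<le> 3 * Re (log_zeta (Complex \<sigma> 0)) + 4 * Re (log_zeta (Complex \<sigma> t)) + Re (log_zeta (Complex \<sigma> (2 * t)))"
      by (rule sums_le[OF _ sums_zero, rotated])
    have n: "cmod (zeta_fun (Complex \<sigma> y)) = cmod K * exp (Re (log_zeta (Complex \<sigma> y)))" for y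
      using K(2)[of "Complex \<sigma> y"] \<sigma> by (simp add: norm_mult)
    have "cmod (zeta_fun (Complex \<sigma> 0)) ^ 3 * cmod (zeta_fun (Complex \<sigma> t)) ^ 4 * cmod (zeta_fun (Complex \<sigma> (2 * t)))
       = cmod K ^ 8 * exp (3 * Re (log_zeta (Complex \<sigma> 0)) + 4 * Re (log_zeta (Complex \<sigma> t)) + Re (log_zeta (Complex \<sigma> (2 * t))))"
    proof -
      have "(k * exp a) ^ 3 * (k * exp b) ^ 4 * (k * exp c) = k ^ 8 * exp (3 * a + 4 * b + c)" for k a b c :: real
        using exp_of_nat_mult[of 3 a] exp_of_nat_mult[of 4 b]
        by (simp add: exp_add power_mult_distrib) (simp add: power_numeral_reduce)
      thus ?thesis unfolding n .
    qed
    moreover have "cmod K ^ 8 * 1 \<le> cmod K ^ 8 * exp (3 * Re (log_zeta (Complex \<sigma> 0)) + 4 * Re (log_zeta (Complex \<sigma> t)) + Re (log_zeta (Complex \<sigma> (2 * t))))"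
      using pos by (intro mult_left_mono) auto
    ultimately show "cmod K ^ 8 \<le> cmod (zeta_fun (Complex \<sigma> 0)) ^ 3 * cmod (zeta_fun (Complex \<sigma> t)) ^ 4 * cmod (zeta_fun (Complex \<sigma> (2 * t)))" by simp
  qed (use K in auto)
qed

text \<open>Truncation with no term at all: on this part of the real axis \<open>zeta_reg\<close> is
  within \<sigma> - 1 of 1.\<close>

lemma zeta_fun_real_bound:
  assumes "1 < \<sigma>" "\<sigma> \<le> 2"
  shows "cmod (zeta_fun (Complex \<sigma> 0)) \<le> 2 / (\<sigma> - 1)"
proof -
  have c: "Complex \<sigma> 0 = of_real \<sigma>" by (simp add: complex_eq_iff)
  have d: "cmod (of_real \<sigma> - 1) = \<sigma> - 1"
    using assms norm_of_real[of "\<sigma> - 1", where ?'a = complex] by (simp del: norm_of_real)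
  have "cmod (zeta_reg (of_real \<sigma>) - ((of_real \<sigma> - 1) * (\<Sum>n<0. cpow (real (Suc n)) (- of_real \<sigma>)) + cpow (real 0 + 1) (1 - of_real \<sigma>)))
     \<le> cmod (of_real \<sigma> - 1) * (cmod (of_real \<sigma>) / Re (of_real \<sigma>) * (real 0 + 1) powr (- Re (of_real \<sigma>)))"
    using assms by (intro zeta_reg_approx) auto
  hence "cmod (zeta_reg (of_real \<sigma>) - 1) \<le> \<sigma> - 1" using assms by (simp add: d)
  hence "cmod (zeta_reg (of_real \<sigma>)) \<le> 2"
    using norm_triangle_ineq2[of "zeta_reg (of_real \<sigma>)" 1] assms by simp
  thus ?thesis using assms by (simp add: zeta_fun_def c norm_divide d divide_right_mono)
qed

text \<open>At distance \<eta> to the right of the line, 3-4-1 gives |zeta| at least of order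
  \<eta>^(3/4) L^(-1/4), since zeta is at most 2 / \<eta> at the real point and of order at most L
  at height 2 t. Moving back to the line changes zeta by at most C L^2 \<eta>. With \<eta> = d^4 /
  L^9 both quantities have order L^-7, the gain with a factor d^3 and the loss with d^4, so a small
  constant d decides.\<close>

lemma zeta_fun_lower_bound:
  assumes "\<tau> > 0"
  shows "\<exists>c>0. \<forall>s. \<bar>Im s\<bar> \<ge> \<tau> \<longrightarrow> 1 \<le> Re s \<longrightarrow> Re s \<le> 2 \<longrightarrow> c / ln (\<bar>Im s\<bar> + 3) ^ 7 \<le> cmod (zeta_fun s)"
proof -
  obtain C where C: "C > 0" and ub: "\<And>s. \<bar>Im s\<bar> \<ge> \<tau> \<Longrightarrow> Re s \<le> 2 \<Longrightarrow> 1 - 1 / (4 * ln (\<bar>Im s\<bar> + 3)) \<le> Re s \<Longrightarrow>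
     cmod (zeta_fun s) \<le> C * ln (\<bar>Im s\<bar> + 3) \<and> cmod (deriv zeta_fun s) \<le> C * ln (\<bar>Im s\<bar> + 3) ^ 2"
    using zeta_fun_deriv_bound[OF assms] by metis
  obtain k where k: "k > 0" and k341: "\<And>\<sigma> t. \<sigma> > 1 \<Longrightarrow> k \<le> cmod (zeta_fun (Complex \<sigma> 0)) ^ 3 * cmod (zeta_fun (Complex \<sigma> t)) ^ 4 * cmod (zeta_fun (Complex \<sigma> (2 * t)))"
    using zeta_341 by metis
  \<comment> \<open>16 = 2^3 * 2, from (2 / \<eta>)^3 and from ln (2 |t| + 3) \<le> 2 L.\<close>
  define q where "q = root 4 (k / (16 * C))"
  have q: "q > 0" "q ^ 4 = k / (16 * C)" using k C by (auto simp: q_def)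
  \<comment> \<open>Chosen so that the loss C d^4 is at most half of the gain q d^3.\<close>
  define d where "d = min (1 / 2) (q / (2 * C))"
  have d: "d > 0" "d \<le> 1 / 2" "C * d \<le> q / 2" using q C by (auto simp: d_def min_def field_simps)
  have lb: "q * d ^ 3 / ln (\<bar>t\<bar> + 3) ^ 7 \<le> cmod (zeta_fun (Complex \<sigma> t))"
    if t: "\<bar>t\<bar> \<ge> \<tau>" and \<sigma>: "\<sigma> - 1 \<ge> d ^ 4 / ln (\<bar>t\<bar> + 3) ^ 9" "\<sigma> \<le> 2" for t \<sigma>
  proof -
    define L where "L = ln (\<bar>t\<bar> + 3)"
    have L: "L \<ge> 1" using ln_abs_add_3 by (simp add: L_def)
    define \<eta> where "\<eta> = d ^ 4 / L ^ 9"
    have \<eta>: "\<eta> > 0" "\<eta> \<le> \<sigma> - 1" using d L \<sigma> by (auto simp: \<eta>_def L_def)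
    have "(\<bar>t\<bar> + 3)\<^sup>2 = t * t + 6 * \<bar>t\<bar> + 9" by (simp add: power2_eq_square algebra_simps)
    moreover have "\<bar>2 * t\<bar> = 2 * \<bar>t\<bar>" "t * t \<ge> 0" by simp_all
    ultimately have "\<bar>2 * t\<bar> + 3 \<le> (\<bar>t\<bar> + 3)\<^sup>2" by linarith
    hence "ln (\<bar>2 * t\<bar> + 3) \<le> ln ((\<bar>t\<bar> + 3)\<^sup>2)" by simp
    hence ln2: "ln (\<bar>2 * t\<bar> + 3) \<le> 2 * L" by (simp add: ln_realpow L_def)
    have ln21: "ln (\<bar>2 * t\<bar> + 3) \<ge> 1" by (rule ln_abs_add_3)
    have "cmod (zeta_fun (Complex \<sigma> (2 * t))) \<le> C * ln (\<bar>2 * t\<bar> + 3)"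
    proof -
      have "1 - 1 / (4 * ln (\<bar>2 * t\<bar> + 3)) \<le> 1" using ln21 by simp
      hence "1 - 1 / (4 * ln (\<bar>2 * t\<bar> + 3)) \<le> \<sigma>" using \<eta> by linarith
      moreover have "\<tau> \<le> \<bar>2 * t\<bar>" using t by (simp add: abs_mult)
      ultimately show ?thesis using ub[of "Complex \<sigma> (2 * t)"] \<sigma>(2) by simp
    qed
    also have "\<dots> \<le> C * (2 * L)" using ln2 C by (intro mult_left_mono) auto
    finally have z2: "cmod (zeta_fun (Complex \<sigma> (2 * t))) \<le> C * (2 * L)" .
    have "cmod (zeta_fun (Complex \<sigma> 0)) \<le> 2 / (\<sigma> - 1)" using \<eta> \<sigma> by (intro zeta_fun_real_bound) auto
    also have "\<dots> \<le> 2 / \<eta>" using \<eta> by (intro divide_left_mono) auto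
    finally have z0: "cmod (zeta_fun (Complex \<sigma> 0)) \<le> 2 / \<eta>" .
    have "k \<le> cmod (zeta_fun (Complex \<sigma> 0)) ^ 3 * cmod (zeta_fun (Complex \<sigma> t)) ^ 4 * cmod (zeta_fun (Complex \<sigma> (2 * t)))"
      using \<eta> by (intro k341) auto
    also have "\<dots> \<le> (2 / \<eta>) ^ 3 * cmod (zeta_fun (Complex \<sigma> t)) ^ 4 * (C * (2 * L))"
      using z0 z2 \<eta> by (intro mult_mono power_mono) auto
    also have "\<dots> = 16 * C * (L / \<eta> ^ 3 * cmod (zeta_fun (Complex \<sigma> t)) ^ 4)"
      by (simp add: power_divide)
    finally have "k / (16 * C) \<le> L / \<eta> ^ 3 * cmod (zeta_fun (Complex \<sigma> t)) ^ 4"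
      using C by (simp add: field_simps)
    hence "q ^ 4 * (\<eta> ^ 3 / L) \<le> (L / \<eta> ^ 3 * cmod (zeta_fun (Complex \<sigma> t)) ^ 4) * (\<eta> ^ 3 / L)"
      using \<eta> L unfolding q by (intro mult_right_mono) auto
    also have "\<dots> = cmod (zeta_fun (Complex \<sigma> t)) ^ 4" using \<eta> L by simp
    finally have "q ^ 4 * (\<eta> ^ 3 / L) \<le> cmod (zeta_fun (Complex \<sigma> t)) ^ 4" .
    also have "\<eta> ^ 3 / L = (d ^ 3 / L ^ 7) ^ 4"
      by (simp add: \<eta>_def power_divide power_mult[symmetric] flip: power_Suc2)
    finally have "(q * (d ^ 3 / L ^ 7)) ^ 4 \<le> cmod (zeta_fun (Complex \<sigma> t)) ^ 4"
      by (simp only: power_mult_distrib)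
    hence "q * (d ^ 3 / L ^ 7) \<le> cmod (zeta_fun (Complex \<sigma> t))"
      by (subst (asm) power_mono_iff) (use q d L in auto)
    thus ?thesis by (simp add: L_def)
  qed
  show ?thesis
  proof (intro exI[of _ "q * d ^ 3 / 2"] conjI allI impI)
    fix s assume s: "\<bar>Im s\<bar> \<ge> \<tau>" "1 \<le> Re s" "Re s \<le> 2"
    define L where "L = ln (\<bar>Im s\<bar> + 3)"
    have L: "L \<ge> 1" using ln_abs_add_3 by (simp add: L_def)
    define \<eta> where "\<eta> = d ^ 4 / L ^ 9"
    have \<eta>0: "\<eta> > 0" using d L by (simp add: \<eta>_def)
    have "d ^ 4 \<le> 1" "1 \<le> L ^ 9" using d L by (auto intro!: power_le_one one_le_power)
    hence "d ^ 4 \<le> L ^ 9" by linarith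
    hence \<eta>1: "\<eta> \<le> 1" using L by (simp add: \<eta>_def divide_le_eq)
    have qd: "q * d ^ 3 / L ^ 7 \<ge> 0" using q d L by simp
    have "(q * d ^ 3 / L ^ 7) / 2 \<le> cmod (zeta_fun s)"
    proof (cases "Re s - 1 \<ge> \<eta>")
      case True
      hence "q * d ^ 3 / L ^ 7 \<le> cmod (zeta_fun (Complex (Re s) (Im s)))"
        unfolding L_def by (intro lb) (use s in \<open>auto simp: \<eta>_def L_def\<close>)
      moreover have "x / 2 \<le> y" if "x \<le> y" "0 \<le> x" for x y :: real using that by simp
      ultimately show ?thesis using qd unfolding complex.collapse by blast
    next
      case False
      define s1 where "s1 = Complex (1 + \<eta>) (Im s)"
      have l1: "q * d ^ 3 / L ^ 7 \<le> cmod (zeta_fun s1)"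
        unfolding L_def s1_def by (intro lb) (use s \<eta>1 in \<open>auto simp: \<eta>_def L_def\<close>)
      have "cmod (zeta_fun s1 - zeta_fun s) \<le> C * L ^ 2 * cmod (s1 - s)"
      proof (rule field_differentiable_bound[where S = "closed_segment s s1" and f' = "deriv zeta_fun"])
        fix z assume "z \<in> closed_segment s s1"
        hence z: "Im z = Im s" "1 \<le> Re z" "Re z \<le> 2"
        proof -
          obtain u where u: "0 \<le> u" "u \<le> 1" "z = (1 - u) *\<^sub>R s + u *\<^sub>R s1"
            using \<open>z \<in> closed_segment s s1\<close> by (auto simp: closed_segment_def)
          have "Im z = (1 - u) * Im s + u * Im s" using u by (simp add: s1_def)
          thus "Im z = Im s" by (simp add: algebra_simps)
          have r: "Re z = (1 - u) * Re s + u * (1 + \<eta>)" using u by (simp add: s1_def)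
          have "(1 - u) * 1 + u * 1 \<le> (1 - u) * Re s + u * (1 + \<eta>)"
            using u s \<eta>0 by (intro add_mono mult_left_mono) auto
          thus "1 \<le> Re z" using r by simp
          have "(1 - u) * Re s + u * (1 + \<eta>) \<le> (1 - u) * 2 + u * 2"
            using u s \<eta>1 by (intro add_mono mult_left_mono) auto
          thus "Re z \<le> 2" using r by simp
        qed
        have "z \<noteq> 1" using z s assms by auto
        hence "z \<in> {s. Re s > 0} - {1}" using z by auto
        hence "(zeta_fun has_field_derivative deriv zeta_fun z) (at z)"
          by (intro holomorphic_derivI[OF zeta_fun_holomorphic] open_Diff open_halfspace_Re_gt) auto
        thus "(zeta_fun has_field_derivative deriv zeta_fun z) (at z within closed_segment s s1)"
          by (rule has_field_derivative_at_within)
        have "1 - 1 / (4 * ln (\<bar>Im z\<bar> + 3)) \<le> 1" using ln_abs_add_3[of "Im z"] by simp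
        hence "1 - 1 / (4 * ln (\<bar>Im z\<bar> + 3)) \<le> Re z" using z by linarith
        thus "norm (deriv zeta_fun z) \<le> C * L ^ 2" using ub[of z] z s by (simp add: L_def)
      qed auto
      also have "cmod (s1 - s) \<le> \<eta>"
      proof -
        have "s1 - s = of_real (1 + \<eta> - Re s)" by (simp add: s1_def complex_eq_iff)
        thus ?thesis using False s by (simp only: norm_of_real)
      qed
      also have "C * L ^ 2 * \<eta> = (C * d) * (d ^ 3 / L ^ 7)"
        using L by (simp add: \<eta>_def field_simps) (simp add: power_numeral_reduce)
      also have "\<dots> \<le> q / 2 * (d ^ 3 / L ^ 7)" using d L by (intro mult_right_mono) auto
      also have "q / 2 * (d ^ 3 / L ^ 7) = (q * d ^ 3 / L ^ 7) / 2" by simp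
      finally have "cmod (zeta_fun s1 - zeta_fun s) \<le> (q * d ^ 3 / L ^ 7) / 2" using C L by simp
      moreover have "x / 2 \<le> b" if "x \<le> a" "a - b \<le> n" "n \<le> x / 2" for x a b n :: real using that by simp
      ultimately show ?thesis
        using l1 norm_triangle_ineq2[of "zeta_fun s1" "zeta_fun s"] by blast
    qed
    thus "q * d ^ 3 / 2 / ln (\<bar>Im s\<bar> + 3) ^ 7 \<le> cmod (zeta_fun s)" by (simp add: L_def)
  qed (use q d in auto)
qed

lemma zeta_fun_nonzero:
  assumes "Re s \<ge> 1" "s \<noteq> 1"
  shows "zeta_fun s \<noteq> 0"
proof (cases "Re s > 1")
  case False
  with assms have im: "\<bar>Im s\<bar> > 0" by (auto simp: complex_eq_iff)
  then obtain c where c: "c > 0" "\<And>z. \<bar>Im z\<bar> \<ge> \<bar>Im s\<bar> \<Longrightarrow> 1 \<le> Re z \<Longrightarrow> Re z \<le> 2 \<Longrightarrow> c / ln (\<bar>Im z\<bar> + 3) ^ 7 \<le> cmod (zeta_fun z)"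
    using zeta_fun_lower_bound[of "\<bar>Im s\<bar>"] by metis
  have "c / ln (\<bar>Im s\<bar> + 3) ^ 7 \<le> cmod (zeta_fun s)" using c(2)[of s] assms False by simp
  moreover have "c / ln (\<bar>Im s\<bar> + 3) ^ 7 > 0" using c ln_abs_add_3[of "Im s"] by simp
  ultimately show ?thesis by auto
qed (rule zeta_fun_nonzero_Re_gt_1)

lemma zeta_reg_nonzero: "Re s \<ge> 1 \<Longrightarrow> zeta_reg s \<noteq> 0"
  using zeta_fun_nonzero[of s] by (cases "s = 1") (auto simp: zeta_fun_def)

section \<open>The logarithmic derivative with its pole removed\<close>

text \<open>This is \<open>- \<zeta>'/\<zeta> - \<zeta>\<close>, in which the poles at 1 cancel.\<close>

definition error_fun :: "complex \<Rightarrow> complex" where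
  "error_fun s = - (deriv zeta_reg s / zeta_reg s) - (if s = 1 then deriv zeta_reg 1 else (zeta_reg s - zeta_reg 1) / (s - 1))"

lemma open_zeta_reg_nonzero: "open {s. Re s > 0 \<and> zeta_reg s \<noteq> 0}"
proof -
  have "open ({s. Re s > 0} \<inter> zeta_reg -` (- {0}))"
    by (intro continuous_open_preimage holomorphic_on_imp_continuous_on zeta_reg_holomorphic open_halfspace_Re_gt) auto
  also have "{s. Re s > 0} \<inter> zeta_reg -` (- {0}) = {s. Re s > 0 \<and> zeta_reg s \<noteq> 0}" by auto
  finally show ?thesis .
qed

lemma error_fun_holomorphic: "error_fun holomorphic_on {s. Re s > 0 \<and> zeta_reg s \<noteq> 0}"
proof -
  have h: "zeta_reg holomorphic_on {s. Re s > 0 \<and> zeta_reg s \<noteq> 0}"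
    using zeta_reg_holomorphic by (rule holomorphic_on_subset) auto
  have "(\<lambda>s. if s = 1 then deriv zeta_reg 1 else (zeta_reg s - zeta_reg 1) / (s - 1)) holomorphic_on {s. Re s > 0 \<and> zeta_reg s \<noteq> 0}"
    by (rule pole_lemma_open[OF h open_zeta_reg_nonzero])
  thus ?thesis unfolding error_fun_def
    by (intro holomorphic_on_diff holomorphic_on_minus holomorphic_on_divide holomorphic_deriv h open_zeta_reg_nonzero) auto
qed

lemma error_fun_eq:
  assumes "Re s > 0" "s \<noteq> 1" "zeta_reg s \<noteq> 0"
  shows "error_fun s = - (deriv zeta_fun s / zeta_fun s) - zeta_fun s"
proof -
  have o: "open ({s. Re s > 0} - {1 :: complex})" by (intro open_Diff open_halfspace_Re_gt) auto
  have s: "s \<in> {s. Re s > 0} - {1}" using assms by auto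
  have d: "(zeta_fun has_field_derivative deriv zeta_fun s) (at s)"
    by (rule holomorphic_derivI[OF zeta_fun_holomorphic o s])
  have "((\<lambda>s. (s - 1) * zeta_fun s) has_field_derivative ((1 - 0) * zeta_fun s + deriv zeta_fun s * (s - 1))) (at s)"
    by (intro DERIV_mult DERIV_diff DERIV_ident DERIV_const d)
  hence "(zeta_reg has_field_derivative ((1 - 0) * zeta_fun s + deriv zeta_fun s * (s - 1))) (at s)"
    by (rule has_field_derivative_transform_within_open[OF _ o s]) (auto simp: zeta_fun_def)
  hence e: "deriv zeta_reg s = zeta_fun s + deriv zeta_fun s * (s - 1)" by (auto dest: DERIV_imp_deriv)
  have z: "zeta_reg s = (s - 1) * zeta_fun s" using assms by (simp add: zeta_fun_def)
  have "zeta_fun s \<noteq> 0" using assms z by auto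
  moreover have "- ((x + d * w) / (w * x)) - (w * x - 1) / w = - (d / x) - x" if "w \<noteq> 0" "x \<noteq> 0" for x d w :: complex
    using that by (simp add: field_simps)
  ultimately show ?thesis using assms(2) unfolding error_fun_def e z by simp
qed

lemma error_fun_dirichlet:
  assumes "Re s > 1"
  shows "error_fun s = dirichlet (\<lambda>n. mangoldt n - 1) s"
proof -
  have z: "zeta_fun s \<noteq> 0" using assms by (rule zeta_fun_nonzero_Re_gt_1)
  have "error_fun s = - (deriv zeta_fun s / zeta_fun s) - zeta_fun s"
    using assms by (intro error_fun_eq zeta_reg_nonzero) auto
  also have "deriv zeta_fun s = - (dirichlet mangoldt s * zeta_fun s)"
    using DERIV_imp_deriv[OF zeta_fun_DERIV[OF assms]] by (simp add: dirichlet_mangoldt_mult_zeta[OF assms])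
  also have "- (- (dirichlet mangoldt s * zeta_fun s) / zeta_fun s) - zeta_fun s = dirichlet mangoldt s - dirichlet (\<lambda>n. 1) s"
    using z dirichlet_one[OF assms] by simp
  also have "\<dots> = dirichlet (\<lambda>n. mangoldt n - 1) s"
    by (rule dirichlet_diff[symmetric, OF polylog_bounded_mangoldt polylog_bounded_one assms])
  finally show ?thesis .
qed

text \<open>All powers of ln |t| are traded for one square root: the Perron kernel decays like t^-2,
  so growth of order t^(1/2) still leaves an integrable function.\<close>

lemma ln_power_le_sqrt: "\<exists>C>0. \<forall>y\<ge>1. ln y ^ j \<le> C * sqrt y"
proof (cases "j = 0")
  case True
  thus ?thesis by (intro exI[of _ 1]) auto
next
  case False
  show ?thesis
  proof (intro exI[of _ "(2 * real j) ^ j"] conjI allI impI)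
    fix y :: real assume y: "y \<ge> 1"
    have "ln y \<le> y powr (1 / (2 * real j)) / (1 / (2 * real j))"
      using y False by (intro ln_powr_bound) auto
    hence "ln y ^ j \<le> (2 * real j * y powr (1 / (2 * real j))) ^ j"
      using y by (intro power_mono) (auto simp: mult_ac)
    also have "\<dots> = (2 * real j) ^ j * (y powr (1 / (2 * real j))) ^ j" by (rule power_mult_distrib)
    also have "(y powr (1 / (2 * real j))) ^ j = y powr (1 / 2)"
      using y False by (simp add: powr_powr flip: powr_realpow)
    also have "\<dots> = sqrt y" using y by (simp add: powr_half_sqrt)
    finally show "ln y ^ j \<le> (2 * real j) ^ j * sqrt y" .
  qed (use False in auto)
qed

text \<open>For Re s \<ge> 1 the modulus of zeta is at least of order L^-7. A step of length \<rho>
  / L^9 to the left changes it by order L^2 \<rho> / L^9, so for small \<rho> half of the lower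
  bound survives, and zeta' / zeta is at most of order L^2 L^7. The bound is stated on a full disc
  about s because Cauchy's estimate is applied there.\<close>

lemma error_fun_bound:
  "\<exists>\<rho> C. \<rho> > 0 \<and> C > 0 \<and> (\<forall>s w. \<bar>Im s\<bar> \<ge> 2 \<longrightarrow> 1 \<le> Re s \<longrightarrow> Re s \<le> 3 / 2 \<longrightarrow>
     cmod (w - s) \<le> \<rho> / ln (\<bar>Im s\<bar> + 3) ^ 9 \<longrightarrow>
     Re w > 0 \<and> zeta_reg w \<noteq> 0 \<and> cmod (error_fun w) \<le> C * ln (\<bar>Im s\<bar> + 3) ^ 9)"
proof -
  obtain C where C: "C > 0" and ub: "\<And>s. \<bar>Im s\<bar> \<ge> 1 \<Longrightarrow> Re s \<le> 2 \<Longrightarrow> 1 - 1 / (4 * ln (\<bar>Im s\<bar> + 3)) \<le> Re s \<Longrightarrow>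
     cmod (zeta_fun s) \<le> C * ln (\<bar>Im s\<bar> + 3) \<and> cmod (deriv zeta_fun s) \<le> C * ln (\<bar>Im s\<bar> + 3) ^ 2"
    using zeta_fun_deriv_bound[of 1] by (metis zero_less_one)
  obtain c where c: "c > 0" and lb: "\<And>s. \<bar>Im s\<bar> \<ge> 1 \<Longrightarrow> 1 \<le> Re s \<Longrightarrow> Re s \<le> 2 \<Longrightarrow> c / ln (\<bar>Im s\<bar> + 3) ^ 7 \<le> cmod (zeta_fun s)"
    using zeta_fun_lower_bound[of 1] by (metis zero_less_one)
  \<comment> \<open>256 = 2 * 2^7: the logarithm at w is at most 2 L, and half of the lower bound is
    given away. The factor 4 making 1024 is from (2 L)^2.\<close>
  define \<rho> where "\<rho> = min (1 / 8) (c / (1024 * C))"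
  have \<rho>: "\<rho> > 0" "\<rho> \<le> 1 / 8" "4 * C * \<rho> \<le> c / 256" using c C by (auto simp: \<rho>_def min_def field_simps)
  show ?thesis
  proof (rule exI[of _ \<rho>], rule exI[of _ "1024 * C / c + 2 * C"], intro conjI allI impI)
    fix s w assume s: "\<bar>Im s\<bar> \<ge> 2" "1 \<le> Re s" "Re s \<le> 3 / 2" and w: "cmod (w - s) \<le> \<rho> / ln (\<bar>Im s\<bar> + 3) ^ 9"
    define L where "L = ln (\<bar>Im s\<bar> + 3)"
    have L: "L \<ge> 1" using ln_abs_add_3 by (simp add: L_def)
    define r where "r = \<rho> / L ^ 9"
    have "L ^ 1 \<le> L ^ 9" using L by (intro power_increasing) auto
    hence rL: "r \<le> \<rho> / L" using L \<rho> unfolding r_def by (intro divide_left_mono) auto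
    have "\<rho> / L \<le> \<rho>" using L \<rho> by (simp add: field_simps)
    hence r8: "r \<le> 1 / 8" using rL \<rho> by linarith
    have "r > 0" using \<rho> L by (simp add: r_def)
    note r = this r8
    have re: "\<bar>Re w - Re s\<bar> \<le> r" using abs_Re_le_cmod[of "w - s"] w by (simp add: r_def L_def)
    have im: "\<bar>Im w - Im s\<bar> \<le> r" using abs_Im_le_cmod[of "w - s"] w by (simp add: r_def L_def)
    have imw: "\<bar>Im w\<bar> \<ge> 1" using im r s by linarith
    define Lw where "Lw = ln (\<bar>Im w\<bar> + 3)"
    have Lw1: "Lw \<ge> 1" using ln_abs_add_3 by (simp add: Lw_def)
    have im3: "\<bar>Im w\<bar> + 3 \<le> \<bar>Im s\<bar> + 4" using im r by linarith
    have "\<bar>Im s\<bar> + 4 \<le> (\<bar>Im s\<bar> + 3)\<^sup>2" by (simp add: power2_eq_square algebra_simps)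
    hence "ln (\<bar>Im w\<bar> + 3) \<le> ln ((\<bar>Im s\<bar> + 3)\<^sup>2)" using im3 by simp
    hence Lw2: "Lw \<le> 2 * L" by (simp add: ln_realpow L_def Lw_def)
    have "\<rho> / L \<le> 1 / 8 / L" using \<rho> L by (intro divide_right_mono) auto
    also have "\<dots> = 1 / (4 * (2 * L))" by simp
    also have "\<dots> \<le> 1 / (4 * Lw)" using Lw1 Lw2 by (intro divide_left_mono) auto
    finally have rLw: "r \<le> 1 / (4 * Lw)" using rL by linarith
    have ubw: "cmod (zeta_fun z) \<le> C * Lw \<and> cmod (deriv zeta_fun z) \<le> C * Lw ^ 2"
      if "Im z = Im w" "1 - r \<le> Re z" "Re z \<le> 2" for z
      using ub[of z] that imw rLw by (simp add: Lw_def)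
    have Rw: "1 - r \<le> Re w" "Re w \<le> 2" "Re w > 0" using re r s by linarith+
    have Lp: "Lw ^ 2 \<le> (2 * L) ^ 2" "Lw ^ 7 \<le> (2 * L) ^ 7" using Lw1 Lw2 by (intro power_mono; simp)+
    have l7: "c / (128 * L ^ 7) \<le> c / Lw ^ 7"
      using Lp(2) c Lw1 L by (intro divide_left_mono) (auto simp: power_mult_distrib)
    have low: "c / (256 * L ^ 7) \<le> cmod (zeta_fun w)"
    proof (cases "Re w \<ge> 1")
      case True
      have "c / (256 * L ^ 7) \<le> c / (128 * L ^ 7)" using c L by (intro divide_left_mono) auto
      also have "\<dots> \<le> c / Lw ^ 7" by (rule l7)
      also have "\<dots> \<le> cmod (zeta_fun w)" unfolding Lw_def by (intro lb imw True Rw)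
      finally show ?thesis .
    next
      case False
      define w1 where "w1 = Complex 1 (Im w)"
      have "c / Lw ^ 7 \<le> cmod (zeta_fun w1)" using lb[of w1] imw by (simp add: w1_def Lw_def)
      hence l1: "c / (128 * L ^ 7) \<le> cmod (zeta_fun w1)" using l7 by linarith
      have "cmod (zeta_fun w1 - zeta_fun w) \<le> C * Lw ^ 2 * cmod (w1 - w)"
      proof (rule field_differentiable_bound[where S = "closed_segment w w1" and f' = "deriv zeta_fun"])
        fix z assume "z \<in> closed_segment w w1"
        then obtain u where u: "0 \<le> u" "u \<le> 1" "z = (1 - u) *\<^sub>R w + u *\<^sub>R w1"
          by (auto simp: closed_segment_def)
        have "Im z = (1 - u) * Im w + u * Im w" using u by (simp add: w1_def)
        hence zi: "Im z = Im w" by (simp add: algebra_simps)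
        have zr: "Re z = (1 - u) * Re w + u * 1" using u by (simp add: w1_def)
        have "(1 - u) * Re w + u * Re w \<le> (1 - u) * Re w + u * 1"
          using u False by (intro add_mono mult_left_mono) auto
        hence z1: "Re w \<le> Re z" using zr by (simp add: algebra_simps)
        have "(1 - u) * Re w + u * 1 \<le> (1 - u) * 1 + u * 1"
          using u False by (intro add_mono mult_left_mono) auto
        hence z2: "Re z \<le> 1" using zr by simp
        have "z \<noteq> 1" using zi imw by auto
        hence "z \<in> {s. Re s > 0} - {1}" using z1 Rw by auto
        hence "(zeta_fun has_field_derivative deriv zeta_fun z) (at z)"
          by (intro holomorphic_derivI[OF zeta_fun_holomorphic] open_Diff open_halfspace_Re_gt) auto
        thus "(zeta_fun has_field_derivative deriv zeta_fun z) (at z within closed_segment w w1)"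
          by (rule has_field_derivative_at_within)
        show "norm (deriv zeta_fun z) \<le> C * Lw ^ 2" using ubw[of z] zi z1 z2 Rw by simp
      qed auto
      also have "\<dots> \<le> C * (2 * L) ^ 2 * r"
      proof -
        have "w1 - w = of_real (1 - Re w)" by (simp add: w1_def complex_eq_iff)
        hence "cmod (w1 - w) \<le> r" using False Rw by (simp only: norm_of_real)
        thus ?thesis using Lp C by (intro mult_mono) auto
      qed
      also have "\<dots> = (4 * C * \<rho>) / L ^ 7"
        using L by (simp add: r_def field_simps)
      also have "\<dots> \<le> (c / 256) / L ^ 7" using \<rho> L by (intro divide_right_mono) auto
      finally have "cmod (zeta_fun w1 - zeta_fun w) \<le> c / (256 * L ^ 7)" by simp
      moreover have "c / (128 * L ^ 7) = c / (256 * L ^ 7) + c / (256 * L ^ 7)" by simp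
      ultimately show ?thesis
        using l1 norm_triangle_ineq2[of "zeta_fun w1" "zeta_fun w"] by linarith
    qed
    have lpos: "c / (256 * L ^ 7) > 0" using c L by simp
    show "Re w > 0" by fact
    have zf: "zeta_fun w \<noteq> 0" using low lpos by auto
    thus zr: "zeta_reg w \<noteq> 0" by (auto simp: zeta_fun_def)
    have w1: "w \<noteq> 1" using imw by auto
    have u: "cmod (zeta_fun w) \<le> C * (2 * L)" "cmod (deriv zeta_fun w) \<le> C * (2 * L) ^ 2"
    proof -
      have "cmod (zeta_fun w) \<le> C * Lw" "cmod (deriv zeta_fun w) \<le> C * Lw ^ 2" using ubw[of w] Rw by auto
      moreover have "C * Lw \<le> C * (2 * L)" "C * Lw ^ 2 \<le> C * (2 * L) ^ 2"
        using Lw2 Lp C by (auto intro!: mult_left_mono)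
      ultimately show "cmod (zeta_fun w) \<le> C * (2 * L)" "cmod (deriv zeta_fun w) \<le> C * (2 * L) ^ 2"
        by (blast intro: order.trans)+
    qed
    have "cmod (error_fun w) \<le> cmod (deriv zeta_fun w) / cmod (zeta_fun w) + cmod (zeta_fun w)"
      unfolding error_fun_eq[OF Rw(3) w1 zr] using norm_triangle_ineq4[of "- (deriv zeta_fun w / zeta_fun w)" "zeta_fun w"]
      by (simp add: norm_divide)
    also have "\<dots> \<le> C * (2 * L) ^ 2 / (c / (256 * L ^ 7)) + C * (2 * L)"
      using u low lpos C by (intro add_mono frac_le) auto
    also have "C * (2 * L) ^ 2 / (c / (256 * L ^ 7)) = 1024 * C / c * L ^ 9"
      using c L by (simp add: field_simps)
    also have "C * (2 * L) \<le> 2 * C * L ^ 9" using \<open>L ^ 1 \<le> L ^ 9\<close> C by simp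
    also have "1024 * C / c * L ^ 9 + 2 * C * L ^ 9 = (1024 * C / c + 2 * C) * L ^ 9" by (simp add: distrib_right)
    finally show "cmod (error_fun w) \<le> (1024 * C / c + 2 * C) * ln (\<bar>Im s\<bar> + 3) ^ 9" by (simp add: L_def)
  qed (use \<rho> C c in \<open>auto intro!: add_pos_pos\<close>)
qed

text \<open>Cauchy's estimate on a disc of radius \<rho> / L^9 bounds the k-th derivative by order
  L^(9 + 9 k). For |Im s| \<le> 2 compactness suffices, as the function is holomorphic at 1 and
  \<open>zeta_reg\<close> has no zero with Re s \<ge> 1.\<close>

lemma error_fun_higher_deriv_bound:
  "\<exists>C>0. \<forall>s. 1 \<le> Re s \<longrightarrow> Re s \<le> 3 / 2 \<longrightarrow> cmod ((deriv ^^ k) error_fun s) \<le> C * sqrt (\<bar>Im s\<bar> + 3)"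
proof -
  let ?U = "{s. Re s > 0 \<and> zeta_reg s \<noteq> 0}"
  obtain \<rho> B where \<rho>: "\<rho> > 0" "B > 0" and bd: "\<And>s w. \<bar>Im s\<bar> \<ge> 2 \<Longrightarrow> 1 \<le> Re s \<Longrightarrow> Re s \<le> 3 / 2 \<Longrightarrow>
     cmod (w - s) \<le> \<rho> / ln (\<bar>Im s\<bar> + 3) ^ 9 \<Longrightarrow>
     Re w > 0 \<and> zeta_reg w \<noteq> 0 \<and> cmod (error_fun w) \<le> B * ln (\<bar>Im s\<bar> + 3) ^ 9"
    using error_fun_bound by metis
  obtain E where E: "E > 0" "\<And>y. y \<ge> 1 \<Longrightarrow> ln y ^ (9 + 9 * k) \<le> E * sqrt y"
    using ln_power_le_sqrt[of "9 + 9 * k"] by metis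
  let ?K = "cbox (Complex 1 (- 2)) (Complex (3 / 2) 2)"
  have "(deriv ^^ k) error_fun holomorphic_on ?U"
    by (intro holomorphic_higher_deriv error_fun_holomorphic open_zeta_reg_nonzero)
  moreover have "?K \<subseteq> ?U" using zeta_reg_nonzero by (auto simp: in_cbox_complex_iff)
  ultimately have "continuous_on ?K ((deriv ^^ k) error_fun)"
    by (meson holomorphic_on_imp_continuous_on continuous_on_subset)
  hence "bounded ((deriv ^^ k) error_fun ` ?K)"
    by (intro compact_imp_bounded compact_continuous_image compact_cbox)
  then obtain D where D: "\<And>s. s \<in> ?K \<Longrightarrow> cmod ((deriv ^^ k) error_fun s) \<le> D"
    unfolding bounded_iff by blast
  define C where "C = fact k * B / \<rho> ^ k * E"
  have C: "C > 0" using \<rho> E by (simp add: C_def)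
  show ?thesis
  proof (intro exI[of _ "C + \<bar>D\<bar>"] conjI allI impI)
    fix s :: complex assume s: "1 \<le> Re s" "Re s \<le> 3 / 2"
    have sq: "sqrt (\<bar>Im s\<bar> + 3) \<ge> 1" by simp
    show "cmod ((deriv ^^ k) error_fun s) \<le> (C + \<bar>D\<bar>) * sqrt (\<bar>Im s\<bar> + 3)"
    proof (cases "\<bar>Im s\<bar> \<le> 2")
      case True
      have "cmod ((deriv ^^ k) error_fun s) \<le> D" using s True by (intro D) (auto simp: in_cbox_complex_iff)
      also have "\<dots> \<le> (C + \<bar>D\<bar>) * 1" using C by simp
      also have "\<dots> \<le> (C + \<bar>D\<bar>) * sqrt (\<bar>Im s\<bar> + 3)" using sq C by (intro mult_left_mono) auto
      finally show ?thesis .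
    next
      case False
      define L where "L = ln (\<bar>Im s\<bar> + 3)"
      have L: "L \<ge> 1" using ln_abs_add_3 by (simp add: L_def)
      define r where "r = \<rho> / L ^ 9"
      have r: "r > 0" using \<rho> L by (simp add: r_def)
      have w: "Re w > 0 \<and> zeta_reg w \<noteq> 0 \<and> cmod (error_fun w) \<le> B * L ^ 9" if "cmod (w - s) \<le> r" for w
        using bd[of s w] that False s by (simp add: L_def r_def)
      have "cball s r \<subseteq> ?U" using w by (auto simp: dist_norm norm_minus_commute)
      hence hol: "error_fun holomorphic_on cball s r" by (rule holomorphic_on_subset[OF error_fun_holomorphic])
      have "cmod ((deriv ^^ k) error_fun s) \<le> fact k * (B * L ^ 9) / r ^ k"
      proof (rule Cauchy_inequality)
        show "error_fun holomorphic_on ball s r" using hol by (rule holomorphic_on_subset) auto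
        show "continuous_on (cball s r) error_fun" using hol by (rule holomorphic_on_imp_continuous_on)
        show "cmod (error_fun x) \<le> B * L ^ 9" if "cmod (s - x) = r" for x
          using w[of x] that by (simp add: norm_minus_commute)
      qed fact
      also have "\<dots> = fact k * B / \<rho> ^ k * L ^ (9 + 9 * k)"
        using \<rho> L by (simp add: r_def power_divide power_add power_mult)
      also have "\<dots> \<le> fact k * B / \<rho> ^ k * (E * sqrt (\<bar>Im s\<bar> + 3))"
        unfolding L_def using \<rho> by (intro mult_left_mono E) auto
      also have "\<dots> = C * sqrt (\<bar>Im s\<bar> + 3)" by (simp add: C_def)
      also have "\<dots> \<le> (C + \<bar>D\<bar>) * sqrt (\<bar>Im s\<bar> + 3)" by (intro mult_right_mono) auto
      finally show ?thesis .
    qed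
  qed (use C in auto)
qed

text \<open>Differentiating k times multiplies the coefficients by (- ln n)^k. The point is
  uniformity: the constant does not deteriorate as Re s tends to 1, although absolute convergence is
  lost there.\<close>

lemma dirichlet_error_bound:
  "\<exists>C>0. \<forall>s. 1 < Re s \<longrightarrow> Re s \<le> 3 / 2 \<longrightarrow>
     cmod (dirichlet (\<lambda>n. (mangoldt n - 1) * ln (real n) ^ k) s) \<le> C * sqrt (\<bar>Im s\<bar> + 3)"
proof -
  have eq: "cmod (dirichlet (\<lambda>n. (mangoldt n - 1) * ln (real n) ^ k) s) = cmod ((deriv ^^ k) error_fun s)"
    if s: "Re s > 1" for s
  proof -
    have "\<forall>\<^sub>F z in nhds s. z \<in> {s. Re s > 1}"
      using s by (intro eventually_nhds_in_open open_halfspace_Re_gt) auto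
    hence "\<forall>\<^sub>F z in nhds s. error_fun z = dirichlet (\<lambda>n. mangoldt n - 1) z"
      by eventually_elim (auto intro: error_fun_dirichlet)
    hence "(deriv ^^ k) error_fun s = (deriv ^^ k) (dirichlet (\<lambda>n. mangoldt n - 1)) s"
      by (rule higher_deriv_cong_ev) auto
    also have "\<dots> = (- 1) ^ k * dirichlet (\<lambda>n. (mangoldt n - 1) * ln (real n) ^ k) s"
      by (intro higher_deriv_dirichlet polylog_bounded_diff polylog_bounded_mangoldt polylog_bounded_one s)
    finally show ?thesis by (simp add: norm_mult norm_power)
  qed
  show ?thesis using error_fun_higher_deriv_bound[of k] eq by (metis order_less_imp_le)
qed

section \<open>Perron's formula and the prime number theorem\<close>

lemma contour_integral_join_linepaths4:
  assumes "(f has_contour_integral I) (rectpath a1 a3)"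
    and cont: "continuous_on (path_image (rectpath a1 a3)) f"
  shows "I = contour_integral (linepath a1 (Complex (Re a3) (Im a1))) f + 
    (contour_integral (linepath (Complex (Re a3) (Im a1)) a3) f +
    (contour_integral (linepath a3 (Complex (Re a1) (Im a3))) f +
     contour_integral (linepath (Complex (Re a1) (Im a3)) a1) f))"
proof -
  let ?a2 = "Complex (Re a3) (Im a1)" and ?a4 = "Complex (Re a1) (Im a3)"
  have pi: "path_image (rectpath a1 a3) = closed_segment a1 ?a2 \<union> closed_segment ?a2 a3 \<union> closed_segment a3 ?a4 \<union> closed_segment ?a4 a1"
    by (simp add: rectpath_def Let_def path_image_join Un_assoc)
  have int: "f contour_integrable_on linepath a b" if "closed_segment a b \<subseteq> path_image (rectpath a1 a3)" for a b
    using cont that by (intro contour_integrable_continuous_linepath) (auto intro: continuous_on_subset)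
  note hs = has_contour_integral_integral[OF int]
  have "(f has_contour_integral (contour_integral (linepath a1 ?a2) f + (contour_integral (linepath ?a2 a3) f +
    (contour_integral (linepath a3 ?a4) f + contour_integral (linepath ?a4 a1) f)))) (rectpath a1 a3)"
    unfolding rectpath_def Let_def
    by (intro has_contour_integral_join hs valid_path_join) (auto simp: pi)
  with assms(1) show ?thesis by (rule has_contour_integral_unique)
qed

text \<open>The factor s + 1 added to the classical y^s / s makes the vertical integral absolutely
  convergent; the price is the weight \<open>max 0 (1 - 1 / y)\<close> in place of a sharp
  cutoff.\<close>

definition perron_kernel :: "real \<Rightarrow> complex \<Rightarrow> complex" where
  "perron_kernel y s = cpow y s / (s * (s + 1))"

lemma continuous_on_perron_kernel: "0 \<notin> S \<Longrightarrow> - 1 \<notin> S \<Longrightarrow> continuous_on S (perron_kernel y)"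
  unfolding perron_kernel_def cpow_def
  by (intro continuous_intros) (auto simp: add_eq_0_iff2)

lemma perron_kernel_side_bound:
  assumes "y > 0" "T > 1" "a \<in> S" "b \<in> S" "convex S"
    and S: "\<And>s. s \<in> S \<Longrightarrow> T \<le> cmod s \<and> y powr Re s \<le> M" and "0 \<le> M" and len: "cmod (b - a) \<le> 2 * T"
  shows "cmod (contour_integral (linepath a b) (perron_kernel y)) \<le> 2 * M / (T - 1)"
proof -
  have sub: "closed_segment a b \<subseteq> S" using assms by (intro closed_segment_subset)
  have s1: "T - 1 \<le> cmod (s + 1)" if "s \<in> S" for s
    using S[OF that] norm_triangle_ineq2[of s "- 1"] by simp
  have "perron_kernel y contour_integrable_on linepath a b"
  proof (intro contour_integrable_continuous_linepath continuous_on_perron_kernel)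
    show "0 \<notin> closed_segment a b" using sub S[of 0] assms(2) by auto
    show "- 1 \<notin> closed_segment a b" using sub s1[of "-1"] assms(2) by auto
  qed
  hence "cmod (contour_integral (linepath a b) (perron_kernel y)) \<le> M / (T * (T - 1)) * cmod (b - a)"
  proof (rule contour_integral_bound_linepath)
    show "0 \<le> M / (T * (T - 1))" using assms by simp
    fix s assume "s \<in> closed_segment a b"
    hence s: "s \<in> S" using sub by auto
    show "cmod (perron_kernel y s) \<le> M / (T * (T - 1))"
      unfolding perron_kernel_def norm_divide norm_mult norm_cpow[OF assms(1)]
      using S[OF s] s1[OF s] assms by (intro frac_le mult_mono) auto
  qed
  also have "\<dots> \<le> M / (T * (T - 1)) * (2 * T)" using assms by (intro mult_left_mono) auto
  also have "\<dots> = 2 * M / (T - 1)" using assms by simp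
  finally show ?thesis .
qed

text \<open>The contour is closed to the left when y \<ge> 1, enclosing the poles at 0 and -1, and
  to the right when y < 1, where there is none. In either case y^(Re s) \<le> y^\<sigma> on the
  three new sides, each of which contributes at most 2 y^\<sigma> / (T - 1).\<close>

lemma perron_kernel_integral:
  assumes "y > 0" "0 < \<sigma>" "\<sigma> \<le> 2" "T > 2"
  shows "cmod (contour_integral (linepath (Complex \<sigma> (- T)) (Complex \<sigma> T)) (perron_kernel y) - 
     2 * pi * \<i> * of_real (max 0 (1 - 1 / y))) \<le> 6 * y powr \<sigma> / (T - 1)"
proof (cases "y \<ge> 1")
  case True
  define a1 a3 where "a1 = Complex (- T) (- T)" and "a3 = Complex \<sigma> T"
  have box: "0 \<in> box a1 a3" "- 1 \<in> box a1 a3"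
    using assms by (auto simp: a1_def a3_def in_box_complex_iff)
  have le: "Re a1 \<le> Re a3" "Im a1 \<le> Im a3" using assms by (auto simp: a1_def a3_def)
  have pi: "path_image (rectpath a1 a3) = cbox a1 a3 - box a1 a3"
    by (rule path_image_rectpath_cbox_minus_box) fact+
  have hol: "cpow y holomorphic_on UNIV" by (intro holomorphic_cpow holomorphic_intros)
  have cauchy: "((\<lambda>w. cpow y w / (w - z)) has_contour_integral (2 * pi * \<i> * cpow y z)) (rectpath a1 a3)"
    if "z \<in> box a1 a3" for z
  proof -
    have "((\<lambda>w. cpow y w / (w - z)) has_contour_integral (2 * pi * \<i> * winding_number (rectpath a1 a3) z * cpow y z)) (rectpath a1 a3)"
      by (rule Cauchy_integral_formula_convex_simple[OF convex_UNIV hol]) (use that pi in auto)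
    thus ?thesis using winding_number_rectpath[OF that] by simp
  qed
  \<comment> \<open>Partial fractions 1 / (s (s + 1)) = 1 / s - 1 / (s + 1) reduce the residues to
    Cauchy's formula for \<open>cpow y\<close>, with values 1 at 0 and 1 / y at -1.\<close>
  have "((\<lambda>w. cpow y w / (w - 0) - cpow y w / (w - (- 1))) has_contour_integral (2 * pi * \<i> * cpow y 0 - 2 * pi * \<i> * cpow y (- 1))) (rectpath a1 a3)"
    by (intro has_contour_integral_diff cauchy box)
  hence "(perron_kernel y has_contour_integral (2 * pi * \<i> * cpow y 0 - 2 * pi * \<i> * cpow y (- 1))) (rectpath a1 a3)"
  proof (rule has_contour_integral_eq)
    fix x assume "x \<in> path_image (rectpath a1 a3)"
    hence "x \<noteq> 0" "x \<noteq> - 1" using box pi by auto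
    hence "x + 1 \<noteq> 0" by (simp add: add_eq_0_iff2)
    with \<open>x \<noteq> 0\<close> show "cpow y x / (x - 0) - cpow y x / (x - (- 1)) = perron_kernel y x"
      by (simp add: perron_kernel_def field_simps)
  qed
  moreover have "cpow y 0 = 1" "cpow y (- 1) = of_real (1 / y)"
    using assms by (simp_all add: cpow_def exp_minus exp_of_real inverse_eq_divide)
  ultimately have "(perron_kernel y has_contour_integral (2 * pi * \<i> * of_real (max 0 (1 - 1 / y)))) (rectpath a1 a3)"
    using True by (simp add: algebra_simps max_def)
  hence eq: "2 * pi * \<i> * of_real (max 0 (1 - 1 / y)) = 
     contour_integral (linepath a1 (Complex (Re a3) (Im a1))) (perron_kernel y) + 
    (contour_integral (linepath (Complex (Re a3) (Im a1)) a3) (perron_kernel y) +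
    (contour_integral (linepath a3 (Complex (Re a1) (Im a3))) (perron_kernel y) +
     contour_integral (linepath (Complex (Re a1) (Im a3)) a1) (perron_kernel y)))"
    by (rule contour_integral_join_linepaths4) (intro continuous_on_perron_kernel; use pi box in auto)
  have M: "y powr Re s \<le> y powr \<sigma>" if "Re s \<le> \<sigma>" for s using True that by (intro powr_mono) auto
  have nIm: "T \<le> cmod s" if "T \<le> \<bar>Im s\<bar>" for s using abs_Im_le_cmod[of s] that by linarith
  have nRe: "T \<le> cmod s" if "T \<le> \<bar>Re s\<bar>" for s using abs_Re_le_cmod[of s] that by linarith
  have len: "cmod (Complex (\<sigma> - - T) 0) \<le> 2 * T" "cmod (Complex (- T - \<sigma>) 0) \<le> 2 * T" "cmod (Complex 0 (- T - T)) \<le> 2 * T"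
    using assms cmod_le[of "Complex (\<sigma> - - T) 0"] cmod_le[of "Complex (- T - \<sigma>) 0"] cmod_le[of "Complex 0 (- T - T)"]
    by auto
  have b1: "cmod (contour_integral (linepath a1 (Complex (Re a3) (Im a1))) (perron_kernel y)) \<le> 2 * y powr \<sigma> / (T - 1)"
    by (rule perron_kernel_side_bound[where S = "{s. Re s \<le> \<sigma>} \<inter> {s. Im s \<le> - T}"])
       (use assms M nIm len in \<open>auto simp: a1_def a3_def complex_diff intro!: convex_Int convex_halfspace_Re_le convex_halfspace_Im_le\<close>)
  have b2: "cmod (contour_integral (linepath a3 (Complex (Re a1) (Im a3))) (perron_kernel y)) \<le> 2 * y powr \<sigma> / (T - 1)"
    by (rule perron_kernel_side_bound[where S = "{s. Re s \<le> \<sigma>} \<inter> {s. Im s \<ge> T}"])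
       (use assms M nIm len in \<open>auto simp: a1_def a3_def complex_diff intro!: convex_Int convex_halfspace_Re_le convex_halfspace_Im_ge\<close>)
  have b3: "cmod (contour_integral (linepath (Complex (Re a1) (Im a3)) a1) (perron_kernel y)) \<le> 2 * y powr \<sigma> / (T - 1)"
    by (rule perron_kernel_side_bound[where S = "{s. Re s \<le> - T}"])
       (use assms M nRe len in \<open>auto simp: a1_def a3_def complex_diff intro!: convex_halfspace_Re_le\<close>)
  have "contour_integral (linepath (Complex \<sigma> (- T)) (Complex \<sigma> T)) (perron_kernel y) - 2 * pi * \<i> * of_real (max 0 (1 - 1 / y))
     = - (contour_integral (linepath a1 (Complex (Re a3) (Im a1))) (perron_kernel y) +
        contour_integral (linepath a3 (Complex (Re a1) (Im a3))) (perron_kernel y) + 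
        contour_integral (linepath (Complex (Re a1) (Im a3)) a1) (perron_kernel y))"
    unfolding eq by (simp add: a1_def a3_def)
  also have "cmod \<dots> \<le> 2 * y powr \<sigma> / (T - 1) + 2 * y powr \<sigma> / (T - 1) + 2 * y powr \<sigma> / (T - 1)"
    unfolding norm_minus_cancel by (intro norm_triangle_le add_mono b1 b2 b3)
  also have "\<dots> = 6 * y powr \<sigma> / (T - 1)" by (simp add: add_divide_distrib[symmetric])
  finally show ?thesis .
next
  case False
  define a1 a3 where "a1 = Complex \<sigma> (- T)" and "a3 = Complex (\<sigma> + T) T"
  have cb: "cbox a1 a3 = {s. \<sigma> \<le> Re s \<and> Re s \<le> \<sigma> + T \<and> - T \<le> Im s \<and> Im s \<le> T}"
    by (auto simp: a1_def a3_def in_cbox_complex_iff)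
  have le: "Re a1 \<le> Re a3" "Im a1 \<le> Im a3" using assms by (auto simp: a1_def a3_def)
  have pi: "path_image (rectpath a1 a3) \<subseteq> cbox a1 a3"
    by (rule path_image_rectpath_subset_cbox) fact+
  have pos: "path_image (rectpath a1 a3) \<subseteq> {s. Re s > 0}" using pi cb assms by auto
  have "(perron_kernel y has_contour_integral 0) (rectpath a1 a3)"
  proof (rule Cauchy_theorem_convex_simple[OF _ convex_halfspace_Re_gt[of 0]])
    show "perron_kernel y holomorphic_on {s. 0 < Re s}"
      unfolding perron_kernel_def cpow_def by (intro holomorphic_intros) (auto simp: add_eq_0_iff2)
  qed (use pos in auto)
  hence eq: "0 = 
     contour_integral (linepath a1 (Complex (Re a3) (Im a1))) (perron_kernel y) + 
    (contour_integral (linepath (Complex (Re a3) (Im a1)) a3) (perron_kernel y) +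
    (contour_integral (linepath a3 (Complex (Re a1) (Im a3))) (perron_kernel y) +
     contour_integral (linepath (Complex (Re a1) (Im a3)) a1) (perron_kernel y)))"
    by (rule contour_integral_join_linepaths4) (intro continuous_on_perron_kernel; use pos in auto)
  have M: "y powr Re s \<le> y powr \<sigma>" if "Re s \<ge> \<sigma>" for s using False assms that by (intro powr_mono') auto
  have nIm: "T \<le> cmod s" if "T \<le> \<bar>Im s\<bar>" for s using abs_Im_le_cmod[of s] that by linarith
  have nRe: "T \<le> cmod s" if "T \<le> \<bar>Re s\<bar>" for s using abs_Re_le_cmod[of s] that by linarith
  have len: "cmod (Complex T 0) \<le> 2 * T" "cmod (Complex (- T) 0) \<le> 2 * T" "cmod (Complex 0 (T - - T)) \<le> 2 * T"
    using assms cmod_le[of "Complex T 0"] cmod_le[of "Complex (- T) 0"] cmod_le[of "Complex 0 (T - - T)"] by auto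
  have b1: "cmod (contour_integral (linepath a1 (Complex (Re a3) (Im a1))) (perron_kernel y)) \<le> 2 * y powr \<sigma> / (T - 1)"
    by (rule perron_kernel_side_bound[where S = "{s. Re s \<ge> \<sigma>} \<inter> {s. Im s \<le> - T}"])
       (use assms M nIm len in \<open>auto simp: a1_def a3_def complex_diff intro!: convex_Int convex_halfspace_Re_ge convex_halfspace_Im_le\<close>)
  have b2: "cmod (contour_integral (linepath a3 (Complex (Re a1) (Im a3))) (perron_kernel y)) \<le> 2 * y powr \<sigma> / (T - 1)"
    by (rule perron_kernel_side_bound[where S = "{s. Re s \<ge> \<sigma>} \<inter> {s. Im s \<ge> T}"])
       (use assms M nIm len in \<open>auto simp: a1_def a3_def complex_diff intro!: convex_Int convex_halfspace_Re_ge convex_halfspace_Im_ge\<close>)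
  have b3: "cmod (contour_integral (linepath (Complex (Re a3) (Im a1)) a3) (perron_kernel y)) \<le> 2 * y powr \<sigma> / (T - 1)"
    by (rule perron_kernel_side_bound[where S = "{s. Re s \<ge> \<sigma> + T}"])
       (use assms M nRe len in \<open>auto simp: a1_def a3_def complex_diff intro!: convex_halfspace_Re_ge\<close>)
  have rev: "contour_integral (linepath (Complex (Re a1) (Im a3)) a1) (perron_kernel y) = 
     - contour_integral (linepath (Complex \<sigma> (- T)) (Complex \<sigma> T)) (perron_kernel y)"
    using contour_integral_reversepath[of "linepath (Complex \<sigma> (- T)) (Complex \<sigma> T)" "perron_kernel y"]
    by (simp add: a1_def a3_def)
  have m: "max 0 (1 - 1 / y) = 0" using False assms by (simp add: max_def field_simps)
  have "contour_integral (linepath (Complex \<sigma> (- T)) (Complex \<sigma> T)) (perron_kernel y) - 2 * pi * \<i> * of_real (max 0 (1 - 1 / y))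
     = contour_integral (linepath a1 (Complex (Re a3) (Im a1))) (perron_kernel y) +
        contour_integral (linepath a3 (Complex (Re a1) (Im a3))) (perron_kernel y) + 
        contour_integral (linepath (Complex (Re a3) (Im a1)) a3) (perron_kernel y)"
    using eq unfolding rev m by (simp add: algebra_simps)
  also have "cmod \<dots> \<le> 2 * y powr \<sigma> / (T - 1) + 2 * y powr \<sigma> / (T - 1) + 2 * y powr \<sigma> / (T - 1)"
    by (intro norm_triangle_le add_mono b1 b2 b3)
  also have "\<dots> = 6 * y powr \<sigma> / (T - 1)" by (simp add: add_divide_distrib[symmetric])
  finally show ?thesis .
qed

text \<open>The exponent is 1 / 2 - 2: growth of the Dirichlet series against decay of the kernel.
  The integral of (1 + |t|)^(-3/2) over the whole line is 4.\<close>

lemma vertical_integral_bound: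
  assumes "T > 0" "K \<ge> 0"
    and cont: "continuous_on (closed_segment (Complex \<sigma> (- T)) (Complex \<sigma> T)) f"
    and bd: "\<And>t. \<bar>t\<bar> \<le> T \<Longrightarrow> cmod (f (Complex \<sigma> t)) \<le> K * (1 + \<bar>t\<bar>) powr (- 3 / 2)"
  shows "cmod (contour_integral (linepath (Complex \<sigma> (- T)) (Complex \<sigma> T)) f) \<le> 4 * K"
proof -
  define g where "g t = K * (1 + \<bar>t\<bar>) powr (- 3 / 2)" for t :: real
  have seg: "Complex \<sigma> t \<in> closed_segment (Complex \<sigma> (- T)) (Complex \<sigma> T)" if "\<bar>t\<bar> \<le> T" for t
    using that assms(1) by (subst closed_segment_same_Re) (auto simp: closed_segment_eq_real_ivl)
  have "continuous_on {- T..T} (\<lambda>t. Complex \<sigma> t)"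
    unfolding Complex_eq by (intro continuous_intros)
  hence "continuous_on {- T..T} (\<lambda>t. f (Complex \<sigma> t))"
    by (intro continuous_on_compose2[OF cont]) (auto intro!: seg)
  hence fint: "(\<lambda>t. f (Complex \<sigma> t)) integrable_on {- T..T}" by (intro integrable_continuous_real)
  have g1: "(g has_integral (- 2 * K * (1 + T) powr (- 1 / 2) - (- 2 * K * (1 + 0) powr (- 1 / 2)))) {0..T}"
  proof (rule fundamental_theorem_of_calculus)
    fix t assume t: "t \<in> {0..T}"
    have "((\<lambda>t. (1 + t) powr (- 1 / 2)) has_real_derivative (- 1 / 2) * (1 + t) powr (- 1 / 2 - of_nat 1) * (0 + 1)) (at t)"
      using t by (intro DERIV_fun_powr DERIV_add DERIV_const DERIV_ident) auto
    hence "((\<lambda>t. - 2 * K * (1 + t) powr (- 1 / 2)) has_real_derivative g t) (at t)"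
      by (rule DERIV_cmult[THEN DERIV_cong]) (use t in \<open>simp add: g_def\<close>)
    thus "((\<lambda>t. - 2 * K * (1 + t) powr (- 1 / 2)) has_vector_derivative g t) (at t within {0..T})"
      by (simp add: has_real_derivative_iff_has_vector_derivative has_vector_derivative_at_within)
  qed (use assms in auto)
  have g2: "(g has_integral (2 * K * (1 - 0) powr (- 1 / 2) - 2 * K * (1 - (- T)) powr (- 1 / 2))) {- T..0}"
  proof (rule fundamental_theorem_of_calculus)
    fix t assume t: "t \<in> {- T..0}"
    have "((\<lambda>t. (1 - t) powr (- 1 / 2)) has_real_derivative (- 1 / 2) * (1 - t) powr (- 1 / 2 - of_nat 1) * (0 - 1)) (at t)"
      using t by (intro DERIV_fun_powr DERIV_diff DERIV_const DERIV_ident) auto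
    hence "((\<lambda>t. 2 * K * (1 - t) powr (- 1 / 2)) has_real_derivative g t) (at t)"
      by (rule DERIV_cmult[THEN DERIV_cong]) (use t in \<open>simp add: g_def\<close>)
    thus "((\<lambda>t. 2 * K * (1 - t) powr (- 1 / 2)) has_vector_derivative g t) (at t within {- T..0})"
      by (simp add: has_real_derivative_iff_has_vector_derivative has_vector_derivative_at_within)
  qed (use assms in auto)
  from has_integral_combine[OF _ _ g2 g1] assms(1)
  have gint: "(g has_integral (4 * K - 4 * K * (1 + T) powr (- 1 / 2))) {- T..T}" by (simp add: mult.assoc)
  have "cmod (contour_integral (linepath (Complex \<sigma> (- T)) (Complex \<sigma> T)) f) = cmod (integral {- T..T} (\<lambda>t. f (Complex \<sigma> t)))"
    using assms(1) by (subst contour_integral_linepath_same_Re[where a = "- T" and b = T and c = \<sigma>]) (auto simp: norm_mult)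
  also have "\<dots> \<le> integral {- T..T} g"
    using fint gint bd by (intro integral_norm_bound_integral) (auto simp: g_def has_integral_integrable)
  also have "\<dots> = 4 * K - 4 * K * (1 + T) powr (- 1 / 2)" using gint by (rule integral_unique)
  also have "\<dots> \<le> 4 * K" using assms by simp
  finally show ?thesis .
qed

lemma cpow_divide: "x > 0 \<Longrightarrow> y > 0 \<Longrightarrow> cpow (x / y) s = cpow x s * cpow y (- s)"
  by (simp add: cpow_def ln_div exp_add[symmetric] algebra_simps)

text \<open>On a finite segment series and integral may be interchanged. Truncation at height T
  costs the n-th term a multiple of n^(-\<sigma>) / (T - 1), and for \<sigma> > 1 these costs have a
  finite sum. They disappear as T tends to infinity, so the result depends on \<sigma> only through
  x^\<sigma> and the bound on the line, and \<sigma> may be moved towards 1 afterwards.\<close>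

lemma perron_sum_bound:
  fixes b :: "nat \<Rightarrow> real" and x :: real
  assumes b: "polylog_bounded b" and \<sigma>: "1 < \<sigma>" "\<sigma> \<le> 2" and "K \<ge> 0" "x > 0"
    and D: "\<And>t. cmod (dirichlet b (Complex \<sigma> t)) \<le> K * sqrt (\<bar>t\<bar> + 3)"
  shows "\<bar>\<Sum>n. b (Suc n) * max 0 (1 - real (Suc n) / x)\<bar> \<le> 32 * K * x powr \<sigma>"
proof -
  define S where "S = (\<Sum>n. b (Suc n) * max 0 (1 - real (Suc n) / x))"
  define M where "M = (\<Sum>n. \<bar>b (Suc n)\<bar> * real (Suc n) powr (- \<sigma>))"
  have Msum: "(\<lambda>n. \<bar>b (Suc n)\<bar> * real (Suc n) powr (- \<sigma>)) sums M"
    unfolding M_def using summable_polylog[OF b \<sigma>(1)] by (rule summable_sums)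
  have Ssum: "(\<lambda>n. b (Suc n) * max 0 (1 - real (Suc n) / x)) sums S"
    unfolding S_def
  proof (intro summable_sums summable_finite[of "{..nat \<lceil>x\<rceil>}"])
    fix n assume "n \<notin> {..nat \<lceil>x\<rceil>}"
    hence "x \<le> real (Suc n)" by simp linarith
    thus "b (Suc n) * max 0 (1 - real (Suc n) / x) = 0" using assms(5) by (simp add: max_def field_simps)
  qed auto
  have main: "2 * pi * \<bar>S\<bar> \<le> 32 * K * x powr \<sigma> + 6 * x powr \<sigma> * M / (T - 1)" if T: "T > 2" for T
  proof -
    let ?g = "linepath (Complex \<sigma> (- T)) (Complex \<sigma> T)"
    have pi: "path_image ?g = {s. Re s = \<sigma> \<and> \<bar>Im s\<bar> \<le> T}"
      using T by (auto simp: closed_segment_same_Re closed_segment_eq_real_ivl)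
    have s1: "(1 + \<bar>Im s\<bar>) / 2 \<le> cmod s" "(1 + \<bar>Im s\<bar>) / 2 \<le> cmod (s + 1)" "1 \<le> cmod s" "1 \<le> cmod (s + 1)" if "Re s = \<sigma>" for s
      using abs_Re_le_cmod[of s] abs_Im_le_cmod[of s] abs_Re_le_cmod[of "s + 1"] abs_Im_le_cmod[of "s + 1"] that \<sigma>
      by auto
    have cker: "continuous_on (path_image ?g) (perron_kernel y)" for y
      unfolding pi using \<sigma> by (intro continuous_on_perron_kernel) auto
    define f where "f n s = of_real (b (Suc n)) * perron_kernel (x / real (Suc n)) s" for n s
    have feq: "f n s = of_real (b (Suc n)) * cpow (real (Suc n)) (- s) * perron_kernel x s" for n s
      unfolding f_def perron_kernel_def using assms(5) by (simp add: cpow_divide)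
    have fint: "f n contour_integrable_on ?g" for n
      unfolding f_def using cker by (intro contour_integrable_continuous_linepath continuous_on_mult continuous_on_const) auto
    have fI: "contour_integral ?g (f n) = of_real (b (Suc n)) * contour_integral ?g (perron_kernel (x / real (Suc n)))" for n
      unfolding f_def using cker by (intro contour_integral_lmul contour_integrable_continuous_linepath) auto
    define A where "A = contour_integral ?g (\<lambda>s. dirichlet b s * perron_kernel x s)"
    have ul: "uniform_limit (path_image ?g) (\<lambda>N s. \<Sum>n<N. f n s) (\<lambda>s. \<Sum>n. f n s) sequentially"
    proof (rule Weierstrass_m_test)
      show "summable (\<lambda>n. \<bar>b (Suc n)\<bar> * real (Suc n) powr (- \<sigma>) * x powr \<sigma>)"
        using Msum by (intro summable_mult2) (rule sums_summable)
      fix n s assume "s \<in> path_image ?g"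
      hence s: "Re s = \<sigma>" unfolding pi by simp
      have "cmod (f n s) = \<bar>b (Suc n)\<bar> * real (Suc n) powr (- \<sigma>) * (x powr \<sigma> / (cmod s * cmod (s + 1)))"
        unfolding feq perron_kernel_def using s assms(5) by (simp add: norm_mult norm_divide norm_cpow)
      also have "\<dots> \<le> \<bar>b (Suc n)\<bar> * real (Suc n) powr (- \<sigma>) * (x powr \<sigma> / 1)"
      proof (intro mult_left_mono divide_left_mono)
        show "1 \<le> cmod s * cmod (s + 1)" using mult_mono[of 1 "cmod s" 1 "cmod (s + 1)"] s1[OF s] by simp
        thus "0 < cmod s * cmod (s + 1) * 1" by linarith
      qed auto
      finally show "cmod (f n s) \<le> \<bar>b (Suc n)\<bar> * real (Suc n) powr (- \<sigma>) * x powr \<sigma>" by simp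
    qed
    have lim: "(\<Sum>n. f n s) = dirichlet b s * perron_kernel x s" if "s \<in> path_image ?g" for s
    proof -
      have "Re s > 1" using that \<sigma> unfolding pi by simp
      from sums_mult2[OF dirichlet_sums[OF b this], of "perron_kernel x s"] show ?thesis
        by (simp add: feq sums_iff)
    qed
    have "(\<lambda>N. contour_integral ?g (\<lambda>s. \<Sum>n<N. f n s)) \<longlonglongrightarrow> contour_integral ?g (\<lambda>s. \<Sum>n. f n s)"
    proof (rule contour_integral_uniform_limit(2)[OF _ ul])
      show "\<forall>\<^sub>F N in sequentially. (\<lambda>s. \<Sum>n<N. f n s) contour_integrable_on ?g"
        by (intro always_eventually allI contour_integrable_sum fint) auto
      show "norm (vector_derivative ?g (at t)) \<le> cmod (Complex \<sigma> T - Complex \<sigma> (- T))" for t by simp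
    qed auto
    also have "contour_integral ?g (\<lambda>s. \<Sum>n. f n s) = A" unfolding A_def by (rule contour_integral_cong) (auto simp: lim)
    also have "(\<lambda>N. contour_integral ?g (\<lambda>s. \<Sum>n<N. f n s)) = (\<lambda>N. \<Sum>n<N. contour_integral ?g (f n))"
      by (intro ext contour_integral_sum fint) auto
    finally have Asum: "(\<lambda>n. contour_integral ?g (f n)) sums A" unfolding sums_def .
    have "(\<lambda>n. 2 * pi * \<i> * of_real (b (Suc n) * max 0 (1 - real (Suc n) / x))) sums (2 * pi * \<i> * of_real S)"
      by (intro sums_mult sums_of_real Ssum)
    from sums_diff[OF Asum this]
    have dsum: "(\<lambda>n. contour_integral ?g (f n) - 2 * pi * \<i> * of_real (b (Suc n) * max 0 (1 - real (Suc n) / x))) sums (A - 2 * pi * \<i> * of_real S)" .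
    have summand_bound: "cmod (contour_integral ?g (f n) - 2 * pi * \<i> * of_real (b (Suc n) * max 0 (1 - real (Suc n) / x))) \<le> 
       \<bar>b (Suc n)\<bar> * real (Suc n) powr (- \<sigma>) * (6 * x powr \<sigma> / (T - 1))" for n
    proof -
      have "contour_integral ?g (f n) - 2 * pi * \<i> * of_real (b (Suc n) * max 0 (1 - real (Suc n) / x)) =
         of_real (b (Suc n)) * (contour_integral ?g (perron_kernel (x / real (Suc n))) - 2 * pi * \<i> * of_real (max 0 (1 - 1 / (x / real (Suc n)))))"
        unfolding fI by (simp add: algebra_simps)
      also have "cmod \<dots> \<le> \<bar>b (Suc n)\<bar> * (6 * (x / real (Suc n)) powr \<sigma> / (T - 1))"
        unfolding norm_mult norm_of_real using \<sigma> T assms(5)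
        by (intro mult_left_mono perron_kernel_integral) auto
      also have "(x / real (Suc n)) powr \<sigma> = x powr \<sigma> * real (Suc n) powr (- \<sigma>)"
        using assms(5) by (simp add: powr_divide powr_minus_divide)
      finally show ?thesis by (simp add: mult_ac)
    qed
    have bsum: "(\<lambda>n. \<bar>b (Suc n)\<bar> * real (Suc n) powr (- \<sigma>) * (6 * x powr \<sigma> / (T - 1))) sums (M * (6 * x powr \<sigma> / (T - 1)))"
      by (intro sums_mult2 Msum)
    have "cmod (A - 2 * pi * \<i> * of_real S) \<le> M * (6 * x powr \<sigma> / (T - 1))"
      using norm_suminf_le[OF summand_bound sums_summable[OF bsum]] dsum bsum by (simp add: sums_iff)
    moreover have "cmod A \<le> 4 * (8 * K * x powr \<sigma>)"
      unfolding A_def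
    proof (rule vertical_integral_bound)
      have "continuous_on {s. Re s > 1} (dirichlet b)"
        using dirichlet_has_derivative[OF b] by (intro continuous_at_imp_continuous_on ballI DERIV_isCont) blast
      hence "continuous_on (path_image ?g) (dirichlet b)"
        unfolding pi by (rule continuous_on_subset) (use \<sigma> in auto)
      thus "continuous_on (closed_segment (Complex \<sigma> (- T)) (Complex \<sigma> T)) (\<lambda>s. dirichlet b s * perron_kernel x s)"
        using cker by (intro continuous_on_mult) auto
      fix t :: real
      define u where "u = 1 + \<bar>t\<bar>"
      have u: "u \<ge> 1" by (simp add: u_def)
      have "sqrt (\<bar>t\<bar> + 3) \<le> sqrt (4 * u)" by (simp add: u_def)
      hence sq: "sqrt (\<bar>t\<bar> + 3) \<le> 2 * sqrt u" by (simp add: real_sqrt_mult)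
      let ?s = "Complex \<sigma> t"
      have "cmod (dirichlet b ?s * perron_kernel x ?s) = cmod (dirichlet b ?s) * (x powr \<sigma> / (cmod ?s * cmod (?s + 1)))"
        unfolding perron_kernel_def using assms(5) by (simp add: norm_mult norm_divide norm_cpow)
      also have "\<dots> \<le> (K * (2 * sqrt u)) * (x powr \<sigma> / ((u / 2) * (u / 2)))"
      proof (intro mult_mono divide_left_mono)
        show "cmod (dirichlet b ?s) \<le> K * (2 * sqrt u)" using D[of t] mult_left_mono[OF sq assms(4)] by linarith
        have "cmod ?s > 0" "cmod (?s + 1) > 0" using s1[of ?s] by auto
        thus "0 < cmod ?s * cmod (?s + 1) * (u / 2 * (u / 2))" using u by (intro mult_pos_pos) auto
        show "u / 2 \<le> cmod ?s" "u / 2 \<le> cmod (?s + 1)" using s1[of ?s] by (simp_all add: u_def)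
      qed (use u assms s1[of ?s] in auto)
      also have "\<dots> = 8 * K * x powr \<sigma> * (sqrt u / u\<^sup>2)"
        using u by (simp add: power2_eq_square)
      also have "sqrt u / u\<^sup>2 = u powr (1 / 2) / u powr 2" using u by (simp add: powr_half_sqrt)
      also have "\<dots> = u powr (- 3 / 2)" by (simp add: powr_diff[symmetric])
      finally show "cmod (dirichlet b ?s * perron_kernel x ?s) \<le> 8 * K * x powr \<sigma> * (1 + \<bar>t\<bar>) powr (- 3 / 2)"
        by (simp add: u_def)
    qed (use T assms in auto)
    moreover have "cmod (2 * pi * \<i> * of_real S) = 2 * pi * \<bar>S\<bar>" by (simp add: norm_mult)
    ultimately show ?thesis
      using norm_triangle_ineq2[of "2 * pi * \<i> * of_real S" A] by (simp add: norm_minus_commute mult_ac)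
  qed
  have "((\<lambda>T. 32 * K * x powr \<sigma> + 6 * x powr \<sigma> * M / (T - 1)) \<longlongrightarrow> 32 * K * x powr \<sigma> + 0) at_top"
    by (intro tendsto_add tendsto_const) real_asymp
  moreover have "\<forall>\<^sub>F T in at_top. 2 * pi * \<bar>S\<bar> \<le> 32 * K * x powr \<sigma> + 6 * x powr \<sigma> * M / (T - 1)"
    using eventually_gt_at_top[of "2 :: real"] by eventually_elim (rule main)
  ultimately have "2 * pi * \<bar>S\<bar> \<le> 32 * K * x powr \<sigma> + 0"
    by (intro tendsto_lowerbound) auto
  moreover have "1 * \<bar>S\<bar> \<le> 2 * pi * \<bar>S\<bar>" using pi_gt3 by (intro mult_right_mono) auto
  ultimately show ?thesis by (simp add: S_def)
qed

text \<open>The abscissa \<sigma> = 1 + 1 / ln N makes N^\<sigma> equal to N times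
  \<open>exp 1\<close>, and the bound for the series is uniform in \<sigma>. From N \<ge> 8 follows
  ln N \<ge> 2, hence \<sigma> \<le> 3 / 2.\<close>

lemma riesz_error_bound:
  "\<exists>C>0. \<forall>N\<ge>8. \<bar>\<Sum>n=1..N. (mangoldt n - 1) * ln (real n) ^ k * (real N - real n)\<bar> \<le> C * (real N)\<^sup>2"
proof -
  let ?b = "\<lambda>n. (mangoldt n - 1) * ln (real n) ^ k :: real"
  have b: "polylog_bounded ?b"
    by (intro polylog_bounded_mult_ln_power polylog_bounded_diff polylog_bounded_mangoldt polylog_bounded_one)
  obtain K where K: "K > 0" and bd: "\<And>s. 1 < Re s \<Longrightarrow> Re s \<le> 3 / 2 \<Longrightarrow> cmod (dirichlet ?b s) \<le> K * sqrt (\<bar>Im s\<bar> + 3)"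
    using dirichlet_error_bound[of k] by metis
  show ?thesis
  proof (intro exI[of _ "96 * K"] conjI allI impI)
    fix N :: nat assume N: "N \<ge> 8"
    have "ln (8 :: real) \<le> ln (real N)" using N by simp
    moreover have "ln (8 :: real) = 3 * ln 2" using ln_realpow[of 2 3] by simp
    ultimately have l2: "ln (real N) \<ge> 2" using ln2_ge_two_thirds by linarith
    define \<sigma> where "\<sigma> = 1 + 1 / ln (real N)"
    have \<sigma>: "1 < \<sigma>" "\<sigma> \<le> 3 / 2" using l2 by (auto simp: \<sigma>_def field_simps)
    have p: "real N powr \<sigma> \<le> 3 * real N"
    proof -
      have "real N powr \<sigma> = real N * exp 1"
        using N l2 by (simp add: \<sigma>_def powr_add) (simp add: powr_def)
      also have "\<dots> \<le> real N * 3" using exp_le by (intro mult_left_mono) auto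
      finally show ?thesis by simp
    qed
    have "(\<Sum>n. ?b (Suc n) * max 0 (1 - real (Suc n) / real N)) = (\<Sum>n<N. ?b (Suc n) * max 0 (1 - real (Suc n) / real N))"
      using N by (intro suminf_finite) (auto simp: max_def field_simps)
    also have "\<dots> = (\<Sum>n=1..N. ?b n * max 0 (1 - real n / real N))"
      by (rule sum.reindex_bij_witness[of _ "\<lambda>n. n - 1" Suc]) auto
    also have "\<dots> = (\<Sum>n=1..N. ?b n * (real N - real n)) / real N"
      unfolding sum_divide_distrib using N by (intro sum.cong refl) (auto simp: max_def field_simps)
    finally have "\<bar>(\<Sum>n=1..N. ?b n * (real N - real n)) / real N\<bar> \<le> 32 * K * real N powr \<sigma>"
      using perron_sum_bound[OF b \<sigma>(1), of K "real N"] \<sigma> N K bd[of "Complex \<sigma> t" for t] by simp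
    also have "\<dots> \<le> 32 * K * (3 * real N)" using p K by (intro mult_left_mono) auto
    finally show "\<bar>\<Sum>n=1..N. ?b n * (real N - real n)\<bar> \<le> 96 * K * (real N)\<^sup>2"
      using N by (simp add: abs_divide field_simps power2_eq_square)
  qed (use K in auto)
qed

section \<open>Unsmoothing and the prime number theorem\<close>

lemma abs_mangoldt_minus_one_le:
  assumes "n \<ge> 3"
  shows "\<bar>mangoldt n - 1 :: real\<bar> \<le> ln (real n)"
proof -
  have "real n \<ge> 3" using assms by simp
  hence "exp 1 \<le> real n" using exp_le by linarith
  hence "1 \<le> ln (real n)" using assms by (subst ln_ge_iff) auto
  moreover have "0 \<le> (mangoldt n :: real)" "mangoldt n \<le> ln (real n)"
    using mangoldt_nonneg mangoldt_le assms by auto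
  ultimately show ?thesis by auto
qed

text \<open>The Riesz mean is unsmoothed by differencing it over a window of length about \<open>N / ln(N)\<^bsup>j+1\<^esup>\<close>, which
  costs half of the \<open>2j + 2\<close> logarithms in the trivial bound.\<close>

lemma weighted_error_bound:
  "\<exists>C>0. \<forall>\<^sub>F N in sequentially. \<bar>\<Sum>n=1..N. (mangoldt n - 1) * ln (real n) ^ (2 * j + 1)\<bar> \<le> C * real N * ln (real N) ^ (j + 1)"
proof -
  define b where "b n = (mangoldt n - 1) * ln (real n) ^ (2 * j + 1)" for n
  define R where "R N = (\<Sum>n=1..N. b n * (real N - real n))" for N
  define S where "S N = (\<Sum>n=1..N. b n)" for N
  obtain C where C: "C > 0" and R: "\<And>N. N \<ge> 8 \<Longrightarrow> \<bar>R N\<bar> \<le> C * (real N)\<^sup>2"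
    using riesz_error_bound[of "2 * j + 1"] by (auto simp: R_def b_def)
  have bb: "\<bar>b n\<bar> \<le> (2 * ln (real N)) ^ (2 * j + 2)" if "n \<ge> 3" "n \<le> 2 * N" "N \<ge> 8" for n N
  proof -
    have "\<bar>b n\<bar> = \<bar>mangoldt n - 1\<bar> * ln (real n) ^ (2 * j + 1)" using that by (simp add: b_def abs_mult)
    also have "\<dots> \<le> ln (real n) * ln (real n) ^ (2 * j + 1)"
      using that by (intro mult_right_mono abs_mangoldt_minus_one_le) auto
    also have "\<dots> = ln (real n) ^ (2 * j + 2)" by simp
    also have "\<dots> \<le> (2 * ln (real N)) ^ (2 * j + 2)"
    proof (intro power_mono)
      have "2 * N \<le> N * N" using that by (intro mult_le_mono1) auto
      hence "n \<le> N * N" using that by linarith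
      hence "real n \<le> real (N * N)" by (simp only: of_nat_le_iff)
      hence "real n \<le> real N ^ 2" by (simp add: power2_eq_square)
      hence "ln (real n) \<le> ln (real N ^ 2)" using that by simp
      thus "ln (real n) \<le> 2 * ln (real N)" using that by (simp add: ln_realpow)
    qed (use that in auto)
    finally show ?thesis .
  qed
  \<comment> \<open>Rests on the identity R (N + h) - R N = h S N + X, where X collects the n beyond
    N. The Riesz means are bounded by order N^2, and X trivially by h^2 times the largest
    coefficient.\<close>
  have step: "real h * \<bar>S N\<bar> \<le> 5 * C * (real N)\<^sup>2 + (real h)\<^sup>2 * (2 * ln (real N)) ^ (2 * j + 2)"
    if h: "h \<le> N" "N \<ge> 8" for h N
  proof -
    define X where "X = (\<Sum>n\<in>{N<..N + h}. b n * (real (N + h) - real n))"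
    have "{1..N + h} = {1..N} \<union> {N<..N + h}" by auto
    moreover have "sum F ({1..N} \<union> {N<..N + h}) = sum F {1..N} + sum F {N<..N + h}" for F :: "nat \<Rightarrow> real"
      by (intro sum.union_disjoint) auto
    ultimately have "R (N + h) = (\<Sum>n=1..N. b n * (real (N + h) - real n)) + X"
      unfolding R_def X_def by simp
    also have "(\<Sum>n=1..N. b n * (real (N + h) - real n)) = R N + real h * S N"
      by (simp add: R_def S_def sum_distrib_left sum.distrib[symmetric] algebra_simps)
    finally have eq: "real h * S N = R (N + h) - R N - X" by simp
    have "\<bar>X\<bar> \<le> (\<Sum>n\<in>{N<..N + h}. (2 * ln (real N)) ^ (2 * j + 2) * real h)"
      unfolding X_def
    proof (rule order.trans[OF sum_abs], rule sum_mono)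
      fix n assume n: "n \<in> {N<..N + h}"
      have "\<bar>b n\<bar> * \<bar>real (N + h) - real n\<bar> \<le> (2 * ln (real N)) ^ (2 * j + 2) * real h"
        using n h by (intro mult_mono bb) auto
      thus "\<bar>b n * (real (N + h) - real n)\<bar> \<le> (2 * ln (real N)) ^ (2 * j + 2) * real h"
        by (simp add: abs_mult)
    qed
    also have "\<dots> = (real h)\<^sup>2 * (2 * ln (real N)) ^ (2 * j + 2)" by (simp add: power2_eq_square)
    finally have X: "\<bar>X\<bar> \<le> (real h)\<^sup>2 * (2 * ln (real N)) ^ (2 * j + 2)" .
    have "\<bar>R (N + h)\<bar> \<le> C * (real (N + h))\<^sup>2" using h by (intro R) auto
    also have "\<dots> \<le> C * (2 * real N)\<^sup>2" using h C by (intro mult_left_mono power_mono) auto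
    finally have "\<bar>R (N + h)\<bar> \<le> 4 * (C * (real N)\<^sup>2)" by (simp add: power_mult_distrib)
    moreover have "\<bar>R N\<bar> \<le> C * (real N)\<^sup>2" using h by (intro R) auto
    moreover have "real h * \<bar>S N\<bar> = \<bar>real h * S N\<bar>" by (simp add: abs_mult)
    moreover have "\<bar>x - y - z\<bar> \<le> \<bar>x\<bar> + \<bar>y\<bar> + \<bar>z\<bar>" for x y z :: real by arith
    note this[of "R (N + h)" "R N" X]
    ultimately show ?thesis using X unfolding eq by simp
  qed
  have ev: "\<forall>\<^sub>F N in sequentially. ln (real N) ^ (j + 1) \<le> real N" by real_asymp
  have ev1: "\<forall>\<^sub>F N in sequentially. 1 \<le> ln (real N)" by real_asymp
  define C' where "C' = 10 * C + 2 ^ (2 * j + 2)"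
  show ?thesis
  proof (rule exI[of _ C'], intro conjI)
    show "C' > 0" using C by (simp add: C'_def add_pos_pos)
    show "\<forall>\<^sub>F N in sequentially. \<bar>\<Sum>n=1..N. (mangoldt n - 1) * ln (real n) ^ (2 * j + 1)\<bar> \<le> C' * real N * ln (real N) ^ (j + 1)"
      using ev ev1 eventually_ge_at_top[of 8]
    proof eventually_elim
      case (elim N)
      define L where "L = ln (real N) ^ (j + 1)"
      have L: "1 \<le> L" "L \<le> real N" using elim one_le_power[of "ln (real N)" "j + 1"] by (auto simp: L_def)
      \<comment> \<open>This length equalises the orders of N^2 / h and h ln(N)^(2 j + 2).\<close>
      define y where "y = real N / L"
      have y: "1 \<le> y" "y \<le> real N" using L by (auto simp: y_def field_simps) 
      define h where "h = nat \<lfloor>y\<rfloor>"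
      have "1 \<le> \<lfloor>y\<rfloor>" using y by (simp add: le_floor_iff)
      hence h: "real h \<le> y" "y - 1 \<le> real h" "1 \<le> real h" using y unfolding h_def by linarith+
      have h2: "y / 2 \<le> real h" using h y by linarith
      have hN: "h \<le> N" using h y by linarith
      have LL: "(2 * ln (real N)) ^ (2 * j + 2) = 2 ^ (2 * j + 2) * (L * L)"
        by (simp add: L_def power_mult_distrib power_add[symmetric] mult_2[symmetric])
      have "real h * \<bar>S N\<bar> \<le> 5 * C * (real N)\<^sup>2 + (real h)\<^sup>2 * (2 ^ (2 * j + 2) * (L * L))"
        using step[OF hN elim(3)] unfolding LL .
      also have "\<dots> \<le> 10 * C * (real N * L) * real h + (2 ^ (2 * j + 2) * (real N * L)) * real h"
      proof (rule add_mono)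
        have "5 * C * (real N)\<^sup>2 = 10 * C * (real N * L) * (y / 2)"
          using L by (simp add: y_def power2_eq_square)
        also have "\<dots> \<le> 10 * C * (real N * L) * real h" using h2 C L by (intro mult_left_mono) auto
        finally show "5 * C * (real N)\<^sup>2 \<le> 10 * C * (real N * L) * real h" .
        have "real h * L \<le> y * L" using h L by (intro mult_right_mono) auto
        also have "\<dots> = real N" using L by (simp add: y_def)
        finally have "(real h * L) * (2 ^ (2 * j + 2) * (L * real h)) \<le> real N * (2 ^ (2 * j + 2) * (L * real h))"
          using L by (intro mult_right_mono) auto
        thus "(real h)\<^sup>2 * (2 ^ (2 * j + 2) * (L * L)) \<le> (2 ^ (2 * j + 2) * (real N * L)) * real h"
          by (simp add: power2_eq_square mult_ac)
      qed
      also have "\<dots> = real h * (C' * real N * L)" by (simp add: C'_def algebra_simps)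
      finally have "\<bar>S N\<bar> \<le> C' * real N * L" using h by simp
      thus ?case by (simp add: S_def b_def L_def)
    qed
  qed
qed

text \<open>Summation by parts for decreasing weights: the variation telescopes to w (m + 1) - w N,
  and the two boundary terms add back at most M (w (m + 1) + w N). The sum starts above m so that
  weights that are large or degenerate at small n are allowed.\<close>

lemma abel_summation_bound:
  fixes b w :: "nat \<Rightarrow> real"
  assumes "m < N" and w: "\<And>n. m < n \<Longrightarrow> n < N \<Longrightarrow> w (Suc n) \<le> w n" and w0: "\<And>n. m < n \<Longrightarrow> n \<le> N \<Longrightarrow> 0 \<le> w n"
    and S: "\<And>n. m \<le> n \<Longrightarrow> n \<le> N \<Longrightarrow> \<bar>\<Sum>i=1..n. b i\<bar> \<le> M"
  shows "\<bar>\<Sum>n\<in>{m<..N}. b n * w n\<bar> \<le> 2 * M * w (Suc m)"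
proof -
  define s where "s n = (\<Sum>i=1..n. b i)" for n
  have M: "M \<ge> 0" using S[of m] assms(1) by auto
  have key: "n \<le> N \<longrightarrow> \<bar>(\<Sum>i\<in>{m<..n}. b i * w i) - s n * w n + s m * w (Suc m)\<bar> \<le> M * (w (Suc m) - w n)" if "Suc m \<le> n" for n
    using that
  proof (induction n rule: dec_induct)
    case base
    have "{m<..Suc m} = {Suc m}" by auto
    thus ?case by (simp add: s_def algebra_simps)
  next
    case (step n)
    show ?case
    proof
      assume n: "Suc n \<le> N"
      have e: "{m<..Suc n} = insert (Suc n) {m<..n}" using step by auto
      have "(\<Sum>i\<in>{m<..Suc n}. b i * w i) - s (Suc n) * w (Suc n) + s m * w (Suc m) =
         ((\<Sum>i\<in>{m<..n}. b i * w i) - s n * w n + s m * w (Suc m)) + s n * (w n - w (Suc n))"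
        unfolding e by (simp add: s_def algebra_simps)
      also have "\<bar>\<dots>\<bar> \<le> M * (w (Suc m) - w n) + M * (w n - w (Suc n))"
      proof (rule order.trans[OF abs_triangle_ineq add_mono])
        show "\<bar>(\<Sum>i\<in>{m<..n}. b i * w i) - s n * w n + s m * w (Suc m)\<bar> \<le> M * (w (Suc m) - w n)"
          using step n by auto
        have "w (Suc n) \<le> w n" using w[of n] step n by auto
        thus "\<bar>s n * (w n - w (Suc n))\<bar> \<le> M * (w n - w (Suc n))"
          unfolding abs_mult using S[of n] step n by (intro mult_mono) (auto simp: s_def)
      qed
      finally show "\<bar>(\<Sum>i\<in>{m<..Suc n}. b i * w i) - s (Suc n) * w (Suc n) + s m * w (Suc m)\<bar> \<le> M * (w (Suc m) - w (Suc n))"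
        by (simp add: algebra_simps)
    qed
  qed
  have N: "Suc m \<le> N" using assms(1) by auto
  have 1: "\<bar>s N * w N\<bar> \<le> M * w N" unfolding abs_mult using S[of N] w0[of N] N by (intro mult_mono) (auto simp: s_def)
  have 2: "\<bar>s m * w (Suc m)\<bar> \<le> M * w (Suc m)" unfolding abs_mult using S[of m] w0[of "Suc m"] N by (intro mult_mono) (auto simp: s_def)
  have 3: "\<bar>(\<Sum>i\<in>{m<..N}. b i * w i) - s N * w N + s m * w (Suc m)\<bar> \<le> M * w (Suc m) - M * w N"
    using key[OF N] by (simp add: right_diff_distrib)
  have "\<bar>x\<bar> \<le> 2 * a" if "\<bar>y\<bar> \<le> b" "\<bar>z\<bar> \<le> a" "\<bar>x - y + z\<bar> \<le> a - b" for x y z a b :: real using that by arith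
  from this[OF 1 2 3] show ?thesis by simp
qed

lemma trivial_prime_error:
  assumes "n \<le> N"
  shows "\<bar>\<Sum>i=1..n. mangoldt i - 1 :: real\<bar> \<le> real n * (1 + ln (real N))"
proof (cases "n = 0")
  case False
  have L: "0 \<le> ln (real N)" using False assms by simp
  have "\<bar>\<Sum>i=1..n. mangoldt i - 1 :: real\<bar> \<le> (\<Sum>i=1..n. 1 + ln (real N))"
  proof (rule order.trans[OF sum_abs], rule sum_mono)
    fix i assume i: "i \<in> {1..n}"
    have "0 \<le> (mangoldt i :: real)" "mangoldt i \<le> ln (real i)" using i mangoldt_nonneg mangoldt_le by auto
    moreover have "ln (real i) \<le> ln (real N)" using i assms by simp
    ultimately show "\<bar>mangoldt i - 1 :: real\<bar> \<le> 1 + ln (real N)" using L by (simp add: abs_le_iff)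
  qed
  thus ?thesis by simp
qed simp

text \<open>The weight ln(n)^k is divided out by partial summation, only above sqrt N, where ln n
  \<ge> ln N / 2 and merely 2^k is lost; the terms up to sqrt N are trivial. With k = 2 j + 1 the
  balance is ln^(j + 1) / ln^(2 j + 1).\<close>

theorem prime_number_theorem_log_power:
  "\<exists>C>0. \<forall>\<^sub>F N in sequentially. \<bar>\<Sum>n=1..N. mangoldt n - 1\<bar> \<le> C * real N / ln (real N) ^ j"
proof -
  define k where "k = 2 * j + 1"
  obtain C where C: "C > 0" and "\<forall>\<^sub>F N in sequentially. \<bar>\<Sum>n=1..N. (mangoldt n - 1) * ln (real n) ^ k\<bar> \<le> C * real N * ln (real N) ^ (j + 1)"
    using weighted_error_bound[of j] by (auto simp: k_def)
  then obtain N0 where N0: "\<And>N. N \<ge> N0 \<Longrightarrow> \<bar>\<Sum>n=1..N. (mangoldt n - 1) * ln (real n) ^ k\<bar> \<le> C * real N * ln (real N) ^ (j + 1)"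
    unfolding eventually_sequentially by blast
  have ev1: "\<forall>\<^sub>F N in sequentially. sqrt (real N) * (1 + ln (real N)) \<le> real N / ln (real N) ^ j" by real_asymp
  have ev2: "\<forall>\<^sub>F N in sequentially. sqrt (real N) \<ge> real (N0 + 3)" by real_asymp
  have ev3: "\<forall>\<^sub>F N in sequentially. ln (real N) \<ge> 1" by real_asymp
  define C' where "C' = 1 + 2 * C * 2 ^ k"
  show ?thesis
  proof (rule exI[of _ C'], intro conjI)
    show "C' > 0" using C by (simp add: C'_def add_pos_pos)
    show "\<forall>\<^sub>F N in sequentially. \<bar>\<Sum>n=1..N. mangoldt n - 1\<bar> \<le> C' * real N / ln (real N) ^ j"
      using ev1 ev2 ev3
    proof eventually_elim
      case (elim N)
      define L where "L = ln (real N)"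
      have L: "L \<ge> 1" using elim by (simp add: L_def)
      define m where "m = nat \<lfloor>sqrt (real N)\<rfloor>"
      have "sqrt (real N) \<ge> 0" by simp
      hence m: "real m \<le> sqrt (real N)" "sqrt (real N) \<le> real (Suc m)" unfolding m_def by linarith+
      have m3: "m \<ge> N0 + 2" using elim(2) unfolding m_def by linarith
      have N1: "real N \<ge> 1" using elim(3) by (cases "N = 0") auto
      have mN: "m < N"
      proof -
        have "1 < sqrt (real N)" using elim(2) by linarith
        hence "1 * sqrt (real N) < sqrt (real N) * sqrt (real N)" by (intro mult_strict_right_mono) linarith+
        hence "sqrt (real N) < real N" by simp
        thus ?thesis using m by linarith
      qed
      define w where "w n = 1 / ln (real n) ^ k" for n :: nat
      have E1: "\<bar>\<Sum>n=1..m. mangoldt n - 1 :: real\<bar> \<le> sqrt (real N) * (1 + L)"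
      proof -
        have "\<bar>\<Sum>n=1..m. mangoldt n - 1 :: real\<bar> \<le> real m * (1 + L)"
          unfolding L_def using mN by (intro trivial_prime_error) auto
        also have "\<dots> \<le> sqrt (real N) * (1 + L)" using m L by (intro mult_right_mono) auto
        finally show ?thesis .
      qed
      have E2: "\<bar>\<Sum>n\<in>{m<..N}. mangoldt n - 1 :: real\<bar> \<le> 2 * (C * real N * L ^ (j + 1)) * w (Suc m)"
      proof -
        have "(\<Sum>n\<in>{m<..N}. mangoldt n - 1 :: real) = (\<Sum>n\<in>{m<..N}. ((mangoldt n - 1) * ln (real n) ^ k) * w n)"
          using m3 by (intro sum.cong refl) (auto simp: w_def)
        also have "\<bar>\<dots>\<bar> \<le> 2 * (C * real N * L ^ (j + 1)) * w (Suc m)"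
        proof (rule abel_summation_bound[OF mN])
          fix n assume n: "m < n" "n < N"
          have "0 < ln (real n)" using n m3 by simp
          moreover have "ln (real n) \<le> ln (real (Suc n))" using n by simp
          ultimately show "w (Suc n) \<le> w n" unfolding w_def by (intro frac_le power_mono) auto
        next
          fix n assume n: "m \<le> n" "n \<le> N"
          have "\<bar>\<Sum>i=1..n. (mangoldt i - 1) * ln (real i) ^ k\<bar> \<le> C * real n * ln (real n) ^ (j + 1)"
            using n m3 by (intro N0) auto
          also have "\<dots> \<le> C * real N * L ^ (j + 1)"
            unfolding L_def using n m3 C by (intro mult_mono power_mono) auto
          finally show "\<bar>\<Sum>i=1..n. (mangoldt i - 1) * ln (real i) ^ k\<bar> \<le> C * real N * L ^ (j + 1)" .
        qed (auto simp: w_def)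
        finally show ?thesis .
      qed
      have wm: "w (Suc m) \<le> 2 ^ k / L ^ k"
      proof -
        have "ln (sqrt (real N)) \<le> ln (real (Suc m))" using m N1 by (subst ln_le_cancel_iff) auto
        hence "L / 2 \<le> ln (real (Suc m))" using N1 by (simp add: L_def ln_sqrt)
        hence "(L / 2) ^ k \<le> ln (real (Suc m)) ^ k" using L by (intro power_mono) auto
        hence "w (Suc m) \<le> 1 / (L / 2) ^ k" unfolding w_def using L by (intro frac_le) auto
        thus ?thesis by (simp add: power_divide)
      qed
      have "{1..N} = {1..m} \<union> {m<..N}" using mN by auto
      hence "(\<Sum>n=1..N. mangoldt n - 1 :: real) = (\<Sum>n=1..m. mangoldt n - 1) + (\<Sum>n\<in>{m<..N}. mangoldt n - 1)"
        by (simp only:) (intro sum.union_disjoint; auto)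
      also have "\<bar>\<dots>\<bar> \<le> sqrt (real N) * (1 + L) + 2 * (C * real N * L ^ (j + 1)) * w (Suc m)"
        by (rule order.trans[OF abs_triangle_ineq add_mono]) (rule E1 E2)+
      also have "\<dots> \<le> real N / L ^ j + 2 * (C * real N * L ^ (j + 1)) * (2 ^ k / L ^ k)"
        using wm elim(1) C L by (intro add_mono mult_left_mono) (auto simp: L_def)
      also have "2 * (C * real N * L ^ (j + 1)) * (2 ^ k / L ^ k) = 2 * C * 2 ^ k * (real N / L ^ j)"
      proof -
        have "L ^ k = L ^ (j + 1) * L ^ j" unfolding power_add[symmetric] k_def by (rule arg_cong[of _ _ "power L"]) simp
        thus ?thesis using L by simp
      qed
      also have "real N / L ^ j + 2 * C * 2 ^ k * (real N / L ^ j) = C' * real N / L ^ j"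
        by (simp add: C'_def distrib_right add_divide_distrib)
      finally show ?case by (simp add: L_def)
    qed
  qed
qed

section \<open>The Fourier transform of \<open>\<Lambda>\<close>\<close>

text \<open>Partial summation against a character needs all partial sums up to N, bounded in terms
  of N. Those with n \<le> sqrt N are trivially small; for the others ln n and ln N are
  comparable.\<close>

lemma uniform_prime_error:
  "\<exists>C>0. \<forall>\<^sub>F N in sequentially. \<forall>n\<le>N. \<bar>\<Sum>i=1..n. mangoldt i - 1 :: real\<bar> \<le> C * real N / ln (real N) ^ j"
proof -
  obtain C where C: "C > 0" and "\<forall>\<^sub>F N in sequentially. \<bar>\<Sum>n=1..N. mangoldt n - 1 :: real\<bar> \<le> C * real N / ln (real N) ^ j"
    using prime_number_theorem_log_power[of j] by blast
  then obtain N0 where N0: "\<And>N. N \<ge> N0 \<Longrightarrow> \<bar>\<Sum>n=1..N. mangoldt n - 1 :: real\<bar> \<le> C * real N / ln (real N) ^ j"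
    unfolding eventually_sequentially by blast
  have ev1: "\<forall>\<^sub>F N in sequentially. sqrt (real N) * (1 + ln (real N)) \<le> real N / ln (real N) ^ j" by real_asymp
  have ev2: "\<forall>\<^sub>F N in sequentially. sqrt (real N) \<ge> real (N0 + 3)" by real_asymp
  have ev3: "\<forall>\<^sub>F N in sequentially. ln (real N) \<ge> 1" by real_asymp
  show ?thesis
  proof (rule exI[of _ "1 + C * 2 ^ j"], intro conjI)
    show "1 + C * 2 ^ j > 0" using C by (simp add: add_pos_pos)
    show "\<forall>\<^sub>F N in sequentially. \<forall>n\<le>N. \<bar>\<Sum>i=1..n. mangoldt i - 1 :: real\<bar> \<le> (1 + C * 2 ^ j) * real N / ln (real N) ^ j"
      using ev1 ev2 ev3
    proof (eventually_elim, intro allI impI)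
      fix N n assume ev: "sqrt (real N) * (1 + ln (real N)) \<le> real N / ln (real N) ^ j" "sqrt (real N) \<ge> real (N0 + 3)" "ln (real N) \<ge> 1"
        and n: "n \<le> N"
      define L where "L = ln (real N)"
      have L: "L \<ge> 1" using ev by (simp add: L_def)
      have split: "(1 + C * 2 ^ j) * real N / L ^ j = real N / L ^ j + C * 2 ^ j * real N / L ^ j"
        by (simp add: distrib_right add_divide_distrib)
      have nn: "0 \<le> real N / L ^ j" "0 \<le> C * 2 ^ j * real N / L ^ j" using L C by auto
      show "\<bar>\<Sum>i=1..n. mangoldt i - 1 :: real\<bar> \<le> (1 + C * 2 ^ j) * real N / ln (real N) ^ j"
      proof (cases "real n \<le> sqrt (real N)")
        case True
        have "\<bar>\<Sum>i=1..n. mangoldt i - 1 :: real\<bar> \<le> real n * (1 + L)"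
          unfolding L_def using n by (rule trivial_prime_error)
        also have "\<dots> \<le> sqrt (real N) * (1 + L)" using True L by (intro mult_right_mono) auto
        also have "\<dots> \<le> real N / L ^ j" using ev by (simp add: L_def)
        also have "\<dots> \<le> (1 + C * 2 ^ j) * real N / L ^ j" unfolding split using nn(2) by simp
        finally show ?thesis by (simp add: L_def)
      next
        case False
        hence n2: "n \<ge> N0" "real n > 1" using ev(2) by linarith+
        have N1: "real N > 0" using n2 n by simp
        have "ln (sqrt (real N)) \<le> ln (real n)" using False n2 N1 by (subst ln_le_cancel_iff) auto
        hence l: "L / 2 \<le> ln (real n)" using N1 by (simp add: L_def ln_sqrt)
        have "\<bar>\<Sum>i=1..n. mangoldt i - 1 :: real\<bar> \<le> C * real n / ln (real n) ^ j" using n2 by (intro N0)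
        also have "\<dots> \<le> C * real N / (L / 2) ^ j"
          using n C l L by (intro frac_le power_mono mult_left_mono) auto
        also have "\<dots> = C * 2 ^ j * real N / L ^ j" by (simp add: power_divide)
        also have "\<dots> \<le> (1 + C * 2 ^ j) * real N / L ^ j" unfolding split using nn(1) by simp
        finally show ?thesis by (simp add: L_def)
      qed
    qed
  qed
qed

lemma slowly_varying_sum_bound:
  fixes a :: "nat \<Rightarrow> real" and z :: "nat \<Rightarrow> complex"
  assumes S: "\<And>n. n \<le> N \<Longrightarrow> \<bar>\<Sum>i=1..n. a i\<bar> \<le> Q" and z1: "\<And>n. cmod (z n) \<le> 1"
    and zd: "\<And>n. cmod (z n - z (Suc n)) \<le> d"
  shows "cmod (\<Sum>n=1..N. of_real (a n) * z n) \<le> Q * (1 + real N * d)"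
proof -
  have Q: "Q \<ge> 0" using S[of 0] by simp
  have key: "m \<le> N \<Longrightarrow> cmod ((\<Sum>n=1..m. of_real (a n) * z n) - of_real (\<Sum>i=1..m. a i) * z m) \<le> Q * d * real m" for m
  proof (induction m)
    case (Suc m)
    have "(\<Sum>n=1..Suc m. of_real (a n) * z n) - of_real (\<Sum>i=1..Suc m. a i) * z (Suc m) =
      ((\<Sum>n=1..m. of_real (a n) * z n) - of_real (\<Sum>i=1..m. a i) * z m) + of_real (\<Sum>i=1..m. a i) * (z m - z (Suc m))"
      by (simp add: algebra_simps)
    also have "cmod \<dots> \<le> Q * d * real m + Q * d"
    proof (rule order.trans[OF norm_triangle_ineq add_mono])
      show "cmod (of_real (\<Sum>i=1..m. a i) * (z m - z (Suc m))) \<le> Q * d"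
        unfolding norm_mult norm_of_real using S[of m] Suc zd[of m] Q by (intro mult_mono) auto
    qed (use Suc in auto)
    finally show ?case by (simp add: algebra_simps)
  qed simp
  have "cmod (of_real (\<Sum>i=1..N. a i) * z N) \<le> Q * 1"
    unfolding norm_mult norm_of_real using S[of N] z1[of N] Q by (intro mult_mono) auto
  with key[of N] have "cmod (\<Sum>n=1..N. of_real (a n) * z n) \<le> Q * 1 + Q * d * real N"
    using norm_triangle_ineq2[of "\<Sum>n=1..N. of_real (a n) * z n" "of_real (\<Sum>i=1..N. a i) * z N"] by linarith
  thus ?thesis by (simp add: algebra_simps)
qed

text \<open>A nontrivial character sums to zero over a full period, so \<Lambda> may be replaced by
  \<Lambda> - 1. The character turns by |r| / N per step, and summation by parts multiplies the
  bound for the partial sums by 1 + 2 pi |r|.\<close>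

lemma mangoldt_hat_bound:
  assumes S: "\<And>n. n \<le> N \<Longrightarrow> \<bar>\<Sum>i=1..n. mangoldt i - 1 :: real\<bar> \<le> Q" and r: "r \<noteq> 0" "\<bar>r\<bar> < int N"
  shows "cmod (mangoldt_hat N r) \<le> Q * (1 + 2 * pi * of_int \<bar>r\<bar>)"
proof -
  have N: "N > 0" using r by linarith
  define z where "z n = e (- (of_int r * of_nat n / of_nat N))" for n
  \<comment> \<open>The periods \<open>{1..N}\<close> and \<open>{..<N}\<close> differ in one end
    point, where the character takes the same value.\<close>
  have "(\<Sum>n=1..N. z n) = (\<Sum>n<N. z n)"
  proof -
    have "z N = z 0" using N e_of_int[of "- r"] by (simp add: z_def)
    moreover have "(\<Sum>n=1..N. z n) + z 0 = (\<Sum>n<N. z n) + z N"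
    proof -
      have "(\<Sum>n\<le>N. z n) = z 0 + (\<Sum>n=1..N. z n)"
        by (simp add: sum.atMost_shift sum.atLeast1_atMost_eq lessThan_Suc_atMost)
      moreover have "(\<Sum>n\<le>N. z n) = (\<Sum>n<N. z n) + z N" by (simp add: lessThan_Suc_atMost[symmetric])
      ultimately show ?thesis by simp
    qed
    ultimately show ?thesis by simp
  qed
  also have "\<dots> = (\<Sum>n<N. e (of_int (- r) * (real n / real N)))"
    by (intro sum.cong refl) (simp add: z_def)
  also have "\<dots> = 0" using r N by (subst sum_e_roots) auto
  finally have z0: "(\<Sum>n=1..N. z n) = 0" .
  have "mangoldt_hat N r = (\<Sum>n=1..N. of_real (mangoldt n - 1) * z n) + (\<Sum>n=1..N. z n)"
    unfolding mangoldt_hat_def z_def[symmetric] sum.distrib[symmetric] by (intro sum.cong refl) (simp add: algebra_simps)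
  also have "cmod \<dots> \<le> Q * (1 + real N * (2 * pi * of_int \<bar>r\<bar> / real N))"
    unfolding z0 add_0_right
  proof (rule slowly_varying_sum_bound)
    fix n
    have "- (of_int r * real (Suc n) / real N) = - (of_int r * real n / real N) + - (of_int r / real N)"
      by (simp add: add_divide_distrib algebra_simps)
    hence "z (Suc n) = z n * e (- (of_int r / real N))"
      unfolding z_def by (simp only: e_add)
    hence "z n - z (Suc n) = z n * (1 - e (- (of_int r / real N)))" by (simp add: algebra_simps)
    hence "cmod (z n - z (Suc n)) = cmod (1 - e (- (of_int r / real N)))"
      by (simp add: norm_mult z_def)
    also have "\<dots> \<le> 2 * pi * \<bar>- (of_int r / of_nat N)\<bar>" by (rule norm_one_minus_e_le)
    finally show "cmod (z n - z (Suc n)) \<le> 2 * pi * of_int \<bar>r\<bar> / real N" by simp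
  qed (use S in \<open>auto simp: z_def\<close>)
  finally show ?thesis using N by simp
qed

lemma mangoldt_hat_periodic: "N > 0 \<Longrightarrow> mangoldt_hat N (\<xi> - int N) = mangoldt_hat N \<xi>"
proof -
  assume N: "N > 0"
  have "- (of_int (\<xi> - int N) * real n / real N) = - (of_int \<xi> * real n / real N) + of_int (int n)" for n
    using N by (simp add: field_simps)
  thus ?thesis unfolding mangoldt_hat_def by (simp only: e_add_of_int)
qed

lemma mangoldt_hat_square_sum:
  assumes "N > 0"
  shows "(\<Sum>\<xi>\<in>{0..<int N}. (cmod (mangoldt_hat N \<xi>))\<^sup>2) \<le> (real N * ln (real N))\<^sup>2"
proof -
  have sq: "complex_of_real ((cmod (mangoldt_hat N (int r)))\<^sup>2) = 
     (\<Sum>n=1..N. \<Sum>m=1..N. mangoldt n * mangoldt m * e (of_int (int m - int n) * (real r / real N)))" for r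
  proof -
    have ee: "e (- (real r * real n / real N)) * cnj (e (- (real r * real m / real N))) = e (of_int (int m - int n) * (real r / real N))" for n m
      unfolding e_diff[symmetric] by (rule arg_cong[of _ _ e]) (simp add: algebra_simps diff_divide_distrib)
    have cm: "cnj (mangoldt m) = mangoldt m" for m by (simp add: complex_eq_iff)
    show ?thesis
      unfolding complex_norm_square mangoldt_hat_def cnj_sum sum_product ee[symmetric]
      by (intro sum.cong refl) (simp add: cm)
  qed
  have "complex_of_real (\<Sum>\<xi>\<in>{0..<int N}. (cmod (mangoldt_hat N \<xi>))\<^sup>2) = (\<Sum>r<N. complex_of_real ((cmod (mangoldt_hat N (int r)))\<^sup>2))"
    unfolding of_real_sum by (rule sum.reindex_bij_witness[of _ int nat]) auto
  also have "\<dots> = (\<Sum>r<N. \<Sum>n=1..N. \<Sum>m=1..N. mangoldt n * mangoldt m * e (of_int (int m - int n) * (real r / real N)))"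
    by (simp only: sq)
  also have "\<dots> = (\<Sum>n=1..N. \<Sum>r<N. \<Sum>m=1..N. mangoldt n * mangoldt m * e (of_int (int m - int n) * (real r / real N)))"
    by (rule sum.swap)
  also have "\<dots> = (\<Sum>n=1..N. \<Sum>m=1..N. \<Sum>r<N. mangoldt n * mangoldt m * e (of_int (int m - int n) * (real r / real N)))"
    by (intro sum.cong refl sum.swap)
  also have "\<dots> = (\<Sum>n=1..N. \<Sum>m=1..N. if m = n then mangoldt n * mangoldt n * of_nat N else 0)"
  proof (intro sum.cong refl)
    fix n m assume nm: "n \<in> {1..N}" "m \<in> {1..N}"
    have "(\<Sum>r<N. mangoldt n * mangoldt m * e (of_int (int m - int n) * (real r / real N))) = 
      mangoldt n * mangoldt m * (\<Sum>r<N. e (of_int (int m - int n) * (real r / real N)))"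
      by (simp only: sum_distrib_left)
    also have "(\<Sum>r<N. e (of_int (int m - int n) * (real r / real N))) = (if int m - int n = 0 then of_nat N else 0)"
      using nm assms by (intro sum_e_roots) auto
    finally show "(\<Sum>r<N. mangoldt n * mangoldt m * e (of_int (int m - int n) * (real r / real N))) = 
      (if m = n then mangoldt n * mangoldt n * of_nat N else (0 :: complex))" by auto
  qed
  also have "\<dots> = complex_of_real (\<Sum>n=1..N. (mangoldt n)\<^sup>2 * real N)"
    by (simp add: power2_eq_square)
  finally have "(\<Sum>\<xi>\<in>{0..<int N}. (cmod (mangoldt_hat N \<xi>))\<^sup>2) = (\<Sum>n=1..N. (mangoldt n)\<^sup>2 * real N)"
    by (simp only: of_real_eq_iff)
  also have "\<dots> \<le> (\<Sum>n=1..N. (ln (real N))\<^sup>2 * real N)"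
  proof (intro sum_mono mult_right_mono power_mono)
    fix n assume n: "n \<in> {1..N}"
    have "mangoldt n \<le> ln (real n)" using n by (intro mangoldt_le) auto
    also have "\<dots> \<le> ln (real N)" using n by simp
    finally show "mangoldt n \<le> ln (real N)" .
  qed (auto simp: mangoldt_nonneg)
  also have "\<dots> = (real N * ln (real N))\<^sup>2" by (simp add: power2_eq_square)
  finally show ?thesis .
qed

section \<open>Combining the three ranges of frequencies\<close>

lemma main_term_estimate:
  fixes \<delta> \<eta> t :: real
  assumes "\<bar>\<delta>\<bar> \<le> t" "t \<le> 1" "0 \<le> \<eta>" "\<eta> \<le> t"
  shows "\<bar>(1 + \<delta>)\<^sup>2 * (1 - \<eta>) - 1\<bar> \<le> 7 * t"
proof -
  have d: "\<bar>\<delta>\<bar> \<le> 1" using assms by linarith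
  have "(1 + \<delta>)\<^sup>2 * (1 - \<eta>) - 1 = \<delta> * (2 + \<delta>) - \<eta> * (1 + \<delta>)\<^sup>2"
    by (simp add: power2_eq_square algebra_simps)
  also have "\<bar>\<dots>\<bar> \<le> \<bar>\<delta> * (2 + \<delta>)\<bar> + \<bar>\<eta> * (1 + \<delta>)\<^sup>2\<bar>" by (rule abs_triangle_ineq4)
  also have "\<dots> \<le> t * 3 + t * 4"
  proof (rule add_mono)
    show "\<bar>\<delta> * (2 + \<delta>)\<bar> \<le> t * 3" unfolding abs_mult using assms d by (intro mult_mono) auto
    have "\<bar>1 + \<delta>\<bar> \<le> 2" using d by auto
    hence "\<bar>1 + \<delta>\<bar>\<^sup>2 \<le> 2\<^sup>2" by (intro power_mono) auto
    hence "(1 + \<delta>)\<^sup>2 \<le> 4" by simp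
    thus "\<bar>\<eta> * (1 + \<delta>)\<^sup>2\<bar> \<le> t * 4" unfolding abs_mult using assms by (intro mult_mono) auto
  qed
  finally show ?thesis by simp
qed

text \<open>The representative modulo N nearest to 0. It provides the |\<theta>| \<le> 1 / 2
  required for removing the floor, and its size separates the few exceptional frequencies from the
  rest.\<close>

definition centred_residue :: "nat \<Rightarrow> int \<Rightarrow> int" where
  "centred_residue N \<xi> = (if 2 * \<xi> \<le> int N then \<xi> else \<xi> - int N)"

lemma centred_residue_le: "\<xi> \<in> {0..<int N} \<Longrightarrow> 2 * \<bar>centred_residue N \<xi>\<bar> \<le> int N"
  by (auto simp: centred_residue_def)

lemma centred_residue_nonzero: "\<xi> \<in> {1..<int N} \<Longrightarrow> centred_residue N \<xi> \<noteq> 0"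
  by (auto simp: centred_residue_def)

lemma inj_on_centred_residue: "inj_on (centred_residue N) {0..<int N}"
  by (auto simp: inj_on_def centred_residue_def split: if_splits)

lemma mangoldt_hat_centred: "N > 0 \<Longrightarrow> mangoldt_hat N (centred_residue N \<xi>) = mangoldt_hat N \<xi>"
  by (simp add: centred_residue_def mangoldt_hat_periodic)

text \<open>Replacing \<xi> by \<xi> - N shifts the phase by the integer h: this is where
  integrality of the floor values enters.\<close>

lemma e_centred:
  assumes "N > 0"
  shows "e (- (of_int \<xi> * of_int h / real N)) = e (- (of_int (centred_residue N \<xi>) / real N) * of_int h)"
proof (cases "2 * \<xi> \<le> int N")
  case False
  have "- (of_int \<xi> * of_int h / real N) = - (of_int (\<xi> - int N) / real N) * of_int h + of_int (- h)"
    using assms by (simp add: field_simps)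
  thus ?thesis using False by (simp only: e_add_of_int centred_residue_def if_False)
qed (simp add: centred_residue_def)

lemma card_small_residues:
  assumes "R \<ge> 1"
  shows "real (card {\<xi> \<in> {1..<int N}. \<bar>real_of_int (centred_residue N \<xi>)\<bar> \<le> R}) \<le> 3 * R"
proof -
  let ?X = "{\<xi> \<in> {1..<int N}. \<bar>real_of_int (centred_residue N \<xi>)\<bar> \<le> R}"
  have "card ?X \<le> card {- \<lfloor>R\<rfloor>..\<lfloor>R\<rfloor>}"
  proof (rule card_inj_on_le)
    show "inj_on (centred_residue N) ?X" by (rule inj_on_subset[OF inj_on_centred_residue]) auto
    show "centred_residue N ` ?X \<subseteq> {- \<lfloor>R\<rfloor>..\<lfloor>R\<rfloor>}"
    proof (intro image_subsetI)
      fix \<xi> assume "\<xi> \<in> ?X"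
      hence "real_of_int (centred_residue N \<xi>) \<le> R" "real_of_int (- centred_residue N \<xi>) \<le> R" by auto
      hence "centred_residue N \<xi> \<le> \<lfloor>R\<rfloor>" "- centred_residue N \<xi> \<le> \<lfloor>R\<rfloor>" by (simp_all only: le_floor_iff)
      thus "centred_residue N \<xi> \<in> {- \<lfloor>R\<rfloor>..\<lfloor>R\<rfloor>}" by simp
    qed
  qed auto
  also have "real (card {- \<lfloor>R\<rfloor>..\<lfloor>R\<rfloor>}) = 2 * of_int \<lfloor>R\<rfloor> + 1" using assms by simp
  also have "\<dots> \<le> 3 * R" using assms by linarith
  finally show ?thesis by simp
qed

theorem theorem3p1:
  fixes c A :: real
  assumes "c > 2" and "c \<notin> \<int>" and "A \<ge> 1"
  shows "\<exists>B::real. B \<ge> 1 \<and>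
    (\<lambda>N::nat. let M = real N powr (1 / c) / ln (real N) powr B in
        (\<Sum>\<xi>\<in>{0..<int N}.
            complex_of_real ((cmod (mangoldt_hat N \<xi> / of_nat N))\<^sup>2) *
            (1 / complex_of_real M *
              (\<Sum>m = 1..nat \<lfloor>M\<rfloor>. e (- (of_int \<xi> * of_int \<lfloor>real m powr c\<rfloor> / real N))))) - 1)
      \<in> O(\<lambda>N. complex_of_real (1 / ln (real N) powr A))"
proof -
  define u where "u = 1 / c"
  have u: "0 < u" "u < 1" "u * c = 1" using assms(1) by (auto simp: u_def)
  define a where "a = nat \<lceil>A\<rceil>"
  have a: "A \<le> real a" "a \<ge> 1" using assms(3) unfolding a_def by linarith+
  \<comment> \<open>Two logarithms beyond \<open>a\<close>: those lost in Parseval.\<close>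
  define D where "D = a + 2"
  obtain B0 :: nat where B0: "\<forall>\<^sub>F P in sequentially. \<forall>\<theta>. \<bar>\<theta>\<bar> \<le> 1 / 2 \<longrightarrow> ln (real P) ^ B0 \<le> \<bar>\<theta>\<bar> * real P powr c \<longrightarrow>
    cmod (\<Sum>m=1..P. e (\<theta> * of_int \<lfloor>real m powr c\<rfloor>)) \<le> real P / ln (real P) ^ D"
    using floor_power_phase_sum[OF assms(2), of D] assms(1) by auto
  \<comment> \<open>\<open>L ^ B1\<close> must beat \<open>L ^ B0\<close> after the losses M^c = N /
    L^c and P \<ge> M / 2: \<lceil>c\<rceil> pays for L^c, the last 1 for 2^c.\<close>
  define B1 where "B1 = B0 + nat \<lceil>c\<rceil> + 1"
  \<comment> \<open>At most 3 R small residues contribute (R / L^j)^2 each, up to constants, so 2 j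
    \<ge> 3 B1 + a suffices.\<close>
  define j where "j = 2 * B1 + a"
  obtain C where C: "C > 0" and prime_error: "\<forall>\<^sub>F N in sequentially. \<forall>n\<le>N. \<bar>\<Sum>i=1..n. mangoldt i - 1 :: real\<bar> \<le> C * real N / ln (real N) ^ j"
    using uniform_prime_error[of j] by blast
  define M where "M N = real N powr u / ln (real N)" for N :: nat
  have "filterlim (\<lambda>N. M N) at_top sequentially" unfolding M_def using u by real_asymp
  hence "filterlim (\<lambda>N. nat \<lfloor>M N\<rfloor>) sequentially sequentially"
    by (intro filterlim_compose[OF filterlim_nat_sequentially] filterlim_compose[OF filterlim_floor_sequentially])
  note ev1 = eventually_compose_filterlim[OF B0 this]
  have ev2: "\<forall>\<^sub>F N in sequentially. M N \<ge> 2" unfolding M_def using u by real_asymp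
  have ev3: "\<forall>\<^sub>F N in sequentially. ln (real N) \<ge> max 1 (max (2 powr c) (C + 1))" by real_asymp
  have ev4: "\<forall>\<^sub>F N in sequentially. ln (real N) ^ a \<le> M N" unfolding M_def using u by real_asymp
  \<comment> \<open>Savings arise as powers of ln P with P about M; this inequality converts them
    into powers of ln N at the cost (2 c)^D.\<close>
  have ev5: "\<forall>\<^sub>F N in sequentially. ln (M N / 2) \<ge> u / 2 * ln (real N)" unfolding M_def using u by real_asymp
  \<comment> \<open>The terms belong to the frequency 0, to the small residues, where 243 = 3 * 9^2,
    and to the remaining frequencies.\<close>
  define K where "K = 7 * (C + 1) + (243 * C\<^sup>2 + (2 * c) ^ D)"
  have bound: "\<forall>\<^sub>F N in sequentially. cmod ((\<Sum>\<xi>\<in>{0..<int N}.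
            complex_of_real ((cmod (mangoldt_hat N \<xi> / of_nat N))\<^sup>2) *
            (1 / complex_of_real (M N) *
              (\<Sum>m = 1..nat \<lfloor>M N\<rfloor>. e (- (of_int \<xi> * of_int \<lfloor>real m powr c\<rfloor> / real N))))) - 1) \<le> K / ln (real N) ^ a"
    using ev1 ev2 ev3 ev4 ev5 prime_error
  proof eventually_elim
    case (elim N)
    define L where "L = ln (real N)"
    define P where "P = nat \<lfloor>M N\<rfloor>"
    have L: "1 \<le> L" "2 powr c \<le> L" "C + 1 \<le> L" using elim(3) by (auto simp: L_def)
    have Lp: "1 \<le> L ^ n" for n using L by (intro one_le_power)
    have N0: "N > 0" using L by (cases "N = 0") (auto simp: L_def)
    have M2: "2 \<le> M N" by fact
    have P: "real P \<le> M N" "M N - 1 \<le> real P" using M2 unfolding P_def by linarith+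
    have P2: "M N / 2 \<le> real P" "1 \<le> real P" using P M2 by linarith+
    define E where "E \<xi> = (\<Sum>m = 1..P. e (- (of_int \<xi> * of_int \<lfloor>real m powr c\<rfloor> / real N)))" for \<xi>
    define G where "G \<xi> = complex_of_real ((cmod (mangoldt_hat N \<xi> / of_nat N))\<^sup>2) * (1 / complex_of_real (M N) * E \<xi>)" for \<xi>
    define R where "R = L ^ B1"
    have R: "R \<ge> 1" using Lp by (simp add: R_def)
    let ?r = "\<lambda>\<xi>. real_of_int (centred_residue N \<xi>)"
    let ?X = "{\<xi> \<in> {1..<int N}. \<bar>?r \<xi>\<bar> \<le> R}" and ?Y = "{\<xi> \<in> {1..<int N}. \<not> \<bar>?r \<xi>\<bar> \<le> R}"
    have S: "\<bar>\<Sum>i=1..n. mangoldt i - 1 :: real\<bar> \<le> C * real N / L ^ j" if "n \<le> N" for n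
      using elim(6) that by (auto simp: L_def)
    have nG: "cmod (G \<xi>) = (cmod (mangoldt_hat N \<xi>))\<^sup>2 / (real N)\<^sup>2 * (cmod (E \<xi>) / M N)" for \<xi>
      using M2 by (simp add: G_def norm_mult norm_divide norm_power power_divide)
    have Ele: "cmod (E \<xi>) / M N \<le> 1" for \<xi>
    proof -
      have "cmod (E \<xi>) \<le> (\<Sum>m=1..P. 1)" unfolding E_def by (rule sum_norm_le) simp
      hence "cmod (E \<xi>) \<le> M N" using P by simp
      thus ?thesis using M2 by simp
    qed
    have Ebig: "cmod (E \<xi>) / M N \<le> (2 * c) ^ D / L ^ D" if \<xi>: "\<xi> \<in> ?Y" for \<xi>
    proof -
      define \<theta> where "\<theta> = - (?r \<xi> / real N)"
      have E: "E \<xi> = (\<Sum>m=1..P. e (\<theta> * of_int \<lfloor>real m powr c\<rfloor>))"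
        unfolding E_def \<theta>_def using N0 by (intro sum.cong refl e_centred)
      have "2 * \<bar>centred_residue N \<xi>\<bar> \<le> int N" using \<xi> by (intro centred_residue_le) auto
      hence "2 * \<bar>?r \<xi>\<bar> \<le> real N" by linarith
      hence \<theta>1: "\<bar>\<theta>\<bar> \<le> 1 / 2" using N0 by (simp add: \<theta>_def abs_divide field_simps)
      have \<theta>2: "R / real N \<le> \<bar>\<theta>\<bar>" using \<xi> N0 by (simp add: \<theta>_def abs_divide divide_right_mono)
      have MN: "M N \<le> real N"
      proof -
        have "real N powr u \<le> real N powr 1" using u N0 by (intro powr_mono) auto
        also have "\<dots> \<le> real N * L" using N0 L by simp
        finally show ?thesis using L by (simp add: M_def L_def field_simps)
      qed
      have lnP: "0 \<le> ln (real P)" "ln (real P) \<le> L" using P P2 MN N0 by (auto simp: L_def)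
      have "R * (1 / (2 powr c * L powr c)) \<ge> L ^ B0"
      proof -
        have "L powr c \<le> L powr real (nat \<lceil>c\<rceil>)" using L by (intro powr_mono) linarith+
        also have "\<dots> = L ^ nat \<lceil>c\<rceil>" using L by (intro powr_realpow) auto
        finally have "2 powr c * L powr c \<le> L * L ^ nat \<lceil>c\<rceil>" using L by (intro mult_mono) auto
        hence "L ^ B0 * (2 powr c * L powr c) \<le> L ^ B0 * (L * L ^ nat \<lceil>c\<rceil>)" using Lp[of B0] by (intro mult_left_mono) auto
        also have "\<dots> = R" by (simp add: R_def B1_def power_add)
        finally show ?thesis using L by (simp add: field_simps)
      qed
      also have "R * (1 / (2 powr c * L powr c)) = R / real N * (M N / 2) powr c"
      proof -
        have "(real N powr u) powr c = real N" using u N0 by (simp add: powr_powr)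
        hence "(M N / 2) powr c = real N / (L powr c * 2 powr c)"
          using L N0 by (simp add: M_def L_def powr_divide powr_mult)
        thus ?thesis using N0 by simp
      qed
      also have "\<dots> \<le> \<bar>\<theta>\<bar> * real P powr c"
        using \<theta>2 P2 M2 assms(1) R by (intro mult_mono powr_mono2) auto
      finally have "ln (real P) ^ B0 \<le> \<bar>\<theta>\<bar> * real P powr c"
        using power_mono[OF lnP(2,1), of B0] by linarith
      hence "cmod (E \<xi>) \<le> real P / ln (real P) ^ D"
        unfolding E using elim(1) \<theta>1 by (auto simp: P_def)
      also have "\<dots> \<le> M N / (u / 2 * L) ^ D"
      proof (intro frac_le power_mono)
        have "ln (M N / 2) \<le> ln (real P)" using P2 M2 by simp
        thus "u / 2 * L \<le> ln (real P)" using elim(5) by (simp add: L_def)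
      qed (use P M2 u L in auto)
      finally have "cmod (E \<xi>) / M N \<le> 1 / (u / 2 * L) ^ D" using M2 by (simp add: field_simps)
      also have "u / 2 * L = L / (2 * c)" by (simp add: u_def)
      finally show ?thesis by (simp add: power_divide)
    qed
    have Ysum: "cmod (\<Sum>\<xi>\<in>?Y. G \<xi>) \<le> (2 * c) ^ D / L ^ a"
    proof -
      have "cmod (\<Sum>\<xi>\<in>?Y. G \<xi>) \<le> (\<Sum>\<xi>\<in>?Y. (cmod (mangoldt_hat N \<xi>))\<^sup>2 * ((2 * c) ^ D / L ^ D / (real N)\<^sup>2))"
      proof (rule sum_norm_le)
        fix \<xi> assume "\<xi> \<in> ?Y"
        from mult_left_mono[OF Ebig[OF this], of "(cmod (mangoldt_hat N \<xi>))\<^sup>2 / (real N)\<^sup>2"]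
        show "cmod (G \<xi>) \<le> (cmod (mangoldt_hat N \<xi>))\<^sup>2 * ((2 * c) ^ D / L ^ D / (real N)\<^sup>2)"
          unfolding nG by (simp add: mult_ac)
      qed
      also have "\<dots> = (\<Sum>\<xi>\<in>?Y. (cmod (mangoldt_hat N \<xi>))\<^sup>2) * ((2 * c) ^ D / L ^ D / (real N)\<^sup>2)"
        by (rule sum_distrib_right[symmetric])
      also have "\<dots> \<le> (real N * L)\<^sup>2 * ((2 * c) ^ D / L ^ D / (real N)\<^sup>2)"
      proof (rule mult_right_mono)
        have "(\<Sum>\<xi>\<in>?Y. (cmod (mangoldt_hat N \<xi>))\<^sup>2) \<le> (\<Sum>\<xi>\<in>{0..<int N}. (cmod (mangoldt_hat N \<xi>))\<^sup>2)"
          by (intro sum_mono2) auto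
        also have "\<dots> \<le> (real N * L)\<^sup>2" unfolding L_def by (rule mangoldt_hat_square_sum[OF N0])
        finally show "(\<Sum>\<xi>\<in>?Y. (cmod (mangoldt_hat N \<xi>))\<^sup>2) \<le> (real N * L)\<^sup>2" .
      qed (use L assms(1) in auto)
      also have "\<dots> = (2 * c) ^ D * (L\<^sup>2 / L ^ D)" using N0 by (simp add: power_mult_distrib)
      also have "L\<^sup>2 / L ^ D = 1 / L ^ a" using L by (simp add: D_def power_add power2_eq_square)
      finally show ?thesis by simp
    qed
    have Xsum: "cmod (\<Sum>\<xi>\<in>?X. G \<xi>) \<le> 243 * C\<^sup>2 / L ^ a"
    proof -
      have "cmod (\<Sum>\<xi>\<in>?X. G \<xi>) \<le> (\<Sum>\<xi>\<in>?X. (9 * C * R / L ^ j)\<^sup>2)"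
      proof (rule sum_norm_le)
        fix \<xi> assume \<xi>: "\<xi> \<in> ?X"
        have "2 * \<bar>centred_residue N \<xi>\<bar> \<le> int N" using \<xi> by (intro centred_residue_le) auto
        hence lt: "\<bar>centred_residue N \<xi>\<bar> < int N" using N0 by linarith
        have "cmod (mangoldt_hat N \<xi>) = cmod (mangoldt_hat N (centred_residue N \<xi>))"
          using N0 by (simp add: mangoldt_hat_centred)
        also have "\<dots> \<le> C * real N / L ^ j * (1 + 2 * pi * of_int \<bar>centred_residue N \<xi>\<bar>)"
          using \<xi> by (intro mangoldt_hat_bound S lt centred_residue_nonzero) auto
        also have "\<dots> \<le> C * real N / L ^ j * (9 * R)"
        proof (intro mult_left_mono)
          have "2 * pi * of_int \<bar>centred_residue N \<xi>\<bar> \<le> 8 * R"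
            using \<xi> pi_less_4 by (intro mult_mono) auto
          thus "1 + 2 * pi * of_int \<bar>centred_residue N \<xi>\<bar> \<le> 9 * R" using R by linarith
        qed (use C L in auto)
        also have "\<dots> = real N * (9 * C * R / L ^ j)" by simp
        finally have "(cmod (mangoldt_hat N \<xi>))\<^sup>2 \<le> (real N * (9 * C * R / L ^ j))\<^sup>2" by (intro power_mono) auto
        hence "(cmod (mangoldt_hat N \<xi>))\<^sup>2 / (real N)\<^sup>2 \<le> (9 * C * R / L ^ j)\<^sup>2"
          unfolding power_mult_distrib[of "real N"] using N0 by (simp add: divide_le_eq mult.commute)
        hence "cmod (G \<xi>) \<le> (9 * C * R / L ^ j)\<^sup>2 * 1"
          unfolding nG using Ele M2 by (intro mult_mono) auto
        thus "cmod (G \<xi>) \<le> (9 * C * R / L ^ j)\<^sup>2" by simp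
      qed
      also have "\<dots> = real (card ?X) * (9 * C * R / L ^ j)\<^sup>2" by simp
      also have "\<dots> \<le> (3 * R) * (9 * C * R / L ^ j)\<^sup>2"
        by (intro mult_right_mono card_small_residues R) auto
      also have "\<dots> = 243 * C\<^sup>2 * (R ^ 3 / L ^ (2 * j))"
        by (simp add: power2_eq_square power3_eq_cube mult_2 power_add)
      also have "R ^ 3 / L ^ (2 * j) \<le> 1 / L ^ a"
      proof -
        have "R ^ 3 * L ^ a = L ^ (3 * B1 + a)" by (simp add: R_def power_add power_mult[symmetric] mult.commute)
        also have "\<dots> \<le> L ^ (2 * j)" using L by (intro power_increasing) (auto simp: j_def)
        finally show ?thesis using L by (simp add: field_simps)
      qed
      finally show ?thesis by (simp add: mult_left_mono)
    qed
    have zero: "cmod (G 0 - 1) \<le> 7 * ((C + 1) / L ^ a)"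
    proof -
      \<comment> \<open>\<delta> is the relative error of the Chebyshev function at N. \<eta> is the
        loss from dividing by M although only \<lfloor>M\<rfloor> terms are summed; it is at most 1
        / M.\<close>
      define \<delta> where "\<delta> = (\<Sum>i=1..N. mangoldt i - 1) / real N"
      define \<eta> where "\<eta> = 1 - real P / M N"
      have "(\<Sum>i=1..N. mangoldt i - 1 :: real) = (\<Sum>i=1..N. mangoldt i) - real N" by (simp add: sum_subtractf)
      hence "(\<Sum>i=1..N. mangoldt i :: real) = real N * (1 + \<delta>)" using N0 by (simp add: \<delta>_def field_simps)
      moreover have "mangoldt_hat N 0 = of_real (\<Sum>i=1..N. mangoldt i)" by (simp add: mangoldt_hat_def)
      ultimately have "mangoldt_hat N 0 / of_nat N = of_real (1 + \<delta>)" using N0 by simp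
      hence "cmod (mangoldt_hat N 0 / of_nat N) = \<bar>1 + \<delta>\<bar>" by (simp only: norm_of_real)
      moreover have "1 / complex_of_real (M N) * E 0 = of_real (1 - \<eta>)" by (simp add: E_def \<eta>_def)
      ultimately have "G 0 - 1 = of_real ((1 + \<delta>)\<^sup>2 * (1 - \<eta>) - 1)" by (simp add: G_def)
      hence "cmod (G 0 - 1) = \<bar>(1 + \<delta>)\<^sup>2 * (1 - \<eta>) - 1\<bar>" by (simp only: norm_of_real)
      also have "\<dots> \<le> 7 * ((C + 1) / L ^ a)"
      proof (rule main_term_estimate)
        have "\<bar>\<delta>\<bar> \<le> (C * real N / L ^ j) / real N"
          unfolding \<delta>_def abs_divide abs_of_nat by (intro divide_right_mono S) auto
        also have "\<dots> = C / L ^ j" using N0 by simp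
        also have "\<dots> \<le> (C + 1) / L ^ a" using C L Lp by (intro frac_le power_increasing) (auto simp: j_def)
        finally show "\<bar>\<delta>\<bar> \<le> (C + 1) / L ^ a" .
        have "L ^ 1 \<le> L ^ a" using L a by (intro power_increasing) auto
        hence "C + 1 \<le> L ^ a" using L by simp
        thus "(C + 1) / L ^ a \<le> 1" using L by (simp add: divide_le_eq)
        show "0 \<le> \<eta>" using P M2 by (simp add: \<eta>_def)
        have "\<eta> = (M N - real P) / M N" using M2 by (simp add: \<eta>_def diff_divide_distrib)
        also have "\<dots> \<le> (C + 1) / L ^ a" using P C M2 elim(4) L by (intro frac_le) (auto simp: L_def)
        finally show "\<eta> \<le> (C + 1) / L ^ a" .
      qed
      finally show ?thesis .
    qed
    have fin: "finite ?X" "finite ?Y" by (rule finite_subset[of _ "{1..<int N}"]; auto)+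
    have "{0..<int N} = insert 0 (?X \<union> ?Y)" using N0 by auto
    hence "(\<Sum>\<xi>\<in>{0..<int N}. G \<xi>) = (\<Sum>\<xi>\<in>insert 0 (?X \<union> ?Y). G \<xi>)" by (rule arg_cong)
    also have "\<dots> = G 0 + (\<Sum>\<xi>\<in>?X \<union> ?Y. G \<xi>)"
      by (rule sum.insert[OF finite_UnI[OF fin]]) auto
    also have "(\<Sum>\<xi>\<in>?X \<union> ?Y. G \<xi>) = (\<Sum>\<xi>\<in>?X. G \<xi>) + (\<Sum>\<xi>\<in>?Y. G \<xi>)"
      by (rule sum.union_disjoint[OF fin]) auto
    finally have "(\<Sum>\<xi>\<in>{0..<int N}. G \<xi>) - 1 = (G 0 - 1) + ((\<Sum>\<xi>\<in>?X. G \<xi>) + (\<Sum>\<xi>\<in>?Y. G \<xi>))" by simp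
    also have "cmod \<dots> \<le> 7 * ((C + 1) / L ^ a) + (243 * C\<^sup>2 / L ^ a + (2 * c) ^ D / L ^ a)"
      by (intro norm_triangle_le add_mono zero norm_triangle_le[of "\<Sum>\<xi>\<in>?X. G \<xi>"] Xsum Ysum)
    also have "\<dots> = K / L ^ a" by (simp add: K_def add_divide_distrib)
    finally show ?case unfolding G_def E_def P_def L_def .
  qed
  show ?thesis
  proof (intro exI[of _ 1] conjI bigoI[where c = K])
    show "\<forall>\<^sub>F N in sequentially. norm (let M = real N powr (1 / c) / ln (real N) powr 1 in
        (\<Sum>\<xi>\<in>{0..<int N}.
            complex_of_real ((cmod (mangoldt_hat N \<xi> / of_nat N))\<^sup>2) *
            (1 / complex_of_real M *
              (\<Sum>m = 1..nat \<lfloor>M\<rfloor>. e (- (of_int \<xi> * of_int \<lfloor>real m powr c\<rfloor> / real N))))) - 1)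
      \<le> K * norm (complex_of_real (1 / ln (real N) powr A))"
      using bound ev3
    proof eventually_elim
      case (elim N)
      have L: "ln (real N) \<ge> 1" using elim(2) by simp
      have M: "real N powr (1 / c) / ln (real N) powr 1 = M N" using L by (simp add: M_def u_def)
      have K: "K \<ge> 0" using C assms(1) by (simp add: K_def)
      have "ln (real N) powr A \<le> ln (real N) powr real a" using L a by (intro powr_mono) auto
      also have "\<dots> = ln (real N) ^ a" using L by (intro powr_realpow) auto
      finally have "K / ln (real N) ^ a \<le> K / ln (real N) powr A" using K L by (intro divide_left_mono) auto
      also have "\<dots> = K * norm (complex_of_real (1 / ln (real N) powr A))" using L by (simp add: norm_divide)
      finally show ?case using elim(1) unfolding M Let_def by linarith
    qed
  qed simp
qed

end
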